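(* Let $\theta\in\mathcal A$ be a maximal claim in $\mathcal A$ (or indeed, viewed as a random variable on $\tilde\Omega$, a maximal claim in $\tilde{\mathcal A}$). Then there exists a sequence $(\theta^n)_{n\ge1}$ of properly maximal claims in $\tilde{\mathcal A}$ which converges almost surely to $\theta$.
   Context: $(\Omega,\mathcal F,(\mathcal F_t)_{t=0,\ldots,T},\mathbb P)$ is a filtered probability space. $m\mathcal F_t^+$ is the set of nonnegative real-valued $\mathcal F_t$-measurable functions. $L^0_d=L^0(\mathcal F,\mathbb R^d)$ carries the topology of convergence in probability (closures are taken in it); inequalities are componentwise; $L^{0,+}_d$ is the set of a.s. nonnegative elements. A finitely $\mathcal F_t$-generated convex cone is a set $\{\sum_{i=1}^n\alpha_i\Pi^i:\alpha_i\in m\mathcal F_t^+\}$ for some $\mathcal F_t$-measurable $\mathbb R^d$-valued $\Pi^1,\ldots,\Pi^n$. Standing assumptions on the market: $\mathcal A=K_0+\cdots+K_T$ (the cone of claims attainable from $0$), where each $K_t$ is a finitely $\mathcal F_t$-generated convex cone, $K_T$ contains all a.s. nonpositive $\mathcal F_T$-measurable $\mathbb R^d$-valued random variables (assets may be burned), $\mathcal A$ is arbitrage-free ($\mathcal A\cap L^{0,+}_d=\{0\}$), and whenever $(\xi_0,\ldots,\xi_T)\in K_0\times\cdots\times K_T$ satisfies $\sum_t\xi_t=0$ a.s., all $\xi_t=0$. Consequently $\mathcal A$ is closed. Randomized market: $\hat\Omega_t=\mathbb N=\{1,2,\ldots\}$ and $\hat\sigma_t=2^{\hat\Omega_t}$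 for $t=1,\ldots,T$; $\hat\Omega=\hat\Omega_1\times\cdots\times\hat\Omega_T$; $\hat{\mathcal F}_t$ is the $\sigma$-algebra on $\hat\Omega$ generated by the first $t$ coordinates (i.e. $\hat\sigma_1\otimes\cdots\otimes\hat\sigma_t$; trivial for $t=0$); $\tilde\Omega=\Omega\times\hat\Omega$, $\tilde{\mathcal F}_t=\mathcal F_t\otimes\hat{\mathcal F}_t$, and $\tilde{\mathbb P}=\mathbb P\otimes\hat{\mathbb P}\otimes\cdots\otimes\hat{\mathbb P}$ ($T$ factors $\hat{\mathbb P}$), where $\hat{\mathbb P}(\{k\})=2^{-k}$ on $\mathbb N$. If $K_t=\{\sum_i\alpha_i\Pi^i_t:\alpha_i\in m\mathcal F_t^+\}$ then $\tilde K_t=\{\sum_i\alpha_i\Pi^i_t:\alpha_i\in m\tilde{\mathcal F}_t^+\}$ (same generators), and $\tilde{\mathcal A}=\tilde K_0+\cdots+\tilde K_T$. Random variables on $\Omega$ are regarded as random variables on $\tilde\Omega$ not depending on the second coordinate. Let $\mathcal D$ be $\mathcal A$ or $\tilde{\mathcal A}$. A claim $X\in\mathcal D$ is maximal in $\mathcal D$ if $W\in\mathcal D$ and $W\ge X$ a.s. imply $W=X$ a.s. It is properly maximal in $\mathcal D$ if the $L^0$-closure of $[\mathcal D,X]=\{a-\lambda X:a\in\mathcal D,\lambda\ge0\}$ contains no nonzero a.s. nonnegative element. Here the $L^0$ space is over $(\Omega,\mathbb P)$ for $\mathcal A$ and over $(\tilde\Omega,\tilde{\mathbb P})$ for $\tilde{\mathcal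 A}$. Almost sure convergence is with respect to $\tilde{\mathbb P}$. *)

theory Defs
  imports "HOL-Probability.Probability"
begin

section \<open>The topology of convergence in probability\<close>

text \<open>
  Elements of \<open>L\<^sup>0\<close> are represented by measurable functions. All the sets of random variables used
  below are invariant under almost sure equality, and equality of random variables is always stated
  almost surely, so that working with representatives amounts to working with classes.
\<close>

abbreviation L0 :: "'b measure \<Rightarrow> ('b \<Rightarrow> real^'d) set" where
  "L0 N \<equiv> borel_measurable N"

definition L0_ball :: "'b measure \<Rightarrow> ('b \<Rightarrow> real^'d) \<Rightarrow> real \<Rightarrow> ('b \<Rightarrow> real^'d) set" where
  "L0_ball N X e = {Y \<in> L0 N. measure N {\<omega> \<in> space N. norm (Y \<omega> - X \<omega>) > e} < e}"

text \<open>On a probability space the sets \<open>L0_ball N X e\<close> with \<open>e > 0\<close> form a base of neighbourhoods of \<open>X\<close>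
  (they are the balls of the Ky Fan metric up to passing between strict and weak inequalities); see
  \<open>L0_closure_sequential\<close> for the connection with sequences.\<close>

definition L0_topology :: "'b measure \<Rightarrow> ('b \<Rightarrow> real^'d) topology" where
  "L0_topology N = topology (\<lambda>U. U \<subseteq> L0 N \<and> (\<forall>X\<in>U. \<exists>e>0. L0_ball N X e \<subseteq> U))"

lemma L0_ball_mono:
  assumes "prob_space N" "X \<in> L0 N" "d \<le> e"
  shows "L0_ball N X d \<subseteq> L0_ball N X e"
proof
  interpret prob_space N by fact
  fix Y assume Y: "Y \<in> L0_ball N X d"
  have [measurable]: "X \<in> L0 N" "Y \<in> L0 N" using assms Y by (auto simp: L0_ball_def)
  have "measure N {\<omega> \<in> space N. norm (Y \<omega> - X \<omega>) > e} \<le> measure N {\<omega> \<in> space N. norm (Y \<omega> - X \<omega>) > d}"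
    by (rule finite_measure_mono) (use assms in auto)
  also have "\<dots> < d" using Y by (auto simp: L0_ball_def)
  finally show "Y \<in> L0_ball N X e" using assms by (auto simp: L0_ball_def)
qed

lemma openin_L0_topology:
  fixes U :: "('b \<Rightarrow> real^'d) set"
  assumes "prob_space N"
  shows "openin (L0_topology N) U \<longleftrightarrow> U \<subseteq> L0 N \<and> (\<forall>X\<in>U. \<exists>e>0. L0_ball N X e \<subseteq> U)"
proof -
  have "istopology (\<lambda>U :: ('b \<Rightarrow> real^'d) set. U \<subseteq> L0 N \<and> (\<forall>X\<in>U. \<exists>e>0. L0_ball N X e \<subseteq> U))"
    unfolding istopology_def
  proof (intro conjI allI impI ballI)
    fix S U :: "('b \<Rightarrow> real^'d) set" and X
    assume S: "S \<subseteq> L0 N \<and> (\<forall>X\<in>S. \<exists>e>0. L0_ball N X e \<subseteq> S)"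
      and U: "U \<subseteq> L0 N \<and> (\<forall>X\<in>U. \<exists>e>0. L0_ball N X e \<subseteq> U)" and X: "X \<in> S \<inter> U"
    obtain d e where "d > 0" "L0_ball N X d \<subseteq> S" "e > 0" "L0_ball N X e \<subseteq> U"
      using S U X by blast
    moreover have "L0_ball N X (min d e) \<subseteq> L0_ball N X d" "L0_ball N X (min d e) \<subseteq> L0_ball N X e"
      by (rule L0_ball_mono[OF assms]; use S X in auto)+
    ultimately show "\<exists>e>0. L0_ball N X e \<subseteq> S \<inter> U"
      by (intro exI[of _ "min d e"]) auto
  next
    fix \<U> :: "('b \<Rightarrow> real^'d) set set" and X
    assume U: "\<forall>U\<in>\<U>. U \<subseteq> L0 N \<and> (\<forall>X\<in>U. \<exists>e>0. L0_ball N X e \<subseteq> U)" and "X \<in> \<Union>\<U>"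
    then obtain U where "U \<in> \<U>" "X \<in> U" by blast
    moreover from this obtain e where "e > 0" "L0_ball N X e \<subseteq> U" using U by blast
    ultimately show "\<exists>e>0. L0_ball N X e \<subseteq> \<Union>\<U>" by blast
  qed auto
  then show ?thesis by (simp add: L0_topology_def)
qed

lemma topspace_L0_topology:
  assumes "prob_space N" shows "topspace (L0_topology N) = L0 N"
proof
  have "openin (L0_topology N) (topspace (L0_topology N))" by simp
  then show "topspace (L0_topology N) \<subseteq> L0 N"
    unfolding openin_L0_topology[OF assms] by (rule conjunct1)
  have "openin (L0_topology N) (L0 N)"
    unfolding openin_L0_topology[OF assms]
    by (intro conjI ballI exI[of _ 1]) (auto simp: L0_ball_def)
  then show "L0 N \<subseteq> topspace (L0_topology N)" by (rule openin_subset)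
qed

lemma L0_ball_triangle:
  assumes "prob_space N" "X \<in> L0 N" "Y \<in> L0_ball N X (e / 2)" "Z \<in> L0_ball N Y (e / 2)"
  shows "Z \<in> L0_ball N X e"
proof -
  interpret prob_space N by fact
  have [measurable]: "X \<in> L0 N" "Y \<in> L0 N" "Z \<in> L0 N" using assms by (auto simp: L0_ball_def)
  let ?A = "{\<omega> \<in> space N. norm (Y \<omega> - X \<omega>) > e / 2}"
  let ?B = "{\<omega> \<in> space N. norm (Z \<omega> - Y \<omega>) > e / 2}"
  have "\<omega> \<in> ?A \<union> ?B" if "\<omega> \<in> space N" "norm (Z \<omega> - X \<omega>) > e" for \<omega>
    using that norm_triangle_ineq[of "Z \<omega> - Y \<omega>" "Y \<omega> - X \<omega>"] by auto
  then have "measure N {\<omega> \<in> space N. norm (Z \<omega> - X \<omega>) > e} \<le> measure N (?A \<union> ?B)"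
    by (intro finite_measure_mono) auto
  also have "\<dots> \<le> measure N ?A + measure N ?B" by (rule measure_subadditive) (auto simp: emeasure_eq_measure)
  also have "\<dots> < e" using assms(3,4) by (auto simp: L0_ball_def)
  finally show ?thesis by (simp add: L0_ball_def)
qed

lemma L0_closure_iff:
  assumes "prob_space N"
  shows "X \<in> L0_topology N closure_of S \<longleftrightarrow> X \<in> L0 N \<and> (\<forall>e>0. S \<inter> L0_ball N X e \<noteq> {})"
proof (intro iffI conjI allI impI)
  assume X: "X \<in> L0_topology N closure_of S"
  then show XL: "X \<in> L0 N" by (simp add: in_closure_of topspace_L0_topology[OF assms])
  fix e :: real assume e: "e > 0"
  define V where "V = {Y \<in> L0 N. \<exists>d>0. L0_ball N Y d \<subseteq> L0_ball N X e}"
  have self: "Y \<in> L0_ball N Y d" if "Y \<in> L0 N" "d > 0" for Y :: "'a \<Rightarrow> real^'b" and d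
    using that by (simp add: L0_ball_def)
  have "openin (L0_topology N) V"
    unfolding openin_L0_topology[OF assms]
  proof (intro conjI ballI)
    fix Y assume "Y \<in> V"
    then obtain d where d: "Y \<in> L0 N" "d > 0" "L0_ball N Y d \<subseteq> L0_ball N X e" by (auto simp: V_def)
    have "L0_ball N Y (d / 2) \<subseteq> V"
    proof
      fix Z assume Z: "Z \<in> L0_ball N Y (d / 2)"
      have "L0_ball N Z (d / 2) \<subseteq> L0_ball N X e"
        using L0_ball_triangle[OF assms d(1) Z] d(3) by blast
      moreover have "Z \<in> L0 N" using Z by (simp add: L0_ball_def)
      ultimately show "Z \<in> V" using half_gt_zero[OF d(2)] unfolding V_def by blast
    qed
    then show "\<exists>e>0. L0_ball N Y e \<subseteq> V" using d(2) half_gt_zero by blast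
  qed (auto simp: V_def)
  moreover have "X \<in> V" using XL e by (auto simp: V_def)
  ultimately obtain Y where "Y \<in> S" "Y \<in> V" using X by (auto simp: in_closure_of)
  then show "S \<inter> L0_ball N X e \<noteq> {}" using self by (auto simp: V_def)
next
  assume X: "X \<in> L0 N \<and> (\<forall>e>0. S \<inter> L0_ball N X e \<noteq> {})"
  then show "X \<in> L0_topology N closure_of S"
    unfolding in_closure_of topspace_L0_topology[OF assms] openin_L0_topology[OF assms] by blast
qed

lemma L0_closure_sequential:
  assumes "prob_space N"
  shows "X \<in> L0_topology N closure_of S \<longleftrightarrow> X \<in> L0 N \<and>
    (\<exists>f. (\<forall>n. f n \<in> S \<inter> L0 N) \<and>
      (\<forall>e>0. (\<lambda>n::nat. measure N {\<omega> \<in> space N. norm (f n \<omega> - X \<omega>) > e}) \<longlonglongrightarrow> 0))"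
    (is "?l \<longleftrightarrow> ?r")
proof
  interpret prob_space N by fact
  assume ?l
  then have XL[measurable]: "X \<in> L0 N" and ne: "\<And>e. e > 0 \<Longrightarrow> S \<inter> L0_ball N X e \<noteq> {}"
    by (auto simp: L0_closure_iff[OF assms])
  have "\<exists>f. f \<in> S \<inter> L0_ball N X (1 / Suc n)" for n using ne[of "1 / Suc n"] by auto
  then obtain f where f: "\<And>n. f n \<in> S \<inter> L0_ball N X (1 / Suc n)" by metis
  then have fL[measurable]: "f n \<in> L0 N" for n by (auto simp: L0_ball_def)
  have "(\<lambda>n. measure N {\<omega> \<in> space N. norm (f n \<omega> - X \<omega>) > e}) \<longlonglongrightarrow> 0" if e: "e > 0" for e
  proof (rule tendsto_sandwich[OF _ _ tendsto_const LIMSEQ_Suc[OF lim_1_over_n]])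
    have "\<forall>\<^sub>F n in sequentially. 1 / real (Suc n) < e"
      using LIMSEQ_Suc[OF lim_1_over_n] e by (rule order_tendstoD)
    then show "\<forall>\<^sub>F n in sequentially. measure N {\<omega> \<in> space N. norm (f n \<omega> - X \<omega>) > e} \<le> 1 / real (Suc n)"
    proof eventually_elim
      case (elim n)
      then show ?case
        using L0_ball_mono[OF assms XL, of "1 / real (Suc n)" e] f[of n]
          finite_measure_mono[of "{\<omega> \<in> space N. norm (f n \<omega> - X \<omega>) > e}"
            "{\<omega> \<in> space N. norm (f n \<omega> - X \<omega>) > 1 / real (Suc n)}"]
        by (force simp: L0_ball_def)
    qed
  qed simp
  then show ?r using f XL by (intro conjI exI[of _ f]) (auto simp: L0_ball_def)
next
  assume ?r
  then obtain f where X: "X \<in> L0 N" and f: "\<And>n. f n \<in> S \<inter> L0 N"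
    and lim: "\<And>e. e > 0 \<Longrightarrow> (\<lambda>n::nat. measure N {\<omega> \<in> space N. norm (f n \<omega> - X \<omega>) > e}) \<longlonglongrightarrow> 0"
    by blast
  have "S \<inter> L0_ball N X e \<noteq> {}" if "e > 0" for e
  proof -
    have "\<forall>\<^sub>F n in sequentially. measure N {\<omega> \<in> space N. norm (f n \<omega> - X \<omega>) > e} < e"
      using lim[OF that] that by (rule order_tendstoD)
    then obtain n where "measure N {\<omega> \<in> space N. norm (f n \<omega> - X \<omega>) > e} < e"
      by (auto simp: eventually_sequentially)
    then show ?thesis using f[of n] by (auto simp: L0_ball_def)
  qed
  then show ?l using X by (simp add: L0_closure_iff[OF assms])
qed


section \<open>Trading cones and maximal claims\<close>

definition nonneg_measurable :: "'b measure \<Rightarrow> ('b \<Rightarrow> real) set" where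
  "nonneg_measurable G = {\<alpha> \<in> borel_measurable G. \<forall>\<omega>\<in>space G. 0 \<le> \<alpha> \<omega>}"

text \<open>The finitely \<open>G\<close>-generated convex cone, as a subset of \<open>L\<^sup>0(N)\<close>: here \<open>G\<close> is the
  \<open>\<sigma>\<close>-algebra of the coefficients, and representatives are taken up to \<open>N\<close>-a.s. equality.\<close>

definition generated_cone ::
    "'b measure \<Rightarrow> 'b measure \<Rightarrow> nat \<Rightarrow> (nat \<Rightarrow> 'b \<Rightarrow> real^'d) \<Rightarrow> ('b \<Rightarrow> real^'d) set" where
  "generated_cone N G n \<gamma> = {X \<in> L0 N. \<exists>\<alpha>. (\<forall>i\<in>{1..n}. \<alpha> i \<in> nonneg_measurable G) \<and>
      (AE \<omega> in N. X \<omega> = (\<Sum>i=1..n. \<alpha> i \<omega> *\<^sub>R \<gamma> i \<omega>))}"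

definition attainable :: "nat \<Rightarrow> (nat \<Rightarrow> ('b \<Rightarrow> real^'d) set) \<Rightarrow> ('b \<Rightarrow> real^'d) set" where
  "attainable T K = {(\<lambda>\<omega>. \<Sum>t\<le>T. \<xi> t \<omega>) | \<xi>. \<forall>t\<le>T. \<xi> t \<in> K t}"

definition maximal :: "'b measure \<Rightarrow> ('b \<Rightarrow> real^'d) set \<Rightarrow> ('b \<Rightarrow> real^'d) \<Rightarrow> bool" where
  "maximal N D X \<longleftrightarrow> X \<in> D \<and>
     (\<forall>W\<in>D. (AE \<omega> in N. X \<omega> \<le> W \<omega>) \<longrightarrow> (AE \<omega> in N. W \<omega> = X \<omega>))"

definition cone_minus :: "('b \<Rightarrow> real^'d) set \<Rightarrow> ('b \<Rightarrow> real^'d) \<Rightarrow> ('b \<Rightarrow> real^'d) set" where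
  "cone_minus D X = {(\<lambda>\<omega>. a \<omega> - c *\<^sub>R X \<omega>) | a c. a \<in> D \<and> (0::real) \<le> c}"

definition properly_maximal :: "'b measure \<Rightarrow> ('b \<Rightarrow> real^'d) set \<Rightarrow> ('b \<Rightarrow> real^'d) \<Rightarrow> bool" where
  "properly_maximal N D X \<longleftrightarrow> X \<in> D \<and>
     (\<forall>Z \<in> L0_topology N closure_of cone_minus D X.
        (AE \<omega> in N. 0 \<le> Z \<omega>) \<longrightarrow> (AE \<omega> in N. Z \<omega> = 0))"


section \<open>The market\<close>

definition market_cone :: "'b measure \<Rightarrow> (nat \<Rightarrow> 'b measure) \<Rightarrow> (nat \<Rightarrow> nat) \<Rightarrow>
    (nat \<Rightarrow> nat \<Rightarrow> 'b \<Rightarrow> real^'d) \<Rightarrow> nat \<Rightarrow> ('b \<Rightarrow> real^'d) set" where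
  "market_cone N G n \<gamma> t = generated_cone N (G t) (n t) (\<gamma> t)"

definition market_claims :: "'b measure \<Rightarrow> (nat \<Rightarrow> 'b measure) \<Rightarrow> nat \<Rightarrow> (nat \<Rightarrow> nat) \<Rightarrow>
    (nat \<Rightarrow> nat \<Rightarrow> 'b \<Rightarrow> real^'d) \<Rightarrow> ('b \<Rightarrow> real^'d) set" where
  "market_claims N G T n \<gamma> = attainable T (market_cone N G n \<gamma>)"

text \<open>\<open>n t\<close> is the number of generators of \<open>K\<^sub>t\<close>, and \<open>\<gamma> t 1, \<dots>, \<gamma> t (n t)\<close> are the generators.\<close>

locale market = prob_space M
  for M :: "'a measure" +
  fixes F :: "nat \<Rightarrow> 'a measure" and T :: nat
    and n :: "nat \<Rightarrow> nat" and \<gamma> :: "nat \<Rightarrow> nat \<Rightarrow> 'a \<Rightarrow> real^'d"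
  assumes filtration_subalgebra: "\<And>t. t \<le> T \<Longrightarrow> subalgebra M (F t)"
    and filtration_mono: "\<And>s t. s \<le> t \<Longrightarrow> t \<le> T \<Longrightarrow> sets (F s) \<subseteq> sets (F t)"
    and generators: "\<And>t i. t \<le> T \<Longrightarrow> i \<in> {1..n t} \<Longrightarrow> \<gamma> t i \<in> borel_measurable (F t)"
    and burning: "\<And>X. X \<in> borel_measurable (F T) \<Longrightarrow> AE \<omega> in M. X \<omega> \<le> 0 \<Longrightarrow>
        X \<in> market_cone M F n \<gamma> T"
    and arbitrage_free: "\<And>X. X \<in> market_claims M F T n \<gamma> \<Longrightarrow> AE \<omega> in M. 0 \<le> X \<omega> \<Longrightarrow>
        AE \<omega> in M. X \<omega> = 0"
    and null_strategies: "\<And>\<xi>. (\<forall>t\<le>T. \<xi> t \<in> market_cone M F n \<gamma> t) \<Longrightarrow>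
        AE \<omega> in M. (\<Sum>t\<le>T. \<xi> t \<omega>) = 0 \<Longrightarrow> \<forall>t\<le>T. AE \<omega> in M. \<xi> t \<omega> = 0"


section \<open>The randomized market\<close>

text \<open>A point of \<open>\<nat>\<^sup>T\<close> is a function on \<open>{1..T}\<close> with values in \<open>{1..}\<close>. Of the measures \<open>F t\<close> and
  \<open>rand_filtration T t\<close> only the \<open>\<sigma>\<close>-algebras matter; for \<open>t = 0\<close> the latter is trivial.\<close>

definition hat_P :: "nat measure" where
  "hat_P = density (count_space {1..}) (\<lambda>k. ennreal ((1 / 2) ^ k))"

definition rand_space :: "nat \<Rightarrow> (nat \<Rightarrow> nat) measure" where
  "rand_space T = (\<Pi>\<^sub>M s\<in>{1..T}. hat_P)"

definition rand_filtration :: "nat \<Rightarrow> nat \<Rightarrow> (nat \<Rightarrow> nat) measure" where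
  "rand_filtration T t = sigma (space (rand_space T))
     {{w \<in> space (rand_space T). w s \<in> B} | s B. s \<in> {1..t} \<and> B \<subseteq> {1..}}"

definition tilde_M :: "'a measure \<Rightarrow> nat \<Rightarrow> ('a \<times> (nat \<Rightarrow> nat)) measure" where
  "tilde_M M T = M \<Otimes>\<^sub>M rand_space T"

definition tilde_F :: "(nat \<Rightarrow> 'a measure) \<Rightarrow> nat \<Rightarrow> nat \<Rightarrow> ('a \<times> (nat \<Rightarrow> nat)) measure" where
  "tilde_F F T t = F t \<Otimes>\<^sub>M rand_filtration T t"

definition tilde_A :: "'a measure \<Rightarrow> (nat \<Rightarrow> 'a measure) \<Rightarrow> nat \<Rightarrow> (nat \<Rightarrow> nat) \<Rightarrow>
    (nat \<Rightarrow> nat \<Rightarrow> 'a \<Rightarrow> real^'d) \<Rightarrow> ('a \<times> (nat \<Rightarrow> nat) \<Rightarrow> real^'d) set" where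
  "tilde_A M F T n \<gamma> =
     market_claims (tilde_M M T) (tilde_F F T) T n (\<lambda>t i x. \<gamma> t i (fst x))"

lemma emeasure_hat_P:
  assumes "k \<ge> 1" shows "emeasure hat_P {k} = ennreal ((1 / 2) ^ k)"
proof -
  have "emeasure hat_P {k} = (\<integral>\<^sup>+j. ennreal ((1 / 2) ^ j) * indicator {k} j \<partial>count_space {1..})"
    unfolding hat_P_def using assms by (intro emeasure_density) auto
  also have "\<dots> = ennreal ((1 / 2) ^ k) * emeasure (count_space {1..}) {k}"
    using assms by (intro nn_integral_indicator_singleton) auto
  also have "emeasure (count_space {1..}) {k} = 1" using assms by (subst emeasure_count_space) auto
  finally show ?thesis by simp
qed

lemma prob_space_hat_P: "prob_space hat_P"
proof
  have "(\<lambda>k. (1 / 2 :: real) ^ Suc k) sums 1" by (rule power_half_series)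
  then have S: "(\<Sum>k. ennreal ((1 / 2) ^ Suc k)) = ennreal 1"
    by (intro suminf_ennreal_eq) auto
  have "emeasure hat_P (space hat_P) = (\<integral>\<^sup>+k. ennreal ((1 / 2) ^ k) \<partial>count_space {1..})"
    unfolding hat_P_def by (subst emeasure_density) (auto intro!: nn_integral_cong)
  also have "\<dots> = (\<integral>\<^sup>+k. ennreal ((1 / 2) ^ Suc k) \<partial>count_space UNIV)"
  proof (rule nn_integral_bij_count_space[symmetric])
    show "bij_betw Suc UNIV {1..}" by (rule bij_betwI[of _ _ _ "\<lambda>k. k - 1"]) auto
  qed
  also have "\<dots> = 1" using S by (simp add: nn_integral_count_space_nat del: power_Suc)
  finally show "emeasure hat_P (space hat_P) = 1" .
qed

lemma prob_space_rand_space: "prob_space (rand_space T)"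
  unfolding rand_space_def by (intro prob_space_PiM prob_space_hat_P)

lemma prob_space_tilde_M: "prob_space M \<Longrightarrow> prob_space (tilde_M M T)"
  unfolding tilde_M_def by (intro prob_space_pair prob_space_rand_space)

lemma subalgebra_rand_filtration:
  assumes "t \<le> T" shows "subalgebra (rand_space T) (rand_filtration T t)"
proof -
  have "{w \<in> space (rand_space T). w s \<in> B} \<in> sets (rand_space T)"
    if "s \<in> {1..t}" "B \<subseteq> {1..}" for s B
  proof -
    have [measurable]: "(\<lambda>w. w s) \<in> rand_space T \<rightarrow>\<^sub>M hat_P"
      using that assms by (auto simp: rand_space_def)
    have [measurable]: "B \<in> sets hat_P" using that by (simp add: hat_P_def)
    show ?thesis by measurable
  qed
  then show ?thesis
    by (auto simp: subalgebra_def rand_filtration_def sets_measure_of_conv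
        intro!: sets.sigma_sets_subset)
qed

end

theory Submission
  imports Defs
begin

text \<open>
  No randomization is needed: the approximating claims do not depend on the second coordinate.
  For a maximal claim \<open>\<theta>\<close> minimize the expected loss
  \<open>\<Sum>\<^sub>i (exp (- x\<^sub>i) + m * (max 0 (- x\<^sub>i))\<^sup>2)\<close>, \<open>x = X - \<theta>\<close>, over the claims \<open>X\<close> in \<open>\<A>\<close>.
  By the convexity of \<open>exp\<close>, along a minimizing sequence \<open>exp (- x\<^sub>i / 2)\<close> is Cauchy in \<open>L\<^sup>2\<close>; as
  \<open>\<A>\<close> is closed and arbitrage-free, the sequence converges in \<open>\<A>\<close> and a minimizer \<open>X\<^sub>m\<close> exists.
  The same argument makes the \<open>X\<^sub>m\<close> converge along a subsequence, to a claim dominating \<open>\<theta>\<close>, hence to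
  \<open>\<theta>\<close>. The conditional expectations \<open>Z\<^sub>t\<close> of the marginal loss at \<open>X\<^sub>m\<close> form a strictly positive
  martingale, and the first-order conditions say that \<open>Z\<^sub>t \<bullet> \<xi> \<le> 0\<close> for \<open>\<xi>\<close> in \<open>K\<^sub>t\<close>, with equality for
  the trades which finance \<open>X\<^sub>m\<close>. This excludes asymptotic arbitrage in \<open>[\<A>, X\<^sub>m]\<close>, and also in
  its randomization, which has the same generators.
\<close>

section \<open>Measurable selections\<close>

text \<open>The obstacle is the closure in the definition of proper maximality. A nonnegative limit
  of elements \<open>a - c * X\<close> comes with no bound on the strategies behind \<open>a\<close>
  or on \<open>c\<close>, and these elements need not be integrable, so a strictly positive
  functional cannot simply be applied and passed to the limit. What survives is the trade-by-trade
  form of the first-order condition: each trade financing \<open>X\<close> has value zero, so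
  subtracting any multiple of it changes no value, however large \<open>c\<close> is. Moreover,
  gains from a martingale increment whose negative parts vanish must vanish themselves in
  probability, without any bound on the strategies. The two terms of the loss have separate tasks.
  The exponential makes the marginal loss strictly positive in every coordinate and gives a
  quantitative strict convexity; a minimizing sequence may only escape to infinite gains, and those
  are arbitrage. The penalty, with \<open>m\<close> growing, forces the limit of the minimizers to
  dominate \<open>\<theta>\<close>, which is where maximality enters. It is squared to keep the loss
  differentiable, as first-order conditions require.\<close>

text \<open>Indices \<open>i\<close> are treated one at a time, each refining the subsequence found
  so far. The bound \<open>k \<le> \<tau> k \<omega>\<close> sends the random indices to infinity,
  which is enough to preserve the limits already obtained; monotonicity in \<open>k\<close> is not
  asked for.\<close>

lemma random_subsequence:
  fixes f :: "nat \<Rightarrow> 'i \<Rightarrow> 'a \<Rightarrow> real"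
  assumes "finite I" and "\<And>k i. i \<in> I \<Longrightarrow> f k i \<in> borel_measurable G"
    and "\<And>i \<omega>. i \<in> I \<Longrightarrow> \<omega> \<in> space G \<Longrightarrow> bounded (range (\<lambda>k. f k i \<omega>))"
  shows "\<exists>\<tau>. (\<forall>k. \<tau> k \<in> G \<rightarrow>\<^sub>M count_space UNIV) \<and> (\<forall>k \<omega>. k \<le> \<tau> k \<omega>) \<and>
    (\<forall>\<omega>\<in>space G. \<forall>i\<in>I. convergent (\<lambda>k. f (\<tau> k \<omega>) i \<omega>))"
  using assms
proof (induction I rule: finite_induct)
  case empty
  show ?case by (rule exI[of _ "\<lambda>k \<omega>. k"]) auto
next
  case (insert j I)
  obtain \<tau> where \<tau>[measurable]: "\<And>k. \<tau> k \<in> G \<rightarrow>\<^sub>M count_space UNIV"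
    and \<tau>_ge: "\<And>k \<omega>. k \<le> \<tau> k \<omega>"
    and \<tau>_conv: "\<And>\<omega> i. \<omega> \<in> space G \<Longrightarrow> i \<in> I \<Longrightarrow> convergent (\<lambda>k. f (\<tau> k \<omega>) i \<omega>)"
    using insert.IH[OF insert.prems] by blast
  have fm: "f k j \<in> borel_measurable G" for k using insert.prems by auto
  define g where "g k \<omega> = f (\<tau> k \<omega>) j \<omega>" for k \<omega>
  have g[measurable]: "g k \<in> borel_measurable G" for k
    unfolding g_def by (rule measurable_compose_countable[OF fm \<tau>])
  \<comment> \<open>The limsup is a cluster point that depends measurably on
    \<open>\<omega>\<close>; boundedness makes it finite.\<close>
  define L where "L \<omega> = real_of_ereal (limsup (\<lambda>k. ereal (g k \<omega>)))" for \<omega>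
  have L[measurable]: "L \<in> borel_measurable G" unfolding L_def by measurable
  have ex: "\<exists>m\<ge>k. \<bar>g m \<omega> - L \<omega>\<bar> < 1 / Suc k" if \<omega>: "\<omega> \<in> space G" for k \<omega>
  proof -
    obtain r where r: "strict_mono r" "((\<lambda>k. ereal (g k \<omega>)) \<circ> r) \<longlonglongrightarrow> limsup (\<lambda>k. ereal (g k \<omega>))"
      using limsup_subseq_lim by blast
    obtain B where B: "\<And>k. \<bar>f k j \<omega>\<bar> \<le> B"
      using insert.prems(2)[of j \<omega>] \<omega> by (auto simp: bounded_iff)
    have gB: "\<bar>g k \<omega>\<bar> \<le> B" for k by (simp add: g_def B)
    have "limsup (\<lambda>k. ereal (g k \<omega>)) \<le> ereal B"
      by (rule tendsto_upperbound[OF r(2)]) (use gB in \<open>auto simp: abs_le_iff\<close>)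
    moreover have "ereal (- B) \<le> limsup (\<lambda>k. ereal (g k \<omega>))"
      by (rule tendsto_lowerbound[OF r(2)]) (use gB in \<open>auto simp: abs_le_iff minus_le_iff\<close>)
    ultimately have "limsup (\<lambda>k. ereal (g k \<omega>)) = ereal (L \<omega>)"
      unfolding L_def by (cases "limsup (\<lambda>k. ereal (g k \<omega>))") auto
    then have "(\<lambda>k. g (r k) \<omega>) \<longlonglongrightarrow> L \<omega>" using r(2) by (simp add: o_def)
    then have "\<forall>\<^sub>F m in sequentially. dist (g (r m) \<omega>) (L \<omega>) < 1 / Suc k"
      by (rule tendstoD) simp
    then obtain N where N: "\<And>m. m \<ge> N \<Longrightarrow> dist (g (r m) \<omega>) (L \<omega>) < 1 / Suc k"
      by (auto simp: eventually_sequentially)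
    have "r (max N k) \<ge> k" using seq_suble[OF r(1), of "max N k"] by linarith
    with N[of "max N k"] show ?thesis by (auto simp: dist_real_def)
  qed
  \<comment> \<open>The first index past \<open>k\<close> with accuracy \<open>1 / Suc k\<close>.
    The default \<open>k\<close> outside \<open>space G\<close> keeps
    \<open>k \<le> \<sigma> k \<omega>\<close> true at every point.\<close>
  define \<sigma> where "\<sigma> k \<omega> = (if \<omega> \<in> space G then LEAST m. k \<le> m \<and> \<bar>g m \<omega> - L \<omega>\<bar> < 1 / Suc k else k)" for k \<omega>
  have \<sigma>: "k \<le> \<sigma> k \<omega> \<and> \<bar>g (\<sigma> k \<omega>) \<omega> - L \<omega>\<bar> < 1 / Suc k" if "\<omega> \<in> space G" for k \<omega>
    using LeastI_ex[OF ex[OF that, of k, unfolded Bex_def]] that unfolding \<sigma>_def by auto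
  have \<sigma>_ge: "k \<le> \<sigma> k \<omega>" for k \<omega> using \<sigma>[of \<omega> k] by (cases "\<omega> \<in> space G") (auto simp: \<sigma>_def)
  have \<sigma>_meas: "\<sigma> k \<in> G \<rightarrow>\<^sub>M count_space UNIV" for k
  proof -
    have "(\<lambda>\<omega>. LEAST m. k \<le> m \<and> \<bar>g m \<omega> - L \<omega>\<bar> < 1 / Suc k) \<in> G \<rightarrow>\<^sub>M count_space UNIV"
      by measurable
    then show ?thesis by (rule measurable_cong[THEN iffD1, rotated]) (simp add: \<sigma>_def)
  qed
  have \<sigma>_top: "filterlim (\<lambda>k. \<sigma> k \<omega>) at_top sequentially" for \<omega>
    by (rule filterlim_at_top_mono[OF filterlim_ident]) (simp add: \<sigma>_ge)
  show ?case
  proof (intro exI[of _ "\<lambda>k \<omega>. \<tau> (\<sigma> k \<omega>) \<omega>"] conjI allI ballI)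
    show "(\<lambda>\<omega>. \<tau> (\<sigma> k \<omega>) \<omega>) \<in> G \<rightarrow>\<^sub>M count_space UNIV" for k
      by (rule measurable_compose_countable[OF \<tau> \<sigma>_meas])
    show "k \<le> \<tau> (\<sigma> k \<omega>) \<omega>" for k \<omega> using \<tau>_ge[of "\<sigma> k \<omega>" \<omega>] \<sigma>_ge[of k \<omega>] by simp
    fix \<omega> i assume \<omega>: "\<omega> \<in> space G" and i: "i \<in> insert j I"
    show "convergent (\<lambda>k. f (\<tau> (\<sigma> k \<omega>) \<omega>) i \<omega>)"
    proof (cases "i \<in> I")
      case True
      then obtain l where "(\<lambda>k. f (\<tau> k \<omega>) i \<omega>) \<longlonglongrightarrow> l" using \<tau>_conv[OF \<omega>] by (auto simp: convergent_def)
      from filterlim_compose[OF this \<sigma>_top[of \<omega>]] show ?thesis by (auto simp: convergent_def)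
    next
      case False
      then have [simp]: "i = j" using i by simp
      have "(\<lambda>k. g (\<sigma> k \<omega>) \<omega> - L \<omega>) \<longlonglongrightarrow> 0"
        by (rule Lim_null_comparison[OF _ LIMSEQ_Suc[OF lim_1_over_n]]) (use \<sigma>[OF \<omega>] in \<open>auto intro!: less_imp_le always_eventually\<close>)
      then have "(\<lambda>k. g (\<sigma> k \<omega>) \<omega>) \<longlonglongrightarrow> L \<omega>" by (simp add: LIM_zero_iff)
      then show ?thesis by (auto simp: convergent_def g_def)
    qed
  qed
qed

lemma random_subsequence_vec:
  fixes f :: "nat \<Rightarrow> 'a \<Rightarrow> 'e::euclidean_space"
  assumes [measurable]: "\<And>k. f k \<in> borel_measurable G"
    and "\<And>\<omega>. \<omega> \<in> space G \<Longrightarrow> bounded (range (\<lambda>k. f k \<omega>))"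
  obtains \<tau> g where "\<And>k. \<tau> k \<in> G \<rightarrow>\<^sub>M count_space UNIV" "\<And>k \<omega>. k \<le> \<tau> k \<omega>"
    "g \<in> borel_measurable G" "\<And>\<omega>. \<omega> \<in> space G \<Longrightarrow> (\<lambda>k. f (\<tau> k \<omega>) \<omega>) \<longlonglongrightarrow> g \<omega>"
proof -
  have "\<exists>\<tau>. (\<forall>k. \<tau> k \<in> G \<rightarrow>\<^sub>M count_space UNIV) \<and> (\<forall>k \<omega>. k \<le> \<tau> k \<omega>) \<and>
    (\<forall>\<omega>\<in>space G. \<forall>b\<in>Basis. convergent (\<lambda>k. f (\<tau> k \<omega>) \<omega> \<bullet> b))"
  proof (rule random_subsequence)
    fix b \<omega> assume b: "b \<in> (Basis :: 'e set)" and "\<omega> \<in> space G"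
    then obtain B where "\<And>k. norm (f k \<omega>) \<le> B" using assms(2)[of \<omega>] by (auto simp: bounded_iff)
    then have "norm (f k \<omega> \<bullet> b) \<le> B" for k using order_trans[OF Basis_le_norm[OF b]] by auto
    then show "bounded (range (\<lambda>k. f k \<omega> \<bullet> b))" by (auto simp: bounded_iff)
  qed auto
  then obtain \<tau> where \<tau>: "\<And>k. \<tau> k \<in> G \<rightarrow>\<^sub>M count_space UNIV" "\<And>k \<omega>. k \<le> \<tau> k \<omega>"
    "\<And>\<omega> b. \<omega>\<in>space G \<Longrightarrow> b \<in> Basis \<Longrightarrow> convergent (\<lambda>k. f (\<tau> k \<omega>) \<omega> \<bullet> b)"
    by blast
  define g where "g \<omega> = lim (\<lambda>k. f (\<tau> k \<omega>) \<omega>)" for \<omega>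
  have [measurable]: "(\<lambda>\<omega>. f (\<tau> k \<omega>) \<omega>) \<in> borel_measurable G" for k
    by (rule measurable_compose_countable[OF _ \<tau>(1)]) simp
  have "(\<lambda>k. f (\<tau> k \<omega>) \<omega>) \<longlonglongrightarrow> g \<omega>" if \<omega>: "\<omega> \<in> space G" for \<omega>
  proof -
    obtain l where "\<And>b. b \<in> Basis \<Longrightarrow> (\<lambda>k. f (\<tau> k \<omega>) \<omega> \<bullet> b) \<longlonglongrightarrow> l b"
      using \<tau>(3)[OF \<omega>] unfolding convergent_def by metis
    then have "(\<lambda>k. \<Sum>b\<in>Basis. (f (\<tau> k \<omega>) \<omega> \<bullet> b) *\<^sub>R b) \<longlonglongrightarrow> (\<Sum>b\<in>Basis. l b *\<^sub>R b)"
      by (intro tendsto_intros)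
    then show ?thesis unfolding g_def euclidean_representation by (simp add: limI)
  qed
  moreover have "g \<in> borel_measurable G" unfolding g_def by (rule borel_measurable_lim_metric) simp
  ultimately show ?thesis using that[OF \<tau>(1,2)] by blast
qed

section \<open>Finitely generated cones: closedness and measurable coefficients\<close>

lemma finitely_generated_cone_eq_hull:
  fixes v :: "nat \<Rightarrow> 'e::euclidean_space"
  shows "{\<Sum>i=1..n. a i *\<^sub>R v i | a. \<forall>i\<in>{1..n}. 0 \<le> a i} = convex_cone hull (v ` {1..n})" (is "?C = _")
proof
  show "?C \<subseteq> convex_cone hull (v ` {1..n})"
  proof safe
    fix a :: "nat \<Rightarrow> real" assume a: "\<forall>i\<in>{1..n}. 0 \<le> a i"
    have "(\<Sum>i\<in>I. a i *\<^sub>R v i) \<in> convex_cone hull (v ` {1..n})" if "finite I" "I \<subseteq> {1..n}" for I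
      using that
    proof (induction I rule: finite_induct)
      case empty then show ?case by (simp add: convex_cone_hull_contains_0)
    next
      case (insert j I)
      have "a j *\<^sub>R v j \<in> convex_cone hull (v ` {1..n})"
        using insert.prems a by (intro convex_cone_hull_mul hull_inc) auto
      then have "a j *\<^sub>R v j + (\<Sum>i\<in>I. a i *\<^sub>R v i) \<in> convex_cone hull (v ` {1..n})"
        using insert.IH insert.prems by (intro convex_cone_hull_add) auto
      then show ?case using insert.hyps by simp
    qed
    then show "(\<Sum>i=1..n. a i *\<^sub>R v i) \<in> convex_cone hull (v ` {1..n})" by simp
  qed
  have "convex_cone ?C" unfolding convex_cone_iff
  proof (intro conjI ballI allI impI)
    fix x y assume "x \<in> ?C" "y \<in> ?C"
    then obtain a b where "\<forall>i\<in>{1..n}. 0 \<le> a i" "x = (\<Sum>i=1..n. a i *\<^sub>R v i)"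
      "\<forall>i\<in>{1..n}. 0 \<le> b i" "y = (\<Sum>i=1..n. b i *\<^sub>R v i)" by auto
    then show "x + y \<in> ?C"
      by (intro CollectI exI[of _ "\<lambda>i. a i + b i"]) (auto simp: scaleR_add_left sum.distrib)
  next
    fix x c assume "x \<in> ?C" "0 \<le> (c::real)"
    then obtain a where "\<forall>i\<in>{1..n}. 0 \<le> a i" "x = (\<Sum>i=1..n. a i *\<^sub>R v i)" by auto
    then show "c *\<^sub>R x \<in> ?C" using \<open>0 \<le> c\<close>
      by (intro CollectI exI[of _ "\<lambda>i. c * a i"]) (auto simp: scaleR_sum_right)
  next
    show "0 \<in> ?C" by (auto intro!: exI[of _ "\<lambda>_. 0"])
  qed
  moreover have "v ` {1..n} \<subseteq> ?C"
  proof safe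
    fix i assume "i \<in> {1..n}"
    then show "\<exists>a. v i = (\<Sum>i=1..n. a i *\<^sub>R v i) \<and> (\<forall>i\<in>{1..n}. 0 \<le> a i)"
      by (intro exI[of _ "\<lambda>j. if j = i then 1 else 0"]) (auto simp: if_distrib[of "\<lambda>c. c *\<^sub>R _"] cong: if_cong)
  qed
  ultimately show "convex_cone hull (v ` {1..n}) \<subseteq> ?C" by (rule hull_minimal[rotated])
qed

lemma closed_finitely_generated_cone:
  fixes v :: "nat \<Rightarrow> 'e::euclidean_space"
  shows "closed {\<Sum>i=1..n. a i *\<^sub>R v i | a. \<forall>i\<in>{1..n}. 0 \<le> a i}"
  unfolding finitely_generated_cone_eq_hull by (intro closed_convex_cone_hull finite_imageI finite_atLeastAtMost)

text \<open>Approximating from below preserves every upper bound on the exact coefficients, so the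
  rational search can stay inside the same bound.\<close>

lemma nonneg_rational_below:
  fixes a e :: real assumes "0 \<le> a" "0 < e"
  shows "\<exists>q\<in>\<rat>. 0 \<le> q \<and> q \<le> a \<and> a - q \<le> e"
proof (cases "a = 0")
  case True then show ?thesis using assms by (intro bexI[of _ 0]) auto
next
  case False
  then have "max 0 (a - e) < a" using assms by auto
  then obtain q where "q \<in> \<rat>" "max 0 (a - e) < q" "q < a" using Rats_dense_in_real by blast
  then show ?thesis by (intro bexI[of _ q]) auto
qed

text \<open>The coefficients are limits, along a measurable random subsequence, of rational
  coefficients found by a countable search; the integer bound in the search makes the
  approximating coefficients bounded.\<close>

lemma measurable_cone_coefficients:
  fixes v :: "nat \<Rightarrow> 'a \<Rightarrow> 'e::euclidean_space"
  assumes [measurable]: "\<And>i. i \<in> {1..n} \<Longrightarrow> v i \<in> borel_measurable G" "x \<in> borel_measurable G"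
    and x: "\<And>\<omega>. \<omega> \<in> space G \<Longrightarrow> \<exists>a. (\<forall>i\<in>{1..n}. 0 \<le> a i) \<and> x \<omega> = (\<Sum>i=1..n. a i *\<^sub>R v i \<omega>)"
  shows "\<exists>\<alpha>. (\<forall>i\<in>{1..n}. \<alpha> i \<in> nonneg_measurable G) \<and> (\<forall>\<omega>\<in>space G. x \<omega> = (\<Sum>i=1..n. \<alpha> i \<omega> *\<^sub>R v i \<omega>))"
proof -
  define Q where "Q = ({1..n} \<rightarrow>\<^sub>E {q::real. q \<in> \<rat> \<and> 0 \<le> q})"
  have Qc: "countable Q" unfolding Q_def
    by (intro countable_PiE) (auto intro: countable_subset[OF _ countable_rat])
  have Qne: "Q \<noteq> {}" unfolding Q_def by (auto simp: PiE_eq_empty_iff intro: exI[of _ 0])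
  define q where "q = from_nat_into Q"
  have qQ: "q k \<in> Q" for k unfolding q_def by (rule from_nat_into[OF Qne])
  have qsurj: "\<exists>k. q k = a" if "a \<in> Q" for a unfolding q_def by (meson Qc from_nat_into_surj that)
  define P where "P m j k \<omega> \<longleftrightarrow> (\<forall>i\<in>{1..n}. q k i \<le> real j) \<and> norm (x \<omega> - (\<Sum>i=1..n. q k i *\<^sub>R v i \<omega>)) < 1 / Suc m" for m j k \<omega>
  have [measurable]: "Measurable.pred G (P m j k)" for m j k unfolding P_def by measurable
  have ex: "\<exists>j. \<forall>m. \<exists>k. P m j k \<omega>" if \<omega>: "\<omega> \<in> space G" for \<omega>
  proof -
    obtain a where a: "\<forall>i\<in>{1..n}. 0 \<le> a i" "x \<omega> = (\<Sum>i=1..n. a i *\<^sub>R v i \<omega>)" using x[OF \<omega>] by blast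
    obtain j where j: "(\<Sum>i=1..n. a i) \<le> real j" using real_arch_simple by blast
    have aj: "a i \<le> real j" if "i \<in> {1..n}" for i
      using member_le_sum[of i "{1..n}" a] a(1) that j by fastforce
    define S where "S = (\<Sum>i=1..n. norm (v i \<omega>))"
    have S: "S \<ge> 0" unfolding S_def by (intro sum_nonneg) auto
    show ?thesis
    proof (rule exI[of _ j], rule allI)
      fix m
      \<comment> \<open>\<open>S + 1\<close> in place of \<open>S\<close> covers the case that all
        generators vanish at \<open>\<omega>\<close>.\<close>
      define e where "e = 1 / (Suc m * (S + 1))"
      have e: "e > 0" using S by (simp add: e_def)
      have "\<exists>b. \<forall>i\<in>{1..n}. b i \<in> \<rat> \<and> 0 \<le> b i \<and> b i \<le> a i \<and> a i - b i \<le> e"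
        using nonneg_rational_below[OF _ e] a(1) by (intro bchoice) blast
      then obtain b where b: "\<And>i. i \<in> {1..n} \<Longrightarrow> b i \<in> \<rat> \<and> 0 \<le> b i \<and> b i \<le> a i \<and> a i - b i \<le> e" by blast
      have "restrict b {1..n} \<in> Q" unfolding Q_def using b by auto
      then obtain k where k: "q k = restrict b {1..n}" using qsurj by blast
      have "norm (x \<omega> - (\<Sum>i=1..n. q k i *\<^sub>R v i \<omega>)) = norm (\<Sum>i=1..n. (a i - b i) *\<^sub>R v i \<omega>)"
        unfolding a(2) k by (simp add: sum_subtractf[symmetric] scaleR_diff_left)
      also have "\<dots> \<le> (\<Sum>i=1..n. e * norm (v i \<omega>))"
        by (rule sum_norm_le) (use b in \<open>auto intro!: mult_right_mono simp: abs_of_nonneg\<close>)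
      also have "\<dots> = e * S" by (simp add: S_def sum_distrib_left)
      also have "\<dots> < e * (S + 1)" using e by simp
      also have "\<dots> = 1 / Suc m" using S by (simp add: e_def)
      finally have "norm (x \<omega> - (\<Sum>i=1..n. q k i *\<^sub>R v i \<omega>)) < 1 / Suc m" .
      moreover have "\<forall>i\<in>{1..n}. q k i \<le> real j" using b aj by (fastforce simp: k)
      ultimately show "\<exists>k. P m j k \<omega>" unfolding P_def by blast
    qed
  qed
  \<comment> \<open>The bound \<open>J \<omega>\<close> is fixed before the accuracy
    \<open>m\<close>. A bound chosen anew for each \<open>m\<close> could grow, and the coefficients
    might then have no cluster point.\<close>
  define J where "J \<omega> = (LEAST j. \<forall>m. \<exists>k. P m j k \<omega>)" for \<omega>
  have J[measurable]: "J \<in> G \<rightarrow>\<^sub>M count_space UNIV" unfolding J_def by measurable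
  have JP: "\<exists>k. P m (J \<omega>) k \<omega>" if "\<omega> \<in> space G" for \<omega> m
    using LeastI_ex[OF ex[OF that]] unfolding J_def by blast
  define \<kappa> where "\<kappa> m \<omega> = (LEAST k. P m (J \<omega>) k \<omega>)" for m \<omega>
  have \<kappa>P: "P m (J \<omega>) (\<kappa> m \<omega>) \<omega>" if "\<omega> \<in> space G" for \<omega> m
    unfolding \<kappa>_def by (rule LeastI_ex[OF JP[OF that]])
  have [measurable]: "Measurable.pred G (\<lambda>\<omega>. P m (J \<omega>) k \<omega>)" for m k
    by (rule measurable_compose_countable[OF _ J]) simp
  have \<kappa>[measurable]: "\<kappa> m \<in> G \<rightarrow>\<^sub>M count_space UNIV" for m unfolding \<kappa>_def by measurable
  define f where "f m i \<omega> = q (\<kappa> m \<omega>) i" for m i \<omega>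
  have f[measurable]: "f m i \<in> borel_measurable G" for m i
    unfolding f_def by (rule measurable_compose_countable[OF _ \<kappa>, of "\<lambda>k _. q k i"]) simp
  have f0: "0 \<le> f m i \<omega>" if "i \<in> {1..n}" for m i \<omega> using qQ[of "\<kappa> m \<omega>"] that by (auto simp: f_def Q_def)
  have fJ: "f m i \<omega> \<le> real (J \<omega>)" if "\<omega> \<in> space G" "i \<in> {1..n}" for m i \<omega>
    using \<kappa>P[OF that(1), of m] that(2) by (auto simp: f_def P_def)
  have "\<exists>\<tau>. (\<forall>k. \<tau> k \<in> G \<rightarrow>\<^sub>M count_space UNIV) \<and> (\<forall>k \<omega>. k \<le> \<tau> k \<omega>) \<and>
    (\<forall>\<omega>\<in>space G. \<forall>i\<in>{1..n}. convergent (\<lambda>k. f (\<tau> k \<omega>) i \<omega>))"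
  proof (rule random_subsequence)
    show "bounded (range (\<lambda>k. f k i \<omega>))" if "i \<in> {1..n}" "\<omega> \<in> space G" for i \<omega>
      unfolding bounded_iff using f0[OF that(1)] fJ[OF that(2,1)]
      by (intro exI[of _ "real (J \<omega>)"]) auto
  qed auto
  then obtain \<tau> where \<tau>[measurable]: "\<And>k. \<tau> k \<in> G \<rightarrow>\<^sub>M count_space UNIV" and \<tau>_ge: "\<And>k \<omega>. k \<le> \<tau> k \<omega>"
    and \<tau>_conv: "\<And>\<omega> i. \<omega>\<in>space G \<Longrightarrow> i \<in> {1..n} \<Longrightarrow> convergent (\<lambda>k. f (\<tau> k \<omega>) i \<omega>)"
    by blast
  define \<alpha> where "\<alpha> i \<omega> = lim (\<lambda>k. f (\<tau> k \<omega>) i \<omega>)" for i \<omega>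
  have lim: "(\<lambda>k. f (\<tau> k \<omega>) i \<omega>) \<longlonglongrightarrow> \<alpha> i \<omega>" if "\<omega> \<in> space G" "i \<in> {1..n}" for i \<omega>
    unfolding \<alpha>_def using \<tau>_conv[OF that] by (simp add: convergent_LIMSEQ_iff)
  have [measurable]: "(\<lambda>\<omega>. f (\<tau> k \<omega>) i \<omega>) \<in> borel_measurable G" for k i
    by (rule measurable_compose_countable[OF f \<tau>])
  have "\<alpha> i \<in> nonneg_measurable G" if "i \<in> {1..n}" for i
  proof -
    have "\<alpha> i \<in> borel_measurable G" unfolding \<alpha>_def by (rule borel_measurable_lim_metric) simp
    moreover have "0 \<le> \<alpha> i \<omega>" if "\<omega> \<in> space G" for \<omega>
      by (rule LIMSEQ_le_const[OF lim]) (use that \<open>i \<in> {1..n}\<close> f0 in auto)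
    ultimately show ?thesis by (simp add: nonneg_measurable_def)
  qed
  moreover have "x \<omega> = (\<Sum>i=1..n. \<alpha> i \<omega> *\<^sub>R v i \<omega>)" if \<omega>: "\<omega> \<in> space G" for \<omega>
  proof -
    have "(\<lambda>k. x \<omega> - (\<Sum>i=1..n. f (\<tau> k \<omega>) i \<omega> *\<^sub>R v i \<omega>)) \<longlonglongrightarrow> x \<omega> - (\<Sum>i=1..n. \<alpha> i \<omega> *\<^sub>R v i \<omega>)"
      by (intro tendsto_intros lim[OF \<omega>])
    moreover have "(\<lambda>k. x \<omega> - (\<Sum>i=1..n. f (\<tau> k \<omega>) i \<omega> *\<^sub>R v i \<omega>)) \<longlonglongrightarrow> 0"
    proof (rule Lim_null_comparison[OF always_eventually LIMSEQ_Suc[OF lim_1_over_n]], rule allI)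
      fix k
      have "norm (x \<omega> - (\<Sum>i=1..n. f (\<tau> k \<omega>) i \<omega> *\<^sub>R v i \<omega>)) < 1 / Suc (\<tau> k \<omega>)"
        using \<kappa>P[OF \<omega>, of "\<tau> k \<omega>"] by (simp add: P_def f_def)
      also have "\<dots> \<le> 1 / Suc k" using \<tau>_ge[of k \<omega>] by (intro divide_left_mono) auto
      finally show "norm (x \<omega> - (\<Sum>i=1..n. f (\<tau> k \<omega>) i \<omega> *\<^sub>R v i \<omega>)) \<le> 1 / real (Suc k)" by simp
    qed
    ultimately show ?thesis using LIMSEQ_unique by fastforce
  qed
  ultimately show ?thesis by blast
qed


section \<open>Closedness of the cone of claims\<close>

text \<open>Equality here is at every point and the set of dates is arbitrary. The induction over
  dates can then manipulate coefficients directly; null sets are dealt with once, in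
  \<open>market_claims_iff\<close>.\<close>

definition exact_claims :: "(nat \<Rightarrow> 'b measure) \<Rightarrow> (nat \<Rightarrow> nat) \<Rightarrow> (nat \<Rightarrow> nat \<Rightarrow> 'b \<Rightarrow> real^'d) \<Rightarrow>
    nat set \<Rightarrow> ('b \<Rightarrow> real^'d) set" where
  "exact_claims G n \<gamma> I = {(\<lambda>\<omega>. \<Sum>t\<in>I. \<Sum>i=1..n t. \<alpha> t i \<omega> *\<^sub>R \<gamma> t i \<omega>) | \<alpha>.
     \<forall>t\<in>I. \<forall>i\<in>{1..n t}. \<alpha> t i \<in> nonneg_measurable (G t)}"

lemma borel_measurable_vec_lambda[measurable (raw)]:
  fixes f :: "'b \<Rightarrow> 'd::finite \<Rightarrow> real"
  assumes "\<And>i. (\<lambda>\<omega>. f \<omega> i) \<in> borel_measurable N"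
  shows "(\<lambda>\<omega>. \<chi> i. f \<omega> i) \<in> borel_measurable N"
proof -
  have "(\<lambda>\<omega>. \<chi> i. f \<omega> i) = (\<lambda>\<omega>. \<Sum>i\<in>UNIV. f \<omega> i *\<^sub>R axis i 1)"
    by (auto simp: vec_eq_iff axis_def if_distrib cong: if_cong)
  then show ?thesis using assms by simp
qed

lemma borel_measurable_vec_nth[measurable (raw)]:
  fixes f :: "'b \<Rightarrow> real^'d::finite"
  assumes "f \<in> borel_measurable N" shows "(\<lambda>\<omega>. f \<omega> $ i) \<in> borel_measurable N"
  using borel_measurable_inner[OF assms borel_measurable_const[of "axis i 1"]]
  by (simp add: inner_axis)

lemma exact_claimsI:
  assumes "\<And>t i. t \<in> I \<Longrightarrow> i \<in> {1..n t} \<Longrightarrow> \<alpha> t i \<in> nonneg_measurable (G t)"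
  shows "(\<lambda>\<omega>. \<Sum>t\<in>I. \<Sum>i=1..n t. \<alpha> t i \<omega> *\<^sub>R \<gamma> t i \<omega>) \<in> exact_claims G n \<gamma> I"
  unfolding exact_claims_def using assms by (intro CollectI exI[of _ \<alpha>]) simp

lemma exact_claimsE:
  assumes "y \<in> exact_claims G n \<gamma> I"
  obtains \<alpha> where "y = (\<lambda>\<omega>. \<Sum>t\<in>I. \<Sum>i=1..n t. \<alpha> t i \<omega> *\<^sub>R \<gamma> t i \<omega>)"
    "\<And>t i. t \<in> I \<Longrightarrow> i \<in> {1..n t} \<Longrightarrow> \<alpha> t i \<in> nonneg_measurable (G t)"
  using assms unfolding exact_claims_def by auto

lemma market_claims_iff:
  fixes \<gamma> :: "nat \<Rightarrow> nat \<Rightarrow> 'b \<Rightarrow> real^'d"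
  assumes sub: "\<And>t. t \<le> T \<Longrightarrow> subalgebra N (G t)"
    and gen: "\<And>t i. t \<le> T \<Longrightarrow> i \<in> {1..n t} \<Longrightarrow> \<gamma> t i \<in> borel_measurable (G t)"
  shows "X \<in> market_claims N G T n \<gamma> \<longleftrightarrow>
    X \<in> L0 N \<and> (\<exists>y\<in>exact_claims G n \<gamma> {..T}. AE \<omega> in N. X \<omega> = y \<omega>)"
proof
  assume "X \<in> market_claims N G T n \<gamma>"
  then obtain \<xi> where X: "X = (\<lambda>\<omega>. \<Sum>t\<le>T. \<xi> t \<omega>)"
    and \<xi>: "\<And>t. t \<le> T \<Longrightarrow> \<xi> t \<in> generated_cone N (G t) (n t) (\<gamma> t)"
    by (auto simp: market_claims_def attainable_def market_cone_def)
  then have "\<forall>t. \<exists>\<alpha>. t \<le> T \<longrightarrow> (\<forall>i\<in>{1..n t}. \<alpha> i \<in> nonneg_measurable (G t)) \<and>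
      (AE \<omega> in N. \<xi> t \<omega> = (\<Sum>i=1..n t. \<alpha> i \<omega> *\<^sub>R \<gamma> t i \<omega>))"
    unfolding generated_cone_def by blast
  from choice[OF this] obtain \<alpha> where \<alpha>: "\<And>t. t \<le> T \<Longrightarrow> \<forall>i\<in>{1..n t}. \<alpha> t i \<in> nonneg_measurable (G t)"
      "\<And>t. t \<le> T \<Longrightarrow> AE \<omega> in N. \<xi> t \<omega> = (\<Sum>i=1..n t. \<alpha> t i \<omega> *\<^sub>R \<gamma> t i \<omega>)"
    by blast
  have "AE \<omega> in N. \<forall>t\<in>{..T}. \<xi> t \<omega> = (\<Sum>i=1..n t. \<alpha> t i \<omega> *\<^sub>R \<gamma> t i \<omega>)"
    using \<alpha>(2) by (intro AE_finite_allI) auto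
  then have "AE \<omega> in N. X \<omega> = (\<Sum>t\<in>{..T}. \<Sum>i=1..n t. \<alpha> t i \<omega> *\<^sub>R \<gamma> t i \<omega>)"
    unfolding X by eventually_elim simp
  moreover have "X \<in> L0 N" unfolding X
    using \<xi> by (intro borel_measurable_sum) (auto simp: generated_cone_def)
  moreover have "(\<lambda>\<omega>. \<Sum>t\<in>{..T}. \<Sum>i=1..n t. \<alpha> t i \<omega> *\<^sub>R \<gamma> t i \<omega>) \<in> exact_claims G n \<gamma> {..T}"
    by (rule exact_claimsI) (use \<alpha>(1) in auto)
  ultimately show "X \<in> L0 N \<and> (\<exists>y\<in>exact_claims G n \<gamma> {..T}. AE \<omega> in N. X \<omega> = y \<omega>)"
    by (intro conjI bexI)
next
  assume "X \<in> L0 N \<and> (\<exists>y\<in>exact_claims G n \<gamma> {..T}. AE \<omega> in N. X \<omega> = y \<omega>)"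
  then obtain y where X[measurable]: "X \<in> L0 N" and y: "y \<in> exact_claims G n \<gamma> {..T}"
    and Xy: "AE \<omega> in N. X \<omega> = y \<omega>" by blast
  from y obtain \<alpha> where y_eq: "y = (\<lambda>\<omega>. \<Sum>t\<in>{..T}. \<Sum>i=1..n t. \<alpha> t i \<omega> *\<^sub>R \<gamma> t i \<omega>)"
    and \<alpha>: "\<And>t i. t \<in> {..T} \<Longrightarrow> i \<in> {1..n t} \<Longrightarrow> \<alpha> t i \<in> nonneg_measurable (G t)"
    by (rule exact_claimsE) blast
  have eq: "AE \<omega> in N. X \<omega> = (\<Sum>t\<in>{..T}. \<Sum>i=1..n t. \<alpha> t i \<omega> *\<^sub>R \<gamma> t i \<omega>)"
    using Xy unfolding y_eq .
  define \<eta> where "\<eta> t \<omega> = (\<Sum>i=1..n t. \<alpha> t i \<omega> *\<^sub>R \<gamma> t i \<omega>)" for t \<omega>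
  have \<eta>[measurable]: "\<eta> t \<in> L0 N" if "t \<le> T" for t
    unfolding \<eta>_def using \<alpha>[of t] that gen[OF that]
    by (intro borel_measurable_sum borel_measurable_scaleR measurable_from_subalg[OF sub[OF that]])
      (auto simp: nonneg_measurable_def)
  \<comment> \<open>\<open>attainable\<close> asks for an equality of functions, whereas
    \<open>X\<close> agrees with the sum only almost surely. The discrepancy is absorbed at date 0,
    whose cone is closed under almost sure equality.\<close>
  define \<xi> where "\<xi> t \<omega> = (if t = 0 then X \<omega> - (\<Sum>s\<in>{..T} - {0}. \<eta> s \<omega>) else \<eta> t \<omega>)" for t \<omega>
  have "\<xi> t \<in> generated_cone N (G t) (n t) (\<gamma> t)" if t: "t \<le> T" for t
    unfolding generated_cone_def
  proof (intro CollectI conjI exI[of _ "\<alpha> t"] ballI)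
    have "(\<lambda>\<omega>. X \<omega> - (\<Sum>s\<in>{..T} - {0}. \<eta> s \<omega>)) \<in> L0 N"
      by (intro borel_measurable_diff borel_measurable_sum) auto
    then show "\<xi> t \<in> L0 N" unfolding \<xi>_def using \<eta>[OF t] by (cases "t = 0") auto
    have split: "(\<Sum>s\<in>{..T}. \<eta> s \<omega>) = \<eta> 0 \<omega> + (\<Sum>s\<in>{..T} - {0}. \<eta> s \<omega>)" for \<omega>
      by (rule sum.remove) auto
    have "AE \<omega> in N. \<xi> t \<omega> = \<eta> t \<omega>"
      using eq unfolding \<eta>_def[symmetric] by eventually_elim (simp add: \<xi>_def split)
    then show "AE \<omega> in N. \<xi> t \<omega> = (\<Sum>i=1..n t. \<alpha> t i \<omega> *\<^sub>R \<gamma> t i \<omega>)" by (simp add: \<eta>_def)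
  qed (use \<alpha>[of t] t in auto)
  moreover have "X = (\<lambda>\<omega>. \<Sum>t\<le>T. \<xi> t \<omega>)"
  proof
    fix \<omega>
    have "(\<Sum>t\<le>T. \<xi> t \<omega>) = \<xi> 0 \<omega> + (\<Sum>s\<in>{..T} - {0}. \<xi> s \<omega>)"
      by (rule sum.remove) auto
    also have "(\<Sum>s\<in>{..T} - {0}. \<xi> s \<omega>) = (\<Sum>s\<in>{..T} - {0}. \<eta> s \<omega>)"
      by (intro sum.cong) (auto simp: \<xi>_def)
    finally show "X \<omega> = (\<Sum>t\<le>T. \<xi> t \<omega>)" by (simp add: \<xi>_def)
  qed
  ultimately show "X \<in> market_claims N G T n \<gamma>"
    unfolding market_claims_def attainable_def market_cone_def by blast
qed

lemma exact_claims_insert: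
  assumes "finite I" "j \<notin> I"
  shows "y \<in> exact_claims G n \<gamma> (insert j I) \<longleftrightarrow>
    (\<exists>x\<in>exact_claims G n \<gamma> {j}. \<exists>z\<in>exact_claims G n \<gamma> I. y = (\<lambda>\<omega>. x \<omega> + z \<omega>))"
proof
  assume "y \<in> exact_claims G n \<gamma> (insert j I)"
  then obtain \<alpha> where "y = (\<lambda>\<omega>. \<Sum>t\<in>insert j I. \<Sum>i=1..n t. \<alpha> t i \<omega> *\<^sub>R \<gamma> t i \<omega>)"
    "\<forall>t\<in>insert j I. \<forall>i\<in>{1..n t}. \<alpha> t i \<in> nonneg_measurable (G t)"
    unfolding exact_claims_def by blast
  then show "\<exists>x\<in>exact_claims G n \<gamma> {j}. \<exists>z\<in>exact_claims G n \<gamma> I. y = (\<lambda>\<omega>. x \<omega> + z \<omega>)"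
    unfolding exact_claims_def using assms
    by (intro bexI[of _ "\<lambda>\<omega>. \<Sum>t\<in>{j}. \<Sum>i=1..n t. \<alpha> t i \<omega> *\<^sub>R \<gamma> t i \<omega>"]
        bexI[of _ "\<lambda>\<omega>. \<Sum>t\<in>I. \<Sum>i=1..n t. \<alpha> t i \<omega> *\<^sub>R \<gamma> t i \<omega>"]) (auto)
next
  assume "\<exists>x\<in>exact_claims G n \<gamma> {j}. \<exists>z\<in>exact_claims G n \<gamma> I. y = (\<lambda>\<omega>. x \<omega> + z \<omega>)"
  then obtain \<alpha> \<beta> where y: "y = (\<lambda>\<omega>. (\<Sum>t\<in>{j}. \<Sum>i=1..n t. \<alpha> t i \<omega> *\<^sub>R \<gamma> t i \<omega>) + (\<Sum>t\<in>I. \<Sum>i=1..n t. \<beta> t i \<omega> *\<^sub>R \<gamma> t i \<omega>))"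
    and "\<forall>t\<in>{j}. \<forall>i\<in>{1..n t}. \<alpha> t i \<in> nonneg_measurable (G t)"
    "\<forall>t\<in>I. \<forall>i\<in>{1..n t}. \<beta> t i \<in> nonneg_measurable (G t)"
    unfolding exact_claims_def by blast
  moreover have "(\<Sum>t\<in>I. \<Sum>i=1..n t. (if t = j then \<alpha> else \<beta>) t i \<omega> *\<^sub>R \<gamma> t i \<omega>) = (\<Sum>t\<in>I. \<Sum>i=1..n t. \<beta> t i \<omega> *\<^sub>R \<gamma> t i \<omega>)" for \<omega>
    by (intro sum.cong) (use assms in auto)
  ultimately show "y \<in> exact_claims G n \<gamma> (insert j I)"
    unfolding exact_claims_def using assms
    by (intro CollectI exI[of _ "\<lambda>t. (if t = j then \<alpha> else \<beta>) t"]) auto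
qed

lemma exact_claims_add:
  assumes "x \<in> exact_claims G n \<gamma> I" "y \<in> exact_claims G n \<gamma> I"
  shows "(\<lambda>\<omega>. x \<omega> + y \<omega>) \<in> exact_claims G n \<gamma> I"
proof -
  obtain \<alpha> \<beta> where "x = (\<lambda>\<omega>. \<Sum>t\<in>I. \<Sum>i=1..n t. \<alpha> t i \<omega> *\<^sub>R \<gamma> t i \<omega>)" "y = (\<lambda>\<omega>. \<Sum>t\<in>I. \<Sum>i=1..n t. \<beta> t i \<omega> *\<^sub>R \<gamma> t i \<omega>)"
    "\<forall>t\<in>I. \<forall>i\<in>{1..n t}. \<alpha> t i \<in> nonneg_measurable (G t)" "\<forall>t\<in>I. \<forall>i\<in>{1..n t}. \<beta> t i \<in> nonneg_measurable (G t)"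
    using assms unfolding exact_claims_def by blast
  then show ?thesis unfolding exact_claims_def
    by (intro CollectI exI[of _ "\<lambda>t i \<omega>. \<alpha> t i \<omega> + \<beta> t i \<omega>"])
      (auto simp: scaleR_add_left sum.distrib nonneg_measurable_def intro!: borel_measurable_add)
qed

lemma exact_claims_zero: "(\<lambda>\<omega>. 0) \<in> exact_claims G n \<gamma> I"
  unfolding exact_claims_def
  by (intro CollectI exI[of _ "\<lambda>t i \<omega>. 0"]) (auto simp: nonneg_measurable_def)

context market
begin

lemma filtration_subalgebra_mono: "s \<le> t \<Longrightarrow> t \<le> T \<Longrightarrow> subalgebra (F t) (F s)"
  using filtration_subalgebra[of s] filtration_subalgebra[of t] filtration_mono[of s t]
  by (auto simp: subalgebra_def)

lemma space_F: "t \<le> T \<Longrightarrow> space (F t) = space M"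
  using filtration_subalgebra by (simp add: subalgebra_def)

lemma exact_claims_measurable:
  assumes "y \<in> exact_claims F n \<gamma> I" "s \<le> T" "\<And>t. t \<in> I \<Longrightarrow> t \<le> s"
  shows "y \<in> borel_measurable (F s)"
proof -
  obtain \<alpha> where \<alpha>: "y = (\<lambda>\<omega>. \<Sum>t\<in>I. \<Sum>i=1..n t. \<alpha> t i \<omega> *\<^sub>R \<gamma> t i \<omega>)"
    "\<forall>t\<in>I. \<forall>i\<in>{1..n t}. \<alpha> t i \<in> nonneg_measurable (F t)"
    using assms unfolding exact_claims_def by blast
  have "(\<lambda>\<omega>. \<alpha> t i \<omega> *\<^sub>R \<gamma> t i \<omega>) \<in> borel_measurable (F s)" if "t \<in> I" "i \<in> {1..n t}" for t i
  proof (rule measurable_from_subalg[OF filtration_subalgebra_mono])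
    show "t \<le> s" "s \<le> T" using assms that by auto
    show "(\<lambda>\<omega>. \<alpha> t i \<omega> *\<^sub>R \<gamma> t i \<omega>) \<in> borel_measurable (F t)"
      using \<alpha>(2) that generators[of t i] assms(2) assms(3)[of t]
      by (intro borel_measurable_scaleR) (auto simp: nonneg_measurable_def)
  qed
  then show ?thesis unfolding \<alpha>(1) by (intro borel_measurable_sum)
qed

lemma exact_claims_measurable_M:
  assumes "y \<in> exact_claims F n \<gamma> I" "I \<subseteq> {..T}"
  shows "y \<in> borel_measurable M"
  by (rule measurable_from_subalg[OF filtration_subalgebra exact_claims_measurable[OF assms(1)], of T])
    (use assms in auto)

text \<open>No date in \<open>I\<close> precedes \<open>r\<close>, so the random choice
  \<open>\<tau>\<close> and the weight \<open>c\<close> are known whenever a coefficient is applied.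
  This allows passing to random subsequences and normalizing without leaving the strategies.\<close>

lemma exact_claims_paste:
  fixes y :: "nat \<Rightarrow> 'a \<Rightarrow> real^'d"
  assumes y: "\<And>k. y k \<in> exact_claims F n \<gamma> I" and I: "\<And>t. t \<in> I \<Longrightarrow> r \<le> t \<and> t \<le> T"
    and \<tau>: "\<tau> \<in> F r \<rightarrow>\<^sub>M count_space UNIV" and c: "c \<in> nonneg_measurable (F r)"
  shows "(\<lambda>\<omega>. c \<omega> *\<^sub>R y (\<tau> \<omega>) \<omega>) \<in> exact_claims F n \<gamma> I"
proof -
  have "\<forall>k. \<exists>\<alpha>. y k = (\<lambda>\<omega>. \<Sum>t\<in>I. \<Sum>i=1..n t. \<alpha> t i \<omega> *\<^sub>R \<gamma> t i \<omega>) \<and>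
    (\<forall>t\<in>I. \<forall>i\<in>{1..n t}. \<alpha> t i \<in> nonneg_measurable (F t))"
    using y unfolding exact_claims_def by simp
  from choice[OF this] obtain \<alpha> where \<alpha>: "\<And>k. y k = (\<lambda>\<omega>. \<Sum>t\<in>I. \<Sum>i=1..n t. \<alpha> k t i \<omega> *\<^sub>R \<gamma> t i \<omega>)"
    "\<And>k t i. t \<in> I \<Longrightarrow> i\<in>{1..n t} \<Longrightarrow> \<alpha> k t i \<in> nonneg_measurable (F t)" by blast
  show ?thesis unfolding exact_claims_def
  proof (intro CollectI exI[of _ "\<lambda>t i \<omega>. c \<omega> * \<alpha> (\<tau> \<omega>) t i \<omega>"] conjI ballI)
    show "(\<lambda>\<omega>. c \<omega> *\<^sub>R y (\<tau> \<omega>) \<omega>) = (\<lambda>\<omega>. \<Sum>t\<in>I. \<Sum>i = 1..n t. (c \<omega> * \<alpha> (\<tau> \<omega>) t i \<omega>) *\<^sub>R \<gamma> t i \<omega>)"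
      by (simp add: \<alpha>(1) scaleR_sum_right)
    fix t i assume t: "t \<in> I" "i \<in> {1..n t}"
    note sub = filtration_subalgebra_mono[of r t] 
    have rt: "r \<le> t" "t \<le> T" using I[OF t(1)] by auto
    have [measurable]: "\<tau> \<in> F t \<rightarrow>\<^sub>M count_space UNIV" "c \<in> borel_measurable (F t)"
      using measurable_from_subalg[OF sub[OF rt]] \<tau> c by (auto simp: nonneg_measurable_def)
    have "(\<lambda>\<omega>. \<alpha> (\<tau> \<omega>) t i \<omega>) \<in> borel_measurable (F t)"
      by (rule measurable_compose_countable[of "\<lambda>k. \<alpha> k t i"]) (use \<alpha>(2)[OF t] in \<open>auto simp: nonneg_measurable_def\<close>)
    then show "(\<lambda>\<omega>. c \<omega> * \<alpha> (\<tau> \<omega>) t i \<omega>) \<in> nonneg_measurable (F t)"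
      using \<alpha>(2)[OF t] c rt space_F[of r] space_F[of t] by (auto simp: nonneg_measurable_def)
  qed
qed

text \<open>At each \<open>\<omega>\<close> the limit stays in a finitely generated, hence closed,
  cone; the measurable choice of coefficients then turns the pointwise statement into a
  strategy.\<close>

lemma exact_claims_single_closed:
  assumes r: "r \<le> T" and x: "\<And>k. x k \<in> exact_claims F n \<gamma> {r}"
    and lim: "\<And>\<omega>. \<omega> \<in> space M \<Longrightarrow> (\<lambda>k. x k \<omega>) \<longlonglongrightarrow> x' \<omega>" and x': "x' \<in> borel_measurable (F r)"
  shows "\<exists>x''\<in>exact_claims F n \<gamma> {r}. \<forall>\<omega>\<in>space M. x'' \<omega> = x' \<omega>"
proof -
  have "\<exists>\<alpha>. (\<forall>i\<in>{1..n r}. \<alpha> i \<in> nonneg_measurable (F r)) \<and> (\<forall>\<omega>\<in>space (F r). x' \<omega> = (\<Sum>i=1..n r. \<alpha> i \<omega> *\<^sub>R \<gamma> r i \<omega>))"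
  proof (rule measurable_cone_coefficients)
    fix \<omega> assume \<omega>: "\<omega> \<in> space (F r)"
    let ?C = "{\<Sum>i=1..n r. a i *\<^sub>R \<gamma> r i \<omega> | a. \<forall>i\<in>{1..n r}. 0 \<le> a i}"
    have "x k \<omega> \<in> ?C" for k
      using x[of k] \<omega> unfolding exact_claims_def nonneg_measurable_def by fastforce
    moreover have "(\<lambda>k. x k \<omega>) \<longlonglongrightarrow> x' \<omega>" using lim[of \<omega>] \<omega> r by (simp add: space_F)
    ultimately have "x' \<omega> \<in> ?C"
      by (rule closed_sequentially[OF closed_finitely_generated_cone])
    then show "\<exists>a. (\<forall>i\<in>{1..n r}. 0 \<le> a i) \<and> x' \<omega> = (\<Sum>i=1..n r. a i *\<^sub>R \<gamma> r i \<omega>)" by blast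
  qed (use r generators x' in auto)
  then obtain \<alpha> where \<alpha>: "\<forall>i\<in>{1..n r}. \<alpha> i \<in> nonneg_measurable (F r)"
    "\<forall>\<omega>\<in>space (F r). x' \<omega> = (\<Sum>i=1..n r. \<alpha> i \<omega> *\<^sub>R \<gamma> r i \<omega>)" by blast
  show ?thesis
    by (rule bexI[of _ "\<lambda>\<omega>. \<Sum>t\<in>{r}. \<Sum>i=1..n r. \<alpha> i \<omega> *\<^sub>R \<gamma> r i \<omega>"])
      (use \<alpha> r in \<open>auto simp: exact_claims_def space_F intro!: exI[of _ "\<lambda>_. \<alpha>"]\<close>)
qed

text \<open>This is where \<open>null_strategies\<close> enters: zero trades before date
  \<open>r\<close> complete \<open>x\<close> and \<open>z\<close> to a full strategy.\<close>

lemma exact_claims_null: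
  assumes r: "r \<le> T" and x: "x \<in> exact_claims F n \<gamma> {r}" and z: "z \<in> exact_claims F n \<gamma> {Suc r..T}"
    and 0: "AE \<omega> in M. x \<omega> + z \<omega> = 0"
  shows "AE \<omega> in M. x \<omega> = 0"
proof -
  obtain \<alpha> where \<alpha>: "x = (\<lambda>\<omega>. \<Sum>i=1..n r. \<alpha> r i \<omega> *\<^sub>R \<gamma> r i \<omega>)"
    "\<And>i. i\<in>{1..n r} \<Longrightarrow> \<alpha> r i \<in> nonneg_measurable (F r)"
    using x unfolding exact_claims_def by auto
  obtain \<beta> where \<beta>: "z = (\<lambda>\<omega>. \<Sum>t\<in>{Suc r..T}. \<Sum>i=1..n t. \<beta> t i \<omega> *\<^sub>R \<gamma> t i \<omega>)"
    "\<And>t i. t\<in>{Suc r..T} \<Longrightarrow> i\<in>{1..n t} \<Longrightarrow> \<beta> t i \<in> nonneg_measurable (F t)"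
    using z unfolding exact_claims_def by blast
  define \<delta> where "\<delta> t i \<omega> = (if t = r then \<alpha> r i \<omega> else if t < r then 0 else \<beta> t i \<omega>)" for t i \<omega>
  have \<delta>: "\<delta> t i \<in> nonneg_measurable (F t)" if "t \<le> T" "i \<in> {1..n t}" for t i
    unfolding \<delta>_def using \<alpha>(2)[of i] \<beta>(2)[of t i] that
    by (cases t r rule: linorder_cases) (auto simp: nonneg_measurable_def)
  define \<xi> where "\<xi> t \<omega> = (\<Sum>i=1..n t. \<delta> t i \<omega> *\<^sub>R \<gamma> t i \<omega>)" for t \<omega>
  have \<xi>: "\<xi> t \<in> market_cone M F n \<gamma> t" if t: "t \<le> T" for t
    unfolding market_cone_def generated_cone_def
  proof (intro CollectI conjI exI[of _ "\<delta> t"] ballI)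
    show "\<xi> t \<in> L0 M"
      unfolding \<xi>_def using \<delta>[OF t] generators[OF t]
      by (intro borel_measurable_sum borel_measurable_scaleR measurable_from_subalg[OF filtration_subalgebra[OF t]])
        (auto simp: nonneg_measurable_def)
  qed (use \<delta> t in \<open>auto simp: \<xi>_def\<close>)
  have "(\<Sum>t\<le>T. \<xi> t \<omega>) = x \<omega> + z \<omega>" for \<omega>
  proof -
    have "(\<Sum>t\<le>T. \<xi> t \<omega>) = (\<Sum>t\<in>{r..T}. \<xi> t \<omega>)"
      by (rule sum.mono_neutral_right) (auto simp: \<xi>_def \<delta>_def)
    also have "\<dots> = \<xi> r \<omega> + (\<Sum>t\<in>{Suc r..T}. \<xi> t \<omega>)"
      using r by (subst sum.atLeast_Suc_atMost) auto
    also have "(\<Sum>t\<in>{Suc r..T}. \<xi> t \<omega>) = z \<omega>"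
      unfolding \<beta>(1) by (intro sum.cong) (auto simp: \<xi>_def \<delta>_def)
    finally show ?thesis by (simp add: \<xi>_def \<delta>_def \<alpha>(1))
  qed
  then have "AE \<omega> in M. (\<Sum>t\<le>T. \<xi> t \<omega>) = 0" using 0 by simp
  then have "AE \<omega> in M. \<xi> r \<omega> = 0" using null_strategies[of \<xi>] \<xi> r by blast
  then show ?thesis by (simp add: \<xi>_def \<delta>_def \<alpha>(1))
qed

text \<open>Backward induction on the first trading date, starting from no date at all. Where the
  trades at \<open>r\<close> are unbounded, normalizing them gives a limit trade of norm one that
  later trades cancel, contradicting \<open>exact_claims_null\<close>. Hence they are almost surely
  bounded, converge along a random subsequence, and leave later trades to the induction
  hypothesis.\<close>

lemma exact_claims_closed:
  assumes "r \<le> Suc T"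
  shows "(\<And>k. y k \<in> exact_claims F n \<gamma> {r..T}) \<Longrightarrow> (AE \<omega> in M. (\<lambda>k. y k \<omega>) \<longlonglongrightarrow> y' \<omega>) \<Longrightarrow>
    \<exists>y''\<in>exact_claims F n \<gamma> {r..T}. AE \<omega> in M. y' \<omega> = y'' \<omega>"
  using assms
proof (induction r arbitrary: y y' rule: inc_induct)
  case base
  have y0: "y k = (\<lambda>_. 0)" for k using base(1)[of k] by (simp add: exact_claims_def)
  have "AE \<omega> in M. y' \<omega> = 0"
    using base(2) by eventually_elim (simp add: y0 LIMSEQ_const_iff)
  then show ?case by (intro bexI[OF _ exact_claims_zero])
next
  case (step r)
  then have r: "r \<le> T" by simp
  have ins: "{r..T} = insert r {Suc r..T}" using r by auto
  have "\<exists>x z. x \<in> exact_claims F n \<gamma> {r} \<and> z \<in> exact_claims F n \<gamma> {Suc r..T} \<and> y k = (\<lambda>\<omega>. x \<omega> + z \<omega>)" for k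
    using step.prems(1)[of k] unfolding ins by (subst (asm) exact_claims_insert) auto
  then obtain x z where x: "\<And>k. x k \<in> exact_claims F n \<gamma> {r}" and z: "\<And>k. z k \<in> exact_claims F n \<gamma> {Suc r..T}"
    and y: "\<And>k. y k = (\<lambda>\<omega>. x k \<omega> + z k \<omega>)" by metis
  have xm[measurable]: "x k \<in> borel_measurable (F r)" for k
    by (rule exact_claims_measurable[OF x r]) auto
  note paste_x = exact_claims_paste[where r = r and I = "{r}"]
  note paste_z = exact_claims_paste[where r = r and I = "{Suc r..T}"]
  define P where "P \<omega> \<longleftrightarrow> (\<forall>R::nat. \<exists>k. norm (x k \<omega>) > real (Suc R))" for \<omega>
  have P[measurable]: "Measurable.pred (F r) P" unfolding P_def by measurable
  have "AE \<omega> in M. \<not> P \<omega>"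
  proof -
    \<comment> \<open>The first index at which the norm exceeds \<open>Suc R\<close>. The
      normalizing weight is then at most \<open>1 / Suc R\<close>, so the total claims
      \<open>y k \<omega>\<close>, bounded in \<open>k\<close>, disappear in the limit.\<close>
    define \<tau> where "\<tau> R \<omega> = (LEAST k. norm (x k \<omega>) > real (Suc R))" for R \<omega>
    have \<tau>[measurable]: "\<tau> R \<in> F r \<rightarrow>\<^sub>M count_space UNIV" for R unfolding \<tau>_def by measurable
    have \<tau>P: "norm (x (\<tau> R \<omega>) \<omega>) > real (Suc R)" if "P \<omega>" for R \<omega>
      unfolding \<tau>_def by (rule LeastI_ex) (use that in \<open>auto simp: P_def\<close>)
    define c where "c R \<omega> = (if P \<omega> then 1 / norm (x (\<tau> R \<omega>) \<omega>) else 0)" for R \<omega>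
    have [measurable]: "(\<lambda>\<omega>. x (\<tau> R \<omega>) \<omega>) \<in> borel_measurable (F r)" for R
      by (rule measurable_compose_countable[OF xm \<tau>])
    have c: "c R \<in> nonneg_measurable (F r)" for R
      unfolding nonneg_measurable_def c_def by auto
    have c_le: "\<bar>c R \<omega>\<bar> \<le> 1 / Suc R" for R \<omega>
    proof (cases "P \<omega>")
      case True
      have "1 / norm (x (\<tau> R \<omega>) \<omega>) \<le> 1 / Suc R"
        using \<tau>P[OF True, of R] by (intro divide_left_mono) (auto intro!: mult_pos_pos)
      then show ?thesis using True by (simp add: c_def)
    qed (simp add: c_def)
    define u where "u R \<omega> = c R \<omega> *\<^sub>R x (\<tau> R \<omega>) \<omega>" for R \<omega>
    define v where "v R \<omega> = c R \<omega> *\<^sub>R z (\<tau> R \<omega>) \<omega>" for R \<omega>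
    have u: "u R \<in> exact_claims F n \<gamma> {r}" for R unfolding u_def
      by (rule paste_x[OF x]) (use r \<tau> c in auto)
    have v: "v R \<in> exact_claims F n \<gamma> {Suc r..T}" for R unfolding v_def
      by (rule paste_z[OF z]) (use r \<tau> c in auto)
    have norm_u: "norm (u R \<omega>) = (if P \<omega> then 1 else 0)" for R \<omega>
      using \<tau>P[of \<omega> R] by (auto simp: u_def c_def)
    have um: "u R \<in> borel_measurable (F r)" for R by (rule exact_claims_measurable[OF u r]) auto
    have bdd: "bounded (range (\<lambda>k. u k \<omega>))" for \<omega>
      unfolding bounded_iff by (intro exI[of _ 1]) (auto simp: norm_u)
    obtain \<sigma> u' where \<sigma>: "\<And>k. \<sigma> k \<in> F r \<rightarrow>\<^sub>M count_space UNIV" "\<And>k \<omega>. k \<le> \<sigma> k \<omega>"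
      and u'm: "u' \<in> borel_measurable (F r)"
      and u': "\<And>\<omega>. \<omega> \<in> space (F r) \<Longrightarrow> (\<lambda>k. u (\<sigma> k \<omega>) \<omega>) \<longlonglongrightarrow> u' \<omega>"
      by (rule random_subsequence_vec[OF um bdd]) blast
    have u'P: "norm (u' \<omega>) = 1" if "P \<omega>" "\<omega> \<in> space M" for \<omega>
    proof -
      have "(\<lambda>k. norm (u (\<sigma> k \<omega>) \<omega>)) \<longlonglongrightarrow> norm (u' \<omega>)"
        using u'[of \<omega>] that r by (intro tendsto_norm) (simp add: space_F)
      then show ?thesis using that by (simp add: norm_u LIMSEQ_const_iff)
    qed
    have one: "(\<lambda>_. 1) \<in> nonneg_measurable (F r)" by (simp add: nonneg_measurable_def)
    have us: "(\<lambda>\<omega>. u (\<sigma> k \<omega>) \<omega>) \<in> exact_claims F n \<gamma> {r}" for k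
      using paste_x[OF u _ \<sigma>(1) one] r by simp
    have vs: "(\<lambda>\<omega>. v (\<sigma> k \<omega>) \<omega>) \<in> exact_claims F n \<gamma> {Suc r..T}" for k
      using paste_z[OF v _ \<sigma>(1) one] r by simp
    have u'S: "(\<lambda>k. u (\<sigma> k \<omega>) \<omega>) \<longlonglongrightarrow> u' \<omega>" if "\<omega> \<in> space M" for \<omega>
      using u'[of \<omega>] that r by (simp add: space_F)
    obtain u'' where u'': "u'' \<in> exact_claims F n \<gamma> {r}" "\<forall>\<omega>\<in>space M. u'' \<omega> = u' \<omega>"
      using exact_claims_single_closed[of r "\<lambda>k \<omega>. u (\<sigma> k \<omega>) \<omega>" u', OF r us u'S u'm] by blast
    have "AE \<omega> in M. (\<lambda>k. v (\<sigma> k \<omega>) \<omega>) \<longlonglongrightarrow> - u' \<omega>"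
      using step.prems(2) AE_space
    proof eventually_elim
      case (elim \<omega>)
      obtain B where B: "\<And>k. norm (y k \<omega>) \<le> B"
        using convergent_imp_Bseq[OF convergentI[OF elim(1)]] unfolding Bseq_def by blast
      have B0: "B \<ge> 0" using order_trans[OF norm_ge_zero B] .
      have "(\<lambda>k. u (\<sigma> k \<omega>) \<omega> + v (\<sigma> k \<omega>) \<omega>) \<longlonglongrightarrow> 0"
      proof (rule Lim_null_comparison[OF always_eventually], rule allI)
        fix k
        have "norm (u (\<sigma> k \<omega>) \<omega> + v (\<sigma> k \<omega>) \<omega>) = \<bar>c (\<sigma> k \<omega>) \<omega>\<bar> * norm (y (\<tau> (\<sigma> k \<omega>) \<omega>) \<omega>)"
          unfolding u_def v_def y by (simp add: scaleR_add_right[symmetric])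
        also have "\<dots> \<le> 1 / Suc (\<sigma> k \<omega>) * B" using c_le B by (intro mult_mono) auto
        also have "\<dots> \<le> 1 / Suc k * B" using \<sigma>(2)[of k \<omega>] B0
          by (intro mult_right_mono divide_left_mono) auto
        finally show "norm (u (\<sigma> k \<omega>) \<omega> + v (\<sigma> k \<omega>) \<omega>) \<le> 1 / real (Suc k) * B" .
      next
        show "(\<lambda>k. 1 / real (Suc k) * B) \<longlonglongrightarrow> 0"
          by (rule tendsto_mult_left_zero[OF LIMSEQ_Suc[OF lim_1_over_n]])
      qed
      from tendsto_diff[OF this u'[of \<omega>]] show ?case using elim(2) r by (simp add: space_F)
    qed
    from step.IH[of "\<lambda>k \<omega>. v (\<sigma> k \<omega>) \<omega>" "\<lambda>\<omega>. - u' \<omega>", OF vs this]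
    obtain v' where v': "v' \<in> exact_claims F n \<gamma> {Suc r..T}" "AE \<omega> in M. - u' \<omega> = v' \<omega>"
      by blast
    have "AE \<omega> in M. u'' \<omega> + v' \<omega> = 0"
      using v'(2) AE_space
    proof eventually_elim
      case (elim \<omega>)
      show ?case unfolding elim(1)[symmetric] using u''(2) elim(2) by simp
    qed
    then have "AE \<omega> in M. u'' \<omega> = 0" by (rule exact_claims_null[OF r u''(1) v'(1)])
    then show ?thesis using AE_space
    proof eventually_elim
      case (elim \<omega>)
      then show ?case using u'P[of \<omega>] u''(2) by auto
    qed
  qed
  note notP = this
  \<comment> \<open>Deleting the trades on the null event \<open>P\<close> makes the sequence
    bounded at every point, as the selection of a random subsequence requires.\<close>
  define w where "w k \<omega> = (if P \<omega> then 0 else x k \<omega>)" for k \<omega>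
  have wm: "w k \<in> borel_measurable (F r)" for k unfolding w_def by measurable
  have "(\<lambda>\<omega>. (if P \<omega> then 0 else 1) *\<^sub>R x k \<omega>) \<in> exact_claims F n \<gamma> {r}" for k
    by (rule paste_x[of "\<lambda>_. x k" "\<lambda>_. 0"]) (use x r in \<open>auto simp: nonneg_measurable_def\<close>)
  moreover have "(\<lambda>\<omega>. (if P \<omega> then 0 else 1) *\<^sub>R x k \<omega>) = w k" for k by (auto simp: w_def)
  ultimately have w: "w k \<in> exact_claims F n \<gamma> {r}" for k by simp
  have bdd: "bounded (range (\<lambda>k. w k \<omega>))" for \<omega>
    proof (cases "P \<omega>")
      case False
      then obtain R where "\<And>k. norm (x k \<omega>) \<le> real (Suc R)" by (auto simp: P_def not_less)
      then show ?thesis using False unfolding bounded_iff by (auto simp: w_def)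
    qed (auto simp: w_def)
  obtain \<sigma> w' where \<sigma>: "\<And>k. \<sigma> k \<in> F r \<rightarrow>\<^sub>M count_space UNIV" "\<And>k \<omega>. k \<le> \<sigma> k \<omega>"
    and w'm: "w' \<in> borel_measurable (F r)"
    and w': "\<And>\<omega>. \<omega> \<in> space (F r) \<Longrightarrow> (\<lambda>k. w (\<sigma> k \<omega>) \<omega>) \<longlonglongrightarrow> w' \<omega>"
    by (rule random_subsequence_vec[OF wm bdd]) blast
  have one: "(\<lambda>_. 1) \<in> nonneg_measurable (F r)" by (simp add: nonneg_measurable_def)
  have ws: "(\<lambda>\<omega>. w (\<sigma> k \<omega>) \<omega>) \<in> exact_claims F n \<gamma> {r}" for k
    using paste_x[OF w _ \<sigma>(1) one] r by simp
  have zs: "(\<lambda>\<omega>. z (\<sigma> k \<omega>) \<omega>) \<in> exact_claims F n \<gamma> {Suc r..T}" for k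
    using paste_z[OF z _ \<sigma>(1) one] r by simp
  have w'S: "(\<lambda>k. w (\<sigma> k \<omega>) \<omega>) \<longlonglongrightarrow> w' \<omega>" if "\<omega> \<in> space M" for \<omega>
    using w'[of \<omega>] that r by (simp add: space_F)
  obtain w'' where w'': "w'' \<in> exact_claims F n \<gamma> {r}" "\<forall>\<omega>\<in>space M. w'' \<omega> = w' \<omega>"
    using exact_claims_single_closed[of r "\<lambda>k \<omega>. w (\<sigma> k \<omega>) \<omega>" w', OF r ws w'S w'm] by blast
  have "AE \<omega> in M. (\<lambda>k. z (\<sigma> k \<omega>) \<omega>) \<longlonglongrightarrow> y' \<omega> - w' \<omega>"
    using step.prems(2) notP AE_space
  proof eventually_elim
    case (elim \<omega>)
    have "filterlim (\<lambda>k. \<sigma> k \<omega>) at_top sequentially"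
      by (rule filterlim_at_top_mono[OF filterlim_ident]) (simp add: \<sigma>)
    from filterlim_compose[OF elim(1) this] have "(\<lambda>k. y (\<sigma> k \<omega>) \<omega>) \<longlonglongrightarrow> y' \<omega>" .
    from tendsto_diff[OF this w'[of \<omega>]] show ?case using elim r by (simp add: space_F y w_def)
  qed
  from step.IH[of "\<lambda>k \<omega>. z (\<sigma> k \<omega>) \<omega>" "\<lambda>\<omega>. y' \<omega> - w' \<omega>", OF zs this]
  obtain z' where z': "z' \<in> exact_claims F n \<gamma> {Suc r..T}" "AE \<omega> in M. y' \<omega> - w' \<omega> = z' \<omega>"
    by blast
  have "(\<lambda>\<omega>. w'' \<omega> + z' \<omega>) \<in> exact_claims F n \<gamma> {r..T}"
    unfolding ins using w''(1) z'(1) by (subst exact_claims_insert) auto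
  moreover have "AE \<omega> in M. y' \<omega> = w'' \<omega> + z' \<omega>"
    using z'(2) AE_space
  proof eventually_elim
    case (elim \<omega>)
    have "y' \<omega> = w' \<omega> + (y' \<omega> - w' \<omega>)" by simp
    then show ?case unfolding elim(1) using w''(2) elim(2) by simp
  qed
  ultimately show ?case by (intro bexI[of _ "\<lambda>\<omega>. w'' \<omega> + z' \<omega>"])
qed

section \<open>Cone operations, burning and closedness for claims up to almost sure equality\<close>

abbreviation claims :: "('a \<Rightarrow> real^'d) set" where "claims \<equiv> market_claims M F T n \<gamma>"

lemma claims_iff: "X \<in> claims \<longleftrightarrow> X \<in> L0 M \<and> (\<exists>y\<in>exact_claims F n \<gamma> {..T}. AE \<omega> in M. X \<omega> = y \<omega>)"
  by (rule market_claims_iff) (use filtration_subalgebra generators in auto)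

lemma claims_measurable: "X \<in> claims \<Longrightarrow> X \<in> L0 M" by (simp add: claims_iff)

lemma claims_closed:
  assumes "\<And>k. X k \<in> claims" "AE \<omega> in M. (\<lambda>k. X k \<omega>) \<longlonglongrightarrow> X' \<omega>" "X' \<in> L0 M"
  shows "X' \<in> claims"
proof -
  obtain y where y: "\<And>k. y k \<in> exact_claims F n \<gamma> {0..T}" "\<And>k. AE \<omega> in M. X k \<omega> = y k \<omega>"
    using assms(1) unfolding claims_iff atLeast0AtMost by metis
  have "AE \<omega> in M. \<forall>k. X k \<omega> = y k \<omega>" using y(2) by (simp add: AE_all_countable)
  with assms(2) have "AE \<omega> in M. (\<lambda>k. y k \<omega>) \<longlonglongrightarrow> X' \<omega>" by eventually_elim simp
  with y(1) have "\<exists>y''\<in>exact_claims F n \<gamma> {0..T}. AE \<omega> in M. X' \<omega> = y'' \<omega>"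
    by (intro exact_claims_closed) auto
  then show ?thesis using assms(3) by (simp add: claims_iff atLeast0AtMost)
qed

lemma claims_add:
  assumes "X \<in> claims" "Y \<in> claims" shows "(\<lambda>\<omega>. X \<omega> + Y \<omega>) \<in> claims"
proof -
  obtain x y where xy: "x \<in> exact_claims F n \<gamma> {..T}" "y \<in> exact_claims F n \<gamma> {..T}"
    and X: "AE \<omega> in M. X \<omega> = x \<omega>" and Y: "AE \<omega> in M. Y \<omega> = y \<omega>" using assms by (auto simp: claims_iff)
  have "AE \<omega> in M. X \<omega> + Y \<omega> = x \<omega> + y \<omega>" using X Y by eventually_elim simp
  then show ?thesis unfolding claims_iff using assms exact_claims_add[OF xy]
    by (intro conjI bexI borel_measurable_add) (auto dest: claims_measurable)
qed

lemma claims_scaleR: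
  assumes "X \<in> claims" "0 \<le> c" shows "(\<lambda>\<omega>. c *\<^sub>R X \<omega>) \<in> claims"
proof -
  obtain x where x: "x \<in> exact_claims F n \<gamma> {..T}" and X: "AE \<omega> in M. X \<omega> = x \<omega>"
    using assms by (auto simp: claims_iff)
  have "(\<lambda>\<omega>. c *\<^sub>R x \<omega>) \<in> exact_claims F n \<gamma> {..T}"
    by (rule exact_claims_paste[of "\<lambda>_. x" "{..T}" 0 "\<lambda>_. 0" "\<lambda>_. c"]) (use x assms in \<open>auto simp: nonneg_measurable_def\<close>)
  moreover have "AE \<omega> in M. c *\<^sub>R X \<omega> = c *\<^sub>R x \<omega>" using X by eventually_elim simp
  ultimately show ?thesis unfolding claims_iff using assms
    by (intro conjI bexI) (auto dest: claims_measurable)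
qed

lemma claims_cong_AE:
  assumes "X \<in> claims" "AE \<omega> in M. X \<omega> = Y \<omega>" "Y \<in> L0 M" shows "Y \<in> claims"
proof -
  obtain x where x: "x \<in> exact_claims F n \<gamma> {..T}" and X: "AE \<omega> in M. X \<omega> = x \<omega>"
    using assms by (auto simp: claims_iff)
  have "AE \<omega> in M. Y \<omega> = x \<omega>" using X assms(2) by eventually_elim simp
  with x show ?thesis using assms(3) by (auto simp: claims_iff)
qed

lemma exact_claims_imp_claims: "y \<in> exact_claims F n \<gamma> {..T} \<Longrightarrow> y \<in> claims"
  by (auto simp: claims_iff exact_claims_measurable_M)

lemma exact_claims_mono:
  assumes "x \<in> exact_claims F n \<gamma> {t}" "t \<le> T" shows "x \<in> exact_claims F n \<gamma> {..T}"
proof -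
  have "insert t ({..T} - {t}) = {..T}" using assms(2) by auto
  moreover have "x \<in> exact_claims F n \<gamma> (insert t ({..T} - {t}))"
    using assms(1) exact_claims_zero[of F n \<gamma>]
    by (subst exact_claims_insert) (simp, simp, intro bexI[of _ x] bexI[of _ "\<lambda>_. 0"], auto)
  ultimately show ?thesis by simp
qed

lemma nonpos_in_claims:
  assumes X: "X \<in> borel_measurable (F T)" "\<And>\<omega>. X \<omega> \<le> 0" shows "X \<in> claims"
proof -
  have "X \<in> market_cone M F n \<gamma> T" using assms by (intro burning) auto
  then obtain \<alpha> where \<alpha>: "\<forall>i\<in>{1..n T}. \<alpha> i \<in> nonneg_measurable (F T)"
     "AE \<omega> in M. X \<omega> = (\<Sum>i=1..n T. \<alpha> i \<omega> *\<^sub>R \<gamma> T i \<omega>)"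
    unfolding market_cone_def generated_cone_def by blast
  have "(\<lambda>\<omega>. \<Sum>i=1..n T. \<alpha> i \<omega> *\<^sub>R \<gamma> T i \<omega>) \<in> exact_claims F n \<gamma> {T}"
    unfolding exact_claims_def using \<alpha>(1) by (auto intro!: exI[of _ "\<lambda>_. \<alpha>"])
  then have "(\<lambda>\<omega>. \<Sum>i=1..n T. \<alpha> i \<omega> *\<^sub>R \<gamma> T i \<omega>) \<in> exact_claims F n \<gamma> {..T}"
    by (rule exact_claims_mono) simp
  then show ?thesis unfolding claims_iff
    using \<alpha>(2) measurable_from_subalg[OF filtration_subalgebra X(1)] by auto
qed

text \<open>The excess over 1 is burned. Burning needs \<open>F T\<close>-measurability, which
  \<open>X\<close> may lack as a mere element of \<open>L0 M\<close>; hence the detour through the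
  exact representative \<open>x\<close>.\<close>

lemma claims_truncate:
  assumes X: "X \<in> claims" shows "(\<lambda>\<omega>. \<chi> i. min (X \<omega> $ i) 1) \<in> claims"
proof -
  obtain x where x: "x \<in> exact_claims F n \<gamma> {..T}" and eq: "AE \<omega> in M. X \<omega> = x \<omega>"
    using assms by (auto simp: claims_iff)
  have [measurable]: "x \<in> borel_measurable (F T)" by (rule exact_claims_measurable[OF x]) auto
  have [measurable]: "X \<in> L0 M" by (rule claims_measurable[OF X])
  have "(\<lambda>\<omega>. \<chi> i. min (x \<omega> $ i) 1 - x \<omega> $ i) \<in> claims"
  proof (rule nonpos_in_claims)
    show "(\<lambda>\<omega>. \<chi> i. min (x \<omega> $ i) 1 - x \<omega> $ i) \<in> borel_measurable (F T)"
      by (intro borel_measurable_vec_lambda borel_measurable_diff borel_measurable_min borel_measurable_vec_nth) auto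
  qed (simp add: less_eq_vec_def)
  from claims_add[OF this exact_claims_imp_claims[OF x]]
  have "(\<lambda>\<omega>. (\<chi> i. min (x \<omega> $ i) 1 - x \<omega> $ i) + x \<omega>) \<in> claims" .
  then show ?thesis
  proof (rule claims_cong_AE)
    show "AE \<omega> in M. (\<chi> i. min (x \<omega> $ i) 1 - x \<omega> $ i) + x \<omega> = (\<chi> i. min (X \<omega> $ i) 1)"
      using eq by eventually_elim (simp add: vec_eq_iff)
  qed (intro borel_measurable_vec_lambda borel_measurable_min borel_measurable_vec_nth, auto)
qed

end


section \<open>Absence of asymptotic arbitrage\<close>

text \<open>Convergence to zero in probability, in the form of the subsequence criterion; in this form
  products with a fixed random variable need no tightness argument.\<close>

definition null_in_prob :: "'b measure \<Rightarrow> (nat \<Rightarrow> 'b \<Rightarrow> real) \<Rightarrow> bool" where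
  "null_in_prob N f \<longleftrightarrow> (\<forall>r::nat \<Rightarrow> nat. strict_mono r \<longrightarrow>
     (\<exists>s::nat \<Rightarrow> nat. strict_mono s \<and> (AE x in N. (\<lambda>k. f (r (s k)) x) \<longlonglongrightarrow> 0)))"

lemma null_in_probE:
  assumes "null_in_prob N f" "strict_mono (r :: nat \<Rightarrow> nat)"
  obtains s :: "nat \<Rightarrow> nat" where "strict_mono s" "AE x in N. (\<lambda>k. f (r (s k)) x) \<longlonglongrightarrow> 0"
  using assms unfolding null_in_prob_def by blast

lemma AE_null_subseq:
  assumes "AE x in N. (\<lambda>k. f k x) \<longlonglongrightarrow> l x" "strict_mono (r :: nat \<Rightarrow> nat)"
  shows "AE x in N. (\<lambda>k. f (r k) x) \<longlonglongrightarrow> l x"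
  using assms(1) by eventually_elim (use LIMSEQ_subseq_LIMSEQ[OF _ assms(2)] in \<open>simp add: o_def\<close>)

lemma null_in_prob_AE:
  assumes "AE x in N. (\<lambda>k. f k x) \<longlonglongrightarrow> 0" shows "null_in_prob N f"
  unfolding null_in_prob_def
proof (intro allI impI exI[of _ id] conjI)
  fix r :: "nat \<Rightarrow> nat" assume "strict_mono r"
  then show "AE x in N. (\<lambda>k. f (r (id k)) x) \<longlonglongrightarrow> 0" using AE_null_subseq[OF assms] by simp
qed (simp add: strict_mono_def)

lemma null_in_prob_add:
  assumes "null_in_prob N f" "null_in_prob N g" shows "null_in_prob N (\<lambda>k x. f k x + g k x)"
  unfolding null_in_prob_def
proof (intro allI impI)
  fix r :: "nat \<Rightarrow> nat" assume r: "strict_mono r"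
  obtain s where s: "strict_mono s" "AE x in N. (\<lambda>k. f (r (s k)) x) \<longlonglongrightarrow> 0"
    using null_in_probE[OF assms(1) r] by blast
  obtain s' where s': "strict_mono s'" "AE x in N. (\<lambda>k. g (r (s (s' k))) x) \<longlonglongrightarrow> 0"
    using null_in_probE[OF assms(2) strict_mono_o[OF r s(1)]] by (auto simp: o_def)
  have "AE x in N. (\<lambda>k. f (r (s (s' k))) x + g (r (s (s' k))) x) \<longlonglongrightarrow> 0"
    using AE_null_subseq[OF s(2) s'(1)] s'(2) by eventually_elim (auto intro: tendsto_add_zero)
  then show "\<exists>s. strict_mono s \<and> (AE x in N. (\<lambda>k. f (r (s k)) x + g (r (s k)) x) \<longlonglongrightarrow> 0)"
    using strict_mono_o[OF s(1) s'(1)] by (intro exI[of _ "s \<circ> s'"]) (simp add: o_def)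
qed

lemma null_in_prob_sum:
  assumes "finite I" "\<And>i. i \<in> I \<Longrightarrow> null_in_prob N (f i)"
  shows "null_in_prob N (\<lambda>k x. \<Sum>i\<in>I. f i k x)"
  using assms
proof (induction I rule: finite_induct)
  case empty show ?case by (simp add: null_in_prob_AE)
next
  case (insert j I)
  then show ?case using null_in_prob_add[of N "f j" "\<lambda>k x. \<Sum>i\<in>I. f i k x"] by simp
qed

lemma null_in_prob_mult:
  assumes "null_in_prob N f" shows "null_in_prob N (\<lambda>k x. c x * f k x)"
  unfolding null_in_prob_def
proof (intro allI impI)
  fix r :: "nat \<Rightarrow> nat" assume r: "strict_mono r"
  obtain s where s: "strict_mono s" "AE x in N. (\<lambda>k. f (r (s k)) x) \<longlonglongrightarrow> 0"
    using null_in_probE[OF assms(1) r] by blast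
  have "AE x in N. (\<lambda>k. c x * f (r (s k)) x) \<longlonglongrightarrow> 0"
    using s(2) by eventually_elim (auto intro: tendsto_mult_right_zero)
  then show "\<exists>s. strict_mono s \<and> (AE x in N. (\<lambda>k. c x * f (r (s k)) x) \<longlonglongrightarrow> 0)" using s(1) by blast
qed

lemma null_in_prob_bound:
  assumes "null_in_prob N g" and le: "AE x in N. \<forall>k. \<bar>f k x\<bar> \<le> g k x"
  shows "null_in_prob N f"
  unfolding null_in_prob_def
proof (intro allI impI)
  fix r :: "nat \<Rightarrow> nat" assume r: "strict_mono r"
  obtain s where s: "strict_mono s" "AE x in N. (\<lambda>k. g (r (s k)) x) \<longlonglongrightarrow> 0"
    using null_in_probE[OF assms(1) r] by blast
  have "AE x in N. (\<lambda>k. f (r (s k)) x) \<longlonglongrightarrow> 0"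
    using s(2) le
  proof eventually_elim
    case (elim x)
    show ?case by (rule Lim_null_comparison[OF _ elim(1)]) (use elim(2) in auto)
  qed
  then show "\<exists>s. strict_mono s \<and> (AE x in N. (\<lambda>k. f (r (s k)) x) \<longlonglongrightarrow> 0)" using s(1) by blast
qed

lemma null_in_prob_abs:
  "null_in_prob N f \<Longrightarrow> null_in_prob N (\<lambda>k x. \<bar>f k x\<bar>)"
  by (simp add: null_in_prob_def tendsto_rabs_zero_iff)

lemma null_in_prob_L1:
  assumes "\<And>k. integrable N (f k)" "(\<lambda>k. \<integral>x. \<bar>f k x\<bar> \<partial>N) \<longlonglongrightarrow> 0"
  shows "null_in_prob N f"
  unfolding null_in_prob_def
proof (intro allI impI)
  fix r :: "nat \<Rightarrow> nat" assume r: "strict_mono r"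
  have "\<exists>s. strict_mono s \<and> (AE x in N. (\<lambda>k. f (r (s k)) x) \<longlonglongrightarrow> 0)"
  proof (rule tendsto_L1_AE_subseq)
    show "(\<lambda>k. \<integral>x. norm (f (r k) x) \<partial>N) \<longlonglongrightarrow> 0"
      using LIMSEQ_subseq_LIMSEQ[OF assms(2) r] by (simp add: o_def)
  qed (use assms in auto)
  then show "\<exists>s. strict_mono s \<and> (AE x in N. (\<lambda>k. f (r (s k)) x) \<longlonglongrightarrow> 0)" .
qed

lemma null_in_prob_const:
  assumes "null_in_prob N (\<lambda>k. f)" shows "AE x in N. f x = 0"
proof -
  obtain s :: "nat \<Rightarrow> nat" where "AE x in N. (\<lambda>k. f x) \<longlonglongrightarrow> 0"
    using null_in_probE[OF assms, of id] by (auto simp: strict_mono_def)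
  then show ?thesis by eventually_elim (simp add: LIMSEQ_const_iff)
qed

section \<open>One-step martingale increments against unbounded strategies\<close>

text \<open>The condition that \<open>Y\<close> has conditional mean zero given \<open>G\<close>,
  expressed through bounded test vectors. Unbounded strategies have possibly nonintegrable gains,
  and this form passes to the product space by Fubini.\<close>

locale martingale_increment = prob_space N for N :: "'b measure" +
  fixes G :: "'b measure" and Y :: "'b \<Rightarrow> 'e::euclidean_space"
  assumes sub: "subalgebra N G" and Y_int: "integrable N Y"
    and mart: "\<And>h. h \<in> borel_measurable G \<Longrightarrow> (\<And>x. norm (h x) \<le> 1) \<Longrightarrow> (\<integral>x. h x \<bullet> Y x \<partial>N) = 0"
begin

text \<open>Gains of mean zero have expected absolute value equal to twice the expected negative
  part, and the negative parts vanish in mean by dominated convergence with bound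
  \<open>norm (Y x)\<close>.\<close>

lemma bounded_gains_null:
  assumes h: "\<And>k. h k \<in> borel_measurable G" and h1: "\<And>k x. norm (h k x) \<le> 1"
    and neg: "AE x in N. (\<lambda>k. max 0 (- (h k x \<bullet> Y x))) \<longlonglongrightarrow> 0"
  shows "null_in_prob N (\<lambda>k x. h k x \<bullet> Y x)"
proof -
  have [measurable]: "h k \<in> borel_measurable N" for k by (rule measurable_from_subalg[OF sub h])
  have [measurable]: "Y \<in> borel_measurable N" using Y_int by simp
  have nY: "integrable N (\<lambda>x. norm (Y x))" using Y_int by simp
  have le: "\<bar>h k x \<bullet> Y x\<bar> \<le> norm (Y x)" for k x
    using Cauchy_Schwarz_ineq2[of "h k x" "Y x"] mult_right_mono[OF h1, of "norm (Y x)" k x] by simp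
  have int: "integrable N (\<lambda>x. h k x \<bullet> Y x)" for k
    by (rule Bochner_Integration.integrable_bound[OF nY]) (use le in auto)
  have int': "integrable N (\<lambda>x. max 0 (- (h k x \<bullet> Y x)))" for k using int by simp
  have lim: "(\<lambda>k. \<integral>x. max 0 (- (h k x \<bullet> Y x)) \<partial>N) \<longlonglongrightarrow> (\<integral>x. 0 \<partial>N)"
  proof (rule integral_dominated_convergence[OF _ _ nY neg])
    show "AE x in N. norm (max 0 (- (h k x \<bullet> Y x))) \<le> norm (Y x)" for k
    proof (intro AE_I2)
      fix x show "norm (max 0 (- (h k x \<bullet> Y x))) \<le> norm (Y x)" using le[of k x] by (auto simp: abs_le_iff)
    qed
  qed auto
  have "(\<integral>x. \<bar>h k x \<bullet> Y x\<bar> \<partial>N) = 2 * (\<integral>x. max 0 (- (h k x \<bullet> Y x)) \<partial>N)" for k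
  proof -
    have "(\<integral>x. \<bar>h k x \<bullet> Y x\<bar> \<partial>N) = (\<integral>x. h k x \<bullet> Y x + 2 * max 0 (- (h k x \<bullet> Y x)) \<partial>N)"
      by (intro Bochner_Integration.integral_cong) (auto simp: max_def)
    also have "\<dots> = (\<integral>x. h k x \<bullet> Y x \<partial>N) + 2 * (\<integral>x. max 0 (- (h k x \<bullet> Y x)) \<partial>N)"
      using int int' by simp
    finally show ?thesis using mart[OF h h1] by simp
  qed
  with tendsto_mult_right_zero[OF lim[simplified], of 2]
  have "(\<lambda>k. \<integral>x. \<bar>h k x \<bullet> Y x\<bar> \<partial>N) \<longlonglongrightarrow> 0" by simp
  then show ?thesis by (intro null_in_prob_L1 int)
qed

text \<open>On the set where the strategies are unbounded, their normalized cluster points \<open>g\<close> satisfy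
  \<open>g \<bullet> Y = 0\<close>, so a coordinate in which \<open>g\<close> does not vanish can be eliminated.\<close>

lemma gains_null_aux:
  assumes "finite J" "J \<subseteq> Basis" and "\<And>k. h k \<in> borel_measurable G"
    and "\<And>k x b. b \<in> Basis - J \<Longrightarrow> h k x \<bullet> b = 0"
    and "AE x in N. (\<lambda>k. max 0 (- (h k x \<bullet> Y x))) \<longlonglongrightarrow> 0"
  shows "null_in_prob N (\<lambda>k x. h k x \<bullet> Y x)"
  using assms
proof (induction J arbitrary: h rule: finite_psubset_induct)
  case (psubset J)
  note hG[measurable] = psubset.prems(2) and supp = psubset.prems(3) and neg = psubset.prems(4)
  define P where "P x \<longleftrightarrow> (\<forall>R::nat. \<exists>k. norm (h k x) > real (Suc R))" for x
  have P[measurable]: "Measurable.pred G P" unfolding P_def by measurable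
  have A: "null_in_prob N (\<lambda>k x. if P x then 0 else h k x \<bullet> Y x)"
  proof -
    \<comment> \<open>A \<open>G\<close>-measurable bound valid for all \<open>k\<close> at once.
      Dividing by it reduces to bounded strategies, and multiplying back is harmless since the
      factor does not depend on \<open>k\<close>.\<close>
    define \<rho> where "\<rho> x = (LEAST R. \<forall>k. norm (h k x) \<le> real (Suc R))" for x
    have [measurable]: "\<rho> \<in> G \<rightarrow>\<^sub>M count_space UNIV" unfolding \<rho>_def by measurable
    have \<rho>: "norm (h k x) \<le> real (Suc (\<rho> x))" if "\<not> P x" for k x
    proof -
      have "\<exists>R. \<forall>k. norm (h k x) \<le> real (Suc R)" using that by (auto simp: P_def not_less)
      from LeastI_ex[OF this] show ?thesis unfolding \<rho>_def by blast
    qed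
    define h' where "h' k x = (if P x then 0 else (1 / real (Suc (\<rho> x))) *\<^sub>R h k x)" for k x
    have "null_in_prob N (\<lambda>k x. h' k x \<bullet> Y x)"
    proof (rule bounded_gains_null)
      show "h' k \<in> borel_measurable G" for k unfolding h'_def by measurable
      show "norm (h' k x) \<le> 1" for k x using \<rho>[of x k] by (simp add: h'_def)
      show "AE x in N. (\<lambda>k. max 0 (- (h' k x \<bullet> Y x))) \<longlonglongrightarrow> 0"
        using neg
      proof eventually_elim
        case (elim x)
        show ?case
        proof (rule Lim_null_comparison[OF always_eventually elim], rule allI)
          fix k
          have "max 0 (- ((1 / real (Suc (\<rho> x))) * (h k x \<bullet> Y x))) \<le> max 0 (- (h k x \<bullet> Y x))"
          proof (cases "h k x \<bullet> Y x \<le> 0")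
            case True
            have "(1 / real (Suc (\<rho> x))) * (- (h k x \<bullet> Y x)) \<le> 1 * (- (h k x \<bullet> Y x))"
              using True by (intro mult_right_mono) auto
            then show ?thesis by (simp add: max.coboundedI2)
          qed (simp add: max_def mult_nonneg_nonneg divide_nonneg_pos)
          then show "norm (max 0 (- (h' k x \<bullet> Y x))) \<le> max 0 (- (h k x \<bullet> Y x))"
            by (simp add: h'_def)
        qed
      qed
    qed
    from null_in_prob_mult[OF this, of "\<lambda>x. real (Suc (\<rho> x))"]
    have "null_in_prob N (\<lambda>k x. real (Suc (\<rho> x)) * (h' k x \<bullet> Y x))" .
    moreover have "real (Suc (\<rho> x)) * (h' k x \<bullet> Y x) = (if P x then 0 else h k x \<bullet> Y x)" for k x
      by (simp add: h'_def)
    ultimately show ?thesis by simp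
  qed
  define \<tau> where "\<tau> R x = (LEAST k. norm (h k x) > real (Suc R))" for R x
  have \<tau>[measurable]: "\<tau> R \<in> G \<rightarrow>\<^sub>M count_space UNIV" for R unfolding \<tau>_def by measurable
  have \<tau>P: "norm (h (\<tau> R x) x) > real (Suc R)" if "P x" for R x
    unfolding \<tau>_def by (rule LeastI_ex) (use that in \<open>auto simp: P_def\<close>)
  have [measurable]: "(\<lambda>x. h (\<tau> R x) x) \<in> borel_measurable G" for R
    by (rule measurable_compose_countable[OF hG \<tau>])
  define u where "u R x = (if P x then (1 / norm (h (\<tau> R x) x)) *\<^sub>R h (\<tau> R x) x else 0)" for R x
  have um: "u R \<in> borel_measurable G" for R unfolding u_def by measurable
  have norm_u: "norm (u R x) = (if P x then 1 else 0)" for R x using \<tau>P[of x R] by (auto simp: u_def)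
  have bdd: "bounded (range (\<lambda>k. u k x))" for x
    unfolding bounded_iff by (intro exI[of _ 1]) (auto simp: norm_u)
  obtain \<sigma> g0 where \<sigma>: "\<And>k. \<sigma> k \<in> G \<rightarrow>\<^sub>M count_space UNIV" "\<And>k x. k \<le> \<sigma> k x"
    and g0m: "g0 \<in> borel_measurable G"
    and g0: "\<And>x. x \<in> space G \<Longrightarrow> (\<lambda>k. u (\<sigma> k x) x) \<longlonglongrightarrow> g0 x"
    by (rule random_subsequence_vec[OF um bdd]) blast
  have spG: "space G = space N" using sub by (simp add: subalgebra_def)
  \<comment> \<open>The value 0 off the space gives \<open>norm (g x) \<le> 1\<close> at every
    point, as \<open>mart\<close> requires of its test vectors.\<close>
  define g where "g x = (if x \<in> space G then g0 x else 0)" for x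
  have gm[measurable]: "g \<in> borel_measurable G"
    by (rule measurable_cong[THEN iffD1, OF _ g0m]) (simp add: g_def)
  have g: "(\<lambda>k. u (\<sigma> k x) x) \<longlonglongrightarrow> g x" if "x \<in> space N" for x using g0[of x] that spG by (simp add: g_def)
  have norm_g: "norm (g x) = (if P x then 1 else 0)" if "x \<in> space N" for x
    using tendsto_norm[OF g[OF that]] by (simp add: norm_u LIMSEQ_const_iff split: if_splits)
  have g_le: "norm (g x) \<le> 1" for x using norm_g[of x] spG by (cases "x \<in> space N") (auto simp: g_def)
  have g_supp: "g x \<bullet> b = 0" if "b \<in> Basis - J" for x b
  proof (cases "x \<in> space N")
    case True
    have "(\<lambda>k. u (\<sigma> k x) x \<bullet> b) \<longlonglongrightarrow> g x \<bullet> b" by (intro tendsto_intros g True)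
    moreover have "u R x \<bullet> b = 0" for R using supp[OF that] by (simp add: u_def)
    ultimately show ?thesis by (simp add: LIMSEQ_const_iff)
  qed (simp add: g_def spG)
  \<comment> \<open>At almost every point the losses are bounded in \<open>k\<close>; divided by
    norms tending to infinity they vanish.\<close>
  have gY_nonneg: "AE x in N. 0 \<le> g x \<bullet> Y x" using neg AE_space
  proof eventually_elim
    case (elim x)
    obtain B where B: "\<And>k. norm (max 0 (- (h k x \<bullet> Y x))) \<le> B"
      using convergent_imp_Bseq[OF convergentI[OF elim(1)]] unfolding Bseq_def by blast
    have B0: "B \<ge> 0" using order_trans[OF norm_ge_zero B] .
    have ge: "- (B / real (Suc k)) \<le> u (\<sigma> k x) x \<bullet> Y x" for k
    proof (cases "P x")
      case True
      define c where "c = 1 / norm (h (\<tau> (\<sigma> k x) x) x)"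
      have "real (Suc k) \<le> norm (h (\<tau> (\<sigma> k x) x) x)" using \<tau>P[OF True, of "\<sigma> k x"] \<sigma>(2)[of k x] by linarith
      then have c: "0 \<le> c" "c \<le> 1 / real (Suc k)" unfolding c_def
        by (auto intro!: divide_left_mono mult_pos_pos)
      have "- (h (\<tau> (\<sigma> k x) x) x \<bullet> Y x) \<le> B" using B[of "\<tau> (\<sigma> k x) x"] by simp
      from mult_left_mono[OF this c(1)]
      have "- (u (\<sigma> k x) x \<bullet> Y x) \<le> c * B" using True by (simp add: u_def c_def)
      also have "c * B \<le> 1 / real (Suc k) * B" using c B0 by (intro mult_right_mono)
      finally show ?thesis by simp
    qed (use B0 in \<open>auto simp: u_def\<close>)
    have l1: "(\<lambda>k. u (\<sigma> k x) x \<bullet> Y x) \<longlonglongrightarrow> g x \<bullet> Y x" by (intro tendsto_intros g elim)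
    have l2: "(\<lambda>k. - (B / real (Suc k))) \<longlonglongrightarrow> - 0"
      by (intro tendsto_minus LIMSEQ_Suc[OF lim_const_over_n])
    show ?case using LIMSEQ_le[OF l2 l1] ge by auto
  qed
  \<comment> \<open>Used as a constant sequence of bounded strategies, \<open>g\<close> has
    nonnegative gains of mean zero.\<close>
  have "null_in_prob N (\<lambda>k::nat. \<lambda>x. g x \<bullet> Y x)"
  proof (rule bounded_gains_null)
    show "AE x in N. (\<lambda>k. max 0 (- (g x \<bullet> Y x))) \<longlonglongrightarrow> 0"
      using gY_nonneg by eventually_elim simp
  qed (use gm g_le in auto)
  then have gY: "AE x in N. g x \<bullet> Y x = 0" by (rule null_in_prob_const)
  define w where "w b k x = (if P x \<and> g x \<bullet> b \<noteq> 0 then h k x - ((h k x \<bullet> b) / (g x \<bullet> b)) *\<^sub>R g x else 0)" for b k x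
  have wY: "AE x in N. \<forall>k b. w b k x \<bullet> Y x = (if P x \<and> g x \<bullet> b \<noteq> 0 then h k x \<bullet> Y x else 0)"
    using gY by eventually_elim (auto simp: w_def inner_diff_left)
  have W: "null_in_prob N (\<lambda>k x. w b k x \<bullet> Y x)" if b: "b \<in> J" for b
  proof (rule psubset.IH[of "J - {b}"])
    show "J - {b} \<subset> J" "J - {b} \<subseteq> Basis" using b psubset.prems(1) by auto
    show "w b k \<in> borel_measurable G" for k unfolding w_def by measurable
    show "w b k x \<bullet> c = 0" if "c \<in> Basis - (J - {b})" for k x c
      using supp[of c k x] g_supp[of c x] that by (cases "c = b") (auto simp: w_def inner_diff_left)
    show "AE x in N. (\<lambda>k. max 0 (- (w b k x \<bullet> Y x))) \<longlonglongrightarrow> 0"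
      using neg wY
    proof eventually_elim
      case (elim x)
      then show ?case by (cases "P x \<and> g x \<bullet> b \<noteq> 0") auto
    qed
  qed
  \<comment> \<open>Which coordinate of \<open>g x\<close> is nonzero depends on \<open>x\<close>.
    Summing over all of \<open>J\<close> spares a measurable choice of it, and the term of the right
    coordinate reproduces the gain.\<close>
  show ?case
  proof (rule null_in_prob_bound)
    show "null_in_prob N (\<lambda>k x. \<bar>if P x then 0 else h k x \<bullet> Y x\<bar> + (\<Sum>b\<in>J. \<bar>w b k x \<bullet> Y x\<bar>))"
      by (intro null_in_prob_add null_in_prob_sum null_in_prob_abs A W psubset.hyps(1))
    show "AE x in N. \<forall>k. \<bar>h k x \<bullet> Y x\<bar> \<le> \<bar>if P x then 0 else h k x \<bullet> Y x\<bar> + (\<Sum>b\<in>J. \<bar>w b k x \<bullet> Y x\<bar>)"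
      using wY AE_space
    proof eventually_elim
      case (elim x)
      show ?case
      proof
        fix k
        show "\<bar>h k x \<bullet> Y x\<bar> \<le> \<bar>if P x then 0 else h k x \<bullet> Y x\<bar> + (\<Sum>b\<in>J. \<bar>w b k x \<bullet> Y x\<bar>)"
        proof (cases "P x")
          case True
          have "g x \<noteq> 0" using norm_g[OF elim(2)] True by auto
          then obtain b where b: "b \<in> Basis" "g x \<bullet> b \<noteq> 0" using euclidean_all_zero_iff by blast
          then have "b \<in> J" using g_supp by blast
          then have "\<bar>w b k x \<bullet> Y x\<bar> \<le> (\<Sum>b\<in>J. \<bar>w b k x \<bullet> Y x\<bar>)"
            using psubset.hyps(1) by (intro member_le_sum) auto
          moreover have "w b k x \<bullet> Y x = h k x \<bullet> Y x" using elim(1) True b(2) by simp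
          ultimately show ?thesis using True by simp
        qed (simp add: sum_nonneg)
      qed
    qed
  qed
qed

lemma gains_null:
  assumes "\<And>k. h k \<in> borel_measurable G" "AE x in N. (\<lambda>k. max 0 (- (h k x \<bullet> Y x))) \<longlonglongrightarrow> 0"
  shows "null_in_prob N (\<lambda>k x. h k x \<bullet> Y x)"
  by (rule gains_null_aux[of Basis]) (use assms in auto)

text \<open>A negative initial value must be recovered by gains. Trading only where
  \<open>x k\<close> is negative, an event known in \<open>G\<close>, leaves gains with vanishing
  negative parts; so these gains vanish, and the initial shortfall with them.\<close>

lemma initial_values_null:
  assumes x: "\<And>k. x k \<in> borel_measurable G" and h: "\<And>k. h k \<in> borel_measurable G"
    and neg: "AE \<omega> in N. (\<lambda>k. max 0 (- (x k \<omega> + h k \<omega> \<bullet> Y \<omega>))) \<longlonglongrightarrow> 0"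
  shows "null_in_prob N (\<lambda>k \<omega>. max 0 (- x k \<omega>))"
proof -
  note [measurable] = x h
  define h' where "h' k \<omega> = (if x k \<omega> < 0 then h k \<omega> else 0)" for k \<omega>
  have "null_in_prob N (\<lambda>k \<omega>. h' k \<omega> \<bullet> Y \<omega>)"
  proof (rule gains_null)
    show "h' k \<in> borel_measurable G" for k unfolding h'_def by measurable
    show "AE \<omega> in N. (\<lambda>k. max 0 (- (h' k \<omega> \<bullet> Y \<omega>))) \<longlonglongrightarrow> 0" using neg
    proof eventually_elim
      case (elim \<omega>)
      show ?case by (rule Lim_null_comparison[OF always_eventually elim]) (auto simp: h'_def)
    qed
  qed
  from null_in_prob_add[OF this null_in_prob_AE[OF neg]] show ?thesis
  proof (rule null_in_prob_bound)
    show "AE \<omega> in N. \<forall>k. \<bar>max 0 (- x k \<omega>)\<bar> \<le> h' k \<omega> \<bullet> Y \<omega> + max 0 (- (x k \<omega> + h k \<omega> \<bullet> Y \<omega>))"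
      by (auto simp: h'_def)
  qed
qed

end

text \<open>The values \<open>Z t \<bullet> S k t\<close> form generalized supermartingales: negligible losses at time
  \<open>T\<close> propagate backwards to all times, and then negligible gains propagate forwards.\<close>

lemma no_asymptotic_arbitrage:
  fixes Z :: "nat \<Rightarrow> 'b \<Rightarrow> real^'d" and S :: "nat \<Rightarrow> nat \<Rightarrow> 'b \<Rightarrow> real^'d"
  assumes N: "prob_space N" and sub: "\<And>t. t \<le> T \<Longrightarrow> subalgebra N (G t)"
    and Z: "\<And>t. t \<le> T \<Longrightarrow> Z t \<in> borel_measurable (G t)"
    and Zint: "\<And>t. t \<le> T \<Longrightarrow> integrable N (Z t)"
    and mart: "\<And>t h. t < T \<Longrightarrow> h \<in> borel_measurable (G t) \<Longrightarrow> (\<And>x. norm (h x) \<le> 1) \<Longrightarrow>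
      (\<integral>x. h x \<bullet> (Z (Suc t) x - Z t x) \<partial>N) = 0"
    and S: "\<And>k t. t \<le> T \<Longrightarrow> S k t \<in> borel_measurable (G t)"
    and S0: "\<And>k. AE x in N. Z 0 x \<bullet> S k 0 x \<le> 0"
    and SSuc: "\<And>k t. t < T \<Longrightarrow> AE x in N. Z (Suc t) x \<bullet> S k (Suc t) x \<le> Z (Suc t) x \<bullet> S k t x"
    and lim: "AE x in N. (\<lambda>k. S k T x) \<longlonglongrightarrow> W x"
    and W: "AE x in N. 0 \<le> W x" and ZT: "AE x in N. \<forall>i. 0 < Z T x $ i"
  shows "AE x in N. W x = 0"
proof -
  define U where "U k t x = Z t x \<bullet> S k t x" for k t x
  have Um: "U k t \<in> borel_measurable (G t)" if "t \<le> T" for k t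
    unfolding U_def using Z S that by (intro borel_measurable_inner) auto
  define D where "D t x = Z (Suc t) x - Z t x" for t x
  \<comment> \<open>Trading at \<open>Suc t\<close> cannot raise the value, and
    \<open>Z (Suc t) \<bullet> S k t\<close> is the old value plus the gain
    \<open>S k t \<bullet> D t\<close>.\<close>
  have USuc: "AE x in N. \<forall>k. U k (Suc t) x \<le> U k t x + S k t x \<bullet> D t x" if "t < T" for t
  proof -
    have "AE x in N. \<forall>k. Z (Suc t) x \<bullet> S k (Suc t) x \<le> Z (Suc t) x \<bullet> S k t x"
      using SSuc[OF that] by (simp add: AE_all_countable)
    then show ?thesis
      by eventually_elim (simp add: U_def D_def inner_diff_right inner_commute)
  qed
  have mi: "martingale_increment N (G t) (D t)" if "t < T" for t
    unfolding D_def
    by (intro martingale_increment.intro martingale_increment_axioms.intro N sub mart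
        Bochner_Integration.integrable_diff Zint) (use that in auto)
  have UT: "AE x in N. (\<lambda>k. U k T x) \<longlonglongrightarrow> Z T x \<bullet> W x"
    using lim by eventually_elim (auto simp: U_def intro!: tendsto_intros)
  have ZW: "AE x in N. 0 \<le> Z T x \<bullet> W x" using W ZT
    by eventually_elim (auto simp: inner_vec_def less_eq_vec_def less_imp_le intro!: sum_nonneg mult_nonneg_nonneg)
  \<comment> \<open>Backward pass: \<open>initial_values_null\<close> carries vanishing negative
    parts from \<open>Suc t\<close> to \<open>t\<close>, thinning the subsequence once per date and
    keeping the later dates.\<close>
  have "\<exists>r::nat \<Rightarrow> nat. strict_mono r \<and> (\<forall>s\<in>{t..T}. AE x in N. (\<lambda>k. max 0 (- U (r k) s x)) \<longlonglongrightarrow> 0)" if "t \<le> T" for t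
    using that
  proof (induction t rule: inc_induct)
    case base
    have "AE x in N. (\<lambda>k. max 0 (- U k T x)) \<longlonglongrightarrow> 0" using UT ZW
    proof eventually_elim
      case (elim x)
      have "(\<lambda>k. max 0 (- U k T x)) \<longlonglongrightarrow> max 0 (- (Z T x \<bullet> W x))" by (intro tendsto_intros elim)
      then show ?case using elim(2) by simp
    qed
    then show ?case by (intro exI[of _ id]) (auto simp: strict_mono_def)
  next
    case (step t)
    then obtain r :: "nat \<Rightarrow> nat" where r: "strict_mono r"
      and neg: "\<And>s. s \<in> {Suc t..T} \<Longrightarrow> AE x in N. (\<lambda>k. max 0 (- U (r k) s x)) \<longlonglongrightarrow> 0" by blast
    interpret martingale_increment N "G t" "D t" using mi step by simp
    have "null_in_prob N (\<lambda>k x. max 0 (- U (r k) t x))"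
    proof (rule initial_values_null)
      have "AE x in N. (\<lambda>k. max 0 (- U (r k) (Suc t) x)) \<longlonglongrightarrow> 0" using neg[of "Suc t"] step by simp
      then show "AE x in N. (\<lambda>k. max 0 (- (U (r k) t x + S (r k) t x \<bullet> D t x))) \<longlonglongrightarrow> 0"
        using USuc[OF step(2)]
      proof eventually_elim
        case (elim x)
        have "max 0 (- (U (r k) t x + S (r k) t x \<bullet> D t x)) \<le> max 0 (- U (r k) (Suc t) x)" for k
          using spec[OF elim(2), of "r k"] by (intro max.mono) auto
        then show ?case by (intro Lim_null_comparison[OF always_eventually elim(1)]) auto
      qed
    qed (use Um S step in auto)
    from null_in_probE[OF this, of id] obtain s :: "nat \<Rightarrow> nat" where s: "strict_mono s"
      "AE x in N. (\<lambda>k. max 0 (- U (r (s k)) t x)) \<longlonglongrightarrow> 0" by (auto simp: strict_mono_def)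
    have "AE x in N. (\<lambda>k. max 0 (- U ((r \<circ> s) k) s' x)) \<longlonglongrightarrow> 0" if "s' \<in> {t..T}" for s'
    proof (cases "s' = t")
      case False
      then show ?thesis using AE_null_subseq[OF neg s(1), of s'] that by simp
    qed (use s in simp)
    then show ?case using strict_mono_o[OF r s(1)] by blast
  qed
  from this[of 0] obtain r :: "nat \<Rightarrow> nat" where r: "strict_mono r"
    and neg: "\<And>s. s \<le> T \<Longrightarrow> AE x in N. (\<lambda>k. max 0 (- U (r k) s x)) \<longlonglongrightarrow> 0" by auto
  \<comment> \<open>Forward pass: at date 0 the values are nonpositive with vanishing negative
    parts. Afterwards the losses in \<open>S k t \<bullet> D t\<close> are at most the negative part
    of the new value plus the absolute old value, so \<open>gains_null\<close> applies and the new
    value is squeezed to zero.\<close>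
  have "\<exists>s::nat \<Rightarrow> nat. strict_mono s \<and> (AE x in N. (\<lambda>k. U (r (s k)) t x) \<longlonglongrightarrow> 0)" if "t \<le> T" for t
    using that
  proof (induction t)
    case 0
    have "AE x in N. \<forall>k. U k 0 x \<le> 0" using S0 by (simp add: AE_all_countable U_def)
    with neg[OF le0] have "AE x in N. (\<lambda>k. U (r k) 0 x) \<longlonglongrightarrow> 0"
    proof eventually_elim
      case (elim x)
      show ?case by (rule Lim_null_comparison[OF always_eventually elim(1)]) (use elim(2) in auto)
    qed
    then show ?case by (intro exI[of _ id]) (auto simp: strict_mono_def)
  next
    case (Suc t)
    then obtain s :: "nat \<Rightarrow> nat" where s: "strict_mono s" "AE x in N. (\<lambda>k. U (r (s k)) t x) \<longlonglongrightarrow> 0" by auto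
    interpret martingale_increment N "G t" "D t" using mi Suc by simp
    have negS: "AE x in N. (\<lambda>k. max 0 (- U (r (s k)) (Suc t) x)) \<longlonglongrightarrow> 0"
      by (rule AE_null_subseq[OF neg[OF Suc.prems] s(1)])
    have le: "AE x in N. \<forall>k. U k (Suc t) x \<le> U k t x + S k t x \<bullet> D t x" using USuc Suc by simp
    have "null_in_prob N (\<lambda>k x. S (r (s k)) t x \<bullet> D t x)"
    proof (rule gains_null)
      show "AE x in N. (\<lambda>k. max 0 (- (S (r (s k)) t x \<bullet> D t x))) \<longlonglongrightarrow> 0"
        using negS s(2) le
      proof eventually_elim
        case (elim x)
        have "(\<lambda>k. max 0 (- U (r (s k)) (Suc t) x) + \<bar>U (r (s k)) t x\<bar>) \<longlonglongrightarrow> 0"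
          by (intro tendsto_add_zero tendsto_rabs_zero elim)
        then show ?case
        proof (rule Lim_null_comparison[OF always_eventually, rotated], intro allI)
          fix k
          show "norm (max 0 (- (S (r (s k)) t x \<bullet> D t x))) \<le> max 0 (- U (r (s k)) (Suc t) x) + \<bar>U (r (s k)) t x\<bar>"
            using spec[OF elim(3), of "r (s k)"] by auto
        qed
      qed
    qed (use S Suc in auto)
    from null_in_probE[OF this, of id] obtain s' :: "nat \<Rightarrow> nat" where s': "strict_mono s'"
      "AE x in N. (\<lambda>k. S (r (s (s' k))) t x \<bullet> D t x) \<longlonglongrightarrow> 0" by (auto simp: strict_mono_def)
    have "AE x in N. (\<lambda>k. U (r (s (s' k))) (Suc t) x) \<longlonglongrightarrow> 0"
      using AE_null_subseq[OF negS s'(1)] AE_null_subseq[OF s(2) s'(1)] s'(2) le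
    proof eventually_elim
      case (elim x)
      have "(\<lambda>k. max 0 (- U (r (s (s' k))) (Suc t) x) + \<bar>U (r (s (s' k))) t x\<bar> + \<bar>S (r (s (s' k))) t x \<bullet> D t x\<bar>) \<longlonglongrightarrow> 0"
        by (intro tendsto_add_zero tendsto_rabs_zero elim)
      then show ?case
      proof (rule Lim_null_comparison[OF always_eventually, rotated], intro allI)
        fix k
        show "norm (U (r (s (s' k))) (Suc t) x) \<le>
            max 0 (- U (r (s (s' k))) (Suc t) x) + \<bar>U (r (s (s' k))) t x\<bar> + \<bar>S (r (s (s' k))) t x \<bullet> D t x\<bar>"
          using spec[OF elim(4), of "r (s (s' k))"] by auto
      qed
    qed
    then show ?case using strict_mono_o[OF s(1) s'(1)] by (intro exI[of _ "s \<circ> s'"]) (simp add: o_def)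
  qed
  from this[of T] obtain s :: "nat \<Rightarrow> nat" where s: "strict_mono s" "AE x in N. (\<lambda>k. U (r (s k)) T x) \<longlonglongrightarrow> 0" by auto
  have "AE x in N. (\<lambda>k. U (r (s k)) T x) \<longlonglongrightarrow> Z T x \<bullet> W x"
    using AE_null_subseq[OF UT strict_mono_o[OF r s(1)]] by simp
  with s(2) W ZT show ?thesis
  proof eventually_elim
    case (elim x)
    have "Z T x \<bullet> W x = 0" using elim(1,4) LIMSEQ_unique by blast
    then have "(\<Sum>i\<in>UNIV. Z T x $ i * W x $ i) = 0" by (simp add: inner_vec_def)
    then have "\<forall>i. Z T x $ i * W x $ i = 0"
      by (subst (asm) sum_nonneg_eq_0_iff) (use elim(2,3) in \<open>auto simp: less_eq_vec_def less_imp_le\<close>)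
    then show ?case using elim(3) by (simp add: vec_eq_iff) (metis less_irrefl)
  qed
qed


section \<open>Existence of risk minimizers\<close>

lemma AE_convergent_if_L2_increments_summable:
  fixes f :: "nat \<Rightarrow> 'b \<Rightarrow> real"
  assumes N: "prob_space N" and [measurable]: "\<And>k. f k \<in> borel_measurable N"
    and int: "\<And>k. integrable N (\<lambda>x. (f (Suc k) x - f k x)\<^sup>2)"
    and le: "\<And>k. (\<integral>x. (f (Suc k) x - f k x)\<^sup>2 \<partial>N) \<le> C * (1 / 4) ^ k"
  shows "AE x in N. convergent (\<lambda>k. f k x)"
proof -
  interpret prob_space N by fact
  define d where "d k x = \<bar>f (Suc k) x - f k x\<bar>" for k x
  have C0: "0 \<le> C" using order_trans[OF Bochner_Integration.integral_nonneg le[of 0]] by simp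
  have [measurable]: "d k \<in> borel_measurable N" for k unfolding d_def by measurable
  \<comment> \<open>The weight \<open>2 ^ k\<close> balances the two terms: second moments of order
    \<open>(1 / 4) ^ k\<close> give first moments of order \<open>(1 / 2) ^ k\<close>, which are
    summable.\<close>
  have bound: "d k x \<le> (2 ^ k * (f (Suc k) x - f k x)\<^sup>2 + (1 / 2) ^ k) / 2" for k x
  proof -
    have pos_cancel: "0 \<le> b" if "0 < a" "0 \<le> a * b" for a b :: real
      using that by (simp add: zero_le_mult_iff)
    have "0 \<le> (2 ^ k * d k x - 1)\<^sup>2" by simp
    also have "\<dots> = 2 ^ k * (2 ^ k * (d k x)\<^sup>2 + (1 / 2) ^ k - 2 * d k x)"
      by (simp add: power2_eq_square algebra_simps power_divide)
    finally have "0 \<le> 2 ^ k * (d k x)\<^sup>2 + (1 / 2) ^ k - 2 * d k x" 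
      using pos_cancel[of "2 ^ k" "2 ^ k * (d k x)\<^sup>2 + (1 / 2) ^ k - 2 * d k x"] by simp
    then show ?thesis by (simp add: d_def)
  qed
  have dint: "integrable N (d k)" for k
  proof (rule Bochner_Integration.integrable_bound)
    show "integrable N (\<lambda>x. (2 ^ k * (f (Suc k) x - f k x)\<^sup>2 + (1 / 2) ^ k) / 2)" using int by simp
    show "AE x in N. norm (d k x) \<le> norm ((2 ^ k * (f (Suc k) x - f k x)\<^sup>2 + (1 / 2) ^ k) / 2)"
    proof (intro AE_I2)
      fix x show "norm (d k x) \<le> norm ((2 ^ k * (f (Suc k) x - f k x)\<^sup>2 + (1 / 2) ^ k) / 2)"
        using bound[of k x] by (simp add: d_def)
    qed
  qed simp
  have dle: "(\<integral>x. d k x \<partial>N) \<le> (C + 1) / 2 * (1 / 2) ^ k" for k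
  proof -
    have "(\<integral>x. d k x \<partial>N) \<le> (\<integral>x. (2 ^ k * (f (Suc k) x - f k x)\<^sup>2 + (1 / 2) ^ k) / 2 \<partial>N)"
      using int by (intro integral_mono dint bound) simp
    also have "\<dots> = (2 ^ k * (\<integral>x. (f (Suc k) x - f k x)\<^sup>2 \<partial>N) + (1 / 2) ^ k) / 2"
      using int by (simp add: prob_space)
    also have "\<dots> \<le> (2 ^ k * (C * (1 / 4) ^ k) + (1 / 2) ^ k) / 2"
      by (intro divide_right_mono add_right_mono mult_left_mono le) auto
    also have "2 ^ k * (C * (1 / 4) ^ k) = C * (1 / 2 :: real) ^ k"
      by (simp add: power_mult_distrib[symmetric] mult.left_commute[of _ C])
    finally show ?thesis by (simp add: algebra_simps)
  qed
  have "(\<integral>\<^sup>+x. (\<Sum>k. ennreal (d k x)) \<partial>N) = (\<Sum>k. \<integral>\<^sup>+x. ennreal (d k x) \<partial>N)"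
    by (rule nn_integral_suminf) simp
  also have "\<dots> = (\<Sum>k. ennreal (\<integral>x. d k x \<partial>N))"
    by (intro suminf_cong nn_integral_eq_integral dint) (simp add: d_def)
  also have "\<dots> \<le> (\<Sum>k. ennreal ((C + 1) / 2 * (1 / 2) ^ k))"
    by (intro suminf_le ennreal_leI dle) auto
  also have "\<dots> = ennreal (\<Sum>k. (C + 1) / 2 * (1 / 2) ^ k)"
    by (rule suminf_ennreal_eq) (use C0 in \<open>auto intro!: summable_sums summable_mult summable_geometric\<close>)
  also have "\<dots> < \<infinity>" by simp
  finally have "(\<integral>\<^sup>+x. (\<Sum>k. ennreal (d k x)) \<partial>N) \<noteq> \<infinity>" by auto
  then have "AE x in N. (\<Sum>k. ennreal (d k x)) \<noteq> \<infinity>"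
    by (intro nn_integral_noteq_infinite) auto
  then show ?thesis
  proof eventually_elim
    case (elim x)
    have "summable (\<lambda>k. d k x)" by (rule summable_suminf_not_top) (use elim in \<open>auto simp: d_def\<close>)
    then have "summable (\<lambda>k. f (Suc k) x - f k x)" unfolding d_def by (rule summable_rabs_cancel)
    then have "convergent (\<lambda>k. f k x - f 0 x)"
      by (simp add: summable_iff_convergent sum_lessThan_telescope[of "\<lambda>k. f k x"])
    from convergent_add[OF this convergent_const[of "f 0 x"]] show ?case by simp
  qed
qed

lemma integral_le_of_AE_limit:
  fixes f :: "nat \<Rightarrow> 'b \<Rightarrow> real"
  assumes f: "\<And>k. integrable N (f k)" "\<And>k x. 0 \<le> f k x" and g: "g \<in> borel_measurable N" "\<And>x. 0 \<le> g x"
    and lim: "AE x in N. (\<lambda>k. f k x) \<longlonglongrightarrow> g x"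
    and c: "\<And>k. (\<integral>x. f k x \<partial>N) \<le> c k" "c \<longlonglongrightarrow> l"
  shows "integrable N g" "(\<integral>x. g x \<partial>N) \<le> l"
proof -
  have l0: "0 \<le> l"
    by (rule LIMSEQ_le_const[OF c(2)]) (use order_trans[OF Bochner_Integration.integral_nonneg c(1)] f(2) in auto)
  have "(\<integral>\<^sup>+x. ennreal (g x) \<partial>N) = (\<integral>\<^sup>+x. liminf (\<lambda>k. ennreal (f k x)) \<partial>N)"
  proof (rule nn_integral_cong_AE)
    show "AE x in N. ennreal (g x) = liminf (\<lambda>k. ennreal (f k x))" using lim
      by eventually_elim (auto intro!: lim_imp_Liminf[symmetric] tendsto_ennrealI)
  qed
  also have "\<dots> \<le> liminf (\<lambda>k. \<integral>\<^sup>+x. ennreal (f k x) \<partial>N)"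
    by (rule nn_integral_liminf) (use f in auto)
  also have "\<dots> \<le> liminf (\<lambda>k. ennreal (c k))"
    by (intro Liminf_mono always_eventually allI) (simp add: nn_integral_eq_integral f c ennreal_leI)
  also have "\<dots> = ennreal l" by (intro lim_imp_Liminf tendsto_ennrealI c) simp
  finally have le: "(\<integral>\<^sup>+x. ennreal (g x) \<partial>N) \<le> ennreal l" .
  show int: "integrable N g"
    by (rule integrableI_nonneg) (use g le in \<open>auto simp: less_top[symmetric] top_unique intro: le_less_trans\<close>)
  show "(\<integral>x. g x \<partial>N) \<le> l"
    using le l0 int g(2) by (simp add: nn_integral_eq_integral)
qed

section \<open>The loss function: midpoint convexity and a second-order upper bound\<close>

definition loss :: "real \<Rightarrow> real \<Rightarrow> real" where
  "loss m x = exp (- x) + m * (max 0 (- x))\<^sup>2"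

lemma loss_nonneg: "0 \<le> m \<Longrightarrow> 0 \<le> loss m x" by (simp add: loss_def)

lemma loss_mono: "m \<le> m' \<Longrightarrow> loss m x \<le> loss m' x"
  by (auto simp: loss_def intro!: mult_right_mono)

lemma borel_measurable_loss[measurable]: "loss m \<in> borel_measurable borel"
  unfolding loss_def by measurable

lemma isCont_loss: "isCont (loss m) x"
  unfolding loss_def by (intro continuous_intros)

text \<open>Strict convexity enters only through the exact identity
  \<open>(exp (- x) + exp (- y)) / 2 - exp (- (x + y) / 2) = (exp (- x / 2) - exp (- y / 2))\<^sup>2 / 2\<close>.\<close>

lemma loss_midpoint:
  assumes "0 \<le> m"
  shows "loss m ((x + y) / 2) + (exp (- x / 2) - exp (- y / 2))\<^sup>2 / 2 \<le> (loss m x + loss m y) / 2"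
proof -
  have "exp (- ((x + y) / 2)) + (exp (- x / 2) - exp (- y / 2))\<^sup>2 / 2 = (exp (- x) + exp (- y)) / 2"
  proof -
    have "exp (- x) = (exp (- x / 2))\<^sup>2" "exp (- y) = (exp (- y / 2))\<^sup>2"
      "exp (- ((x + y) / 2)) = exp (- x / 2) * exp (- y / 2)"
      by (simp_all add: power2_eq_square mult_exp_exp add_divide_distrib)
    then show ?thesis by (simp add: power2_eq_square field_simps)
  qed
  moreover have "(max 0 (- ((x + y) / 2)))\<^sup>2 \<le> ((max 0 (- x))\<^sup>2 + (max 0 (- y))\<^sup>2) / 2"
  proof -
    define a b where "a = max 0 (- x)" and "b = max 0 (- y)"
    have "(max 0 (- ((x + y) / 2)))\<^sup>2 \<le> ((a + b) / 2)\<^sup>2"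
      by (rule power_mono) (auto simp: a_def b_def max_def field_simps)
    also have "\<dots> \<le> (a\<^sup>2 + b\<^sup>2) / 2"
      using sum_squares_ge_zero[of "a - b" 0] by (simp add: power2_eq_square field_simps)
    finally show ?thesis by (simp add: a_def b_def)
  qed
  from mult_left_mono[OF this assms]
  have "m * (max 0 (- ((x + y) / 2)))\<^sup>2 \<le> (m * (max 0 (- x))\<^sup>2 + m * (max 0 (- y))\<^sup>2) / 2"
    by (simp add: algebra_simps)
  ultimately show ?thesis unfolding loss_def by (simp add: field_simps)
qed

lemma exp_minus_le_quadratic:
  fixes u :: real assumes "\<bar>u\<bar> \<le> 1" shows "exp (- u) \<le> 1 - u + u\<^sup>2"
proof (cases "u \<le> 0")
  case True then show ?thesis using exp_bound[of "- u"] assms by simp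
next
  case False
  have "exp (- u) \<le> 1 / (1 + u)"
    unfolding exp_minus inverse_eq_divide using exp_ge_add_one_self[of u] False
    by (intro divide_left_mono) auto
  also have "\<dots> \<le> 1 - u + u\<^sup>2"
  proof -
    have "(1 - u + u\<^sup>2) * (1 + u) = 1 + u ^ 3" by (simp add: algebra_simps power2_eq_square power3_eq_cube)
    then show ?thesis using False by (simp add: divide_le_eq)
  qed
  finally show ?thesis .
qed

text \<open>A Taylor estimate whose remainder is controlled by \<open>exp (- x)\<close> and
  \<open>m\<close>, thus by the loss up to a constant. After integration it yields first-order
  conditions without differentiating under the integral.\<close>

lemma loss_shift_le:
  assumes "0 \<le> m" "\<bar>v\<bar> \<le> 1"
  shows "loss m (x + v) \<le> loss m x - (exp (- x) + 2 * m * max 0 (- x)) * v + v\<^sup>2 * (exp (- x) + m)"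
proof -
  have "exp (- (x + v)) = exp (- x) * exp (- v)" by (simp add: exp_add[symmetric])
  also have "\<dots> \<le> exp (- x) * (1 - v + v\<^sup>2)"
    by (intro mult_left_mono exp_minus_le_quadratic assms) simp
  finally have 1: "exp (- (x + v)) \<le> exp (- x) * (1 - v + v\<^sup>2)" .
  have "(max 0 (- (x + v)))\<^sup>2 \<le> \<bar>max 0 (- x) - v\<bar>\<^sup>2" by (rule power_mono) auto
  then have "m * (max 0 (- (x + v)))\<^sup>2 \<le> m * (max 0 (- x) - v)\<^sup>2"
    using assms by (intro mult_left_mono) auto
  with 1 show ?thesis unfolding loss_def by (simp add: algebra_simps power2_eq_square)
qed

context market
begin

section \<open>Minimizing the expected loss over the claims\<close>

definition total_loss :: "real \<Rightarrow> ('a \<Rightarrow> real^'d) \<Rightarrow> ('a \<Rightarrow> real^'d) \<Rightarrow> 'a \<Rightarrow> real" where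
  "total_loss m \<theta> X \<omega> = (\<Sum>i\<in>UNIV. loss m (X \<omega> $ i - \<theta> \<omega> $ i))"

definition risk :: "real \<Rightarrow> ('a \<Rightarrow> real^'d) \<Rightarrow> ('a \<Rightarrow> real^'d) \<Rightarrow> real" where
  "risk m \<theta> X = (\<integral>\<omega>. total_loss m \<theta> X \<omega> \<partial>M)"

definition feasible :: "real \<Rightarrow> ('a \<Rightarrow> real^'d) \<Rightarrow> ('a \<Rightarrow> real^'d) set" where
  "feasible m \<theta> = {X \<in> claims. integrable M (total_loss m \<theta> X)}"

text \<open>Twice the convexity defect, at the midpoint, of the exponential part of the
  loss.\<close>

definition sq_gap :: "('a \<Rightarrow> real^'d) \<Rightarrow> ('a \<Rightarrow> real^'d) \<Rightarrow> ('a \<Rightarrow> real^'d) \<Rightarrow> 'a \<Rightarrow> real" where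
  "sq_gap \<theta> X Y \<omega> = (\<Sum>i\<in>UNIV. (exp (- (X \<omega> $ i - \<theta> \<omega> $ i) / 2) - exp (- (Y \<omega> $ i - \<theta> \<omega> $ i) / 2))\<^sup>2)"

lemma total_loss_measurable[measurable]:
  assumes [measurable]: "\<theta> \<in> L0 M" "X \<in> L0 M" shows "total_loss m \<theta> X \<in> borel_measurable M"
  unfolding total_loss_def by measurable

lemma sq_gap_measurable[measurable]:
  assumes [measurable]: "\<theta> \<in> L0 M" "X \<in> L0 M" "Y \<in> L0 M" shows "sq_gap \<theta> X Y \<in> borel_measurable M"
  unfolding sq_gap_def by measurable

lemma total_loss_nonneg: "0 \<le> m \<Longrightarrow> 0 \<le> total_loss m \<theta> X \<omega>"
  by (simp add: total_loss_def sum_nonneg loss_nonneg)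

lemma sq_gap_nonneg: "0 \<le> sq_gap \<theta> X Y \<omega>"
  by (simp add: sq_gap_def sum_nonneg)

lemma risk_nonneg: "0 \<le> m \<Longrightarrow> 0 \<le> risk m \<theta> X"
  by (simp add: risk_def total_loss_nonneg)

text \<open>The midpoint is again a competitor, so two claims of nearly minimal risk can only have a
  small gap. Integrability of the midpoint loss and of the gap follows from the pointwise
  inequality, all terms being nonnegative.\<close>

lemma risk_midpoint:
  assumes \<theta>: "\<theta> \<in> L0 M" and m: "0 \<le> m" and X: "X \<in> feasible m \<theta>" and Y: "Y \<in> feasible m \<theta>"
  defines "Z \<equiv> \<lambda>\<omega>. (1 / 2) *\<^sub>R (X \<omega> + Y \<omega>)"
  shows "Z \<in> feasible m \<theta>" "integrable M (sq_gap \<theta> X Y)"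
    "risk m \<theta> Z + (\<integral>\<omega>. sq_gap \<theta> X Y \<omega> \<partial>M) / 2 \<le> (risk m \<theta> X + risk m \<theta> Y) / 2"
proof -
  have cl: "X \<in> claims" "Y \<in> claims" and int: "integrable M (total_loss m \<theta> X)" "integrable M (total_loss m \<theta> Y)"
    using X Y by (auto simp: feasible_def)
  have Zcl: "Z \<in> claims" unfolding Z_def by (intro claims_scaleR claims_add cl) simp
  note [measurable] = \<theta> claims_measurable[OF cl(1)] claims_measurable[OF cl(2)] claims_measurable[OF Zcl]
  have le: "total_loss m \<theta> Z \<omega> + sq_gap \<theta> X Y \<omega> / 2 \<le> (total_loss m \<theta> X \<omega> + total_loss m \<theta> Y \<omega>) / 2" for \<omega>
  proof -
    have "loss m (Z \<omega> $ i - \<theta> \<omega> $ i) + (exp (- (X \<omega> $ i - \<theta> \<omega> $ i) / 2) - exp (- (Y \<omega> $ i - \<theta> \<omega> $ i) / 2))\<^sup>2 / 2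
       \<le> (loss m (X \<omega> $ i - \<theta> \<omega> $ i) + loss m (Y \<omega> $ i - \<theta> \<omega> $ i)) / 2" for i
    proof -
      have eq: "Z \<omega> $ i - \<theta> \<omega> $ i = ((X \<omega> $ i - \<theta> \<omega> $ i) + (Y \<omega> $ i - \<theta> \<omega> $ i)) / 2" by (simp add: Z_def field_simps)
      show ?thesis unfolding eq by (rule loss_midpoint[OF m])
    qed
    then have "(\<Sum>i\<in>UNIV. loss m (Z \<omega> $ i - \<theta> \<omega> $ i) + (exp (- (X \<omega> $ i - \<theta> \<omega> $ i) / 2) - exp (- (Y \<omega> $ i - \<theta> \<omega> $ i) / 2))\<^sup>2 / 2)
       \<le> (\<Sum>i\<in>UNIV. (loss m (X \<omega> $ i - \<theta> \<omega> $ i) + loss m (Y \<omega> $ i - \<theta> \<omega> $ i)) / 2)" by (intro sum_mono)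
    then show ?thesis
      by (simp add: total_loss_def sq_gap_def sum.distrib sum_divide_distrib[symmetric])
  qed
  have avg: "integrable M (\<lambda>\<omega>. (total_loss m \<theta> X \<omega> + total_loss m \<theta> Y \<omega>) / 2)" using int by simp
  have bnd: "norm (total_loss m \<theta> Z \<omega>) \<le> norm ((total_loss m \<theta> X \<omega> + total_loss m \<theta> Y \<omega>) / 2)"
    "norm (sq_gap \<theta> X Y \<omega>) \<le> norm (total_loss m \<theta> X \<omega> + total_loss m \<theta> Y \<omega>)" for \<omega>
    using le[of \<omega>] total_loss_nonneg[OF m, of \<theta> Z \<omega>] total_loss_nonneg[OF m, of \<theta> X \<omega>]
      total_loss_nonneg[OF m, of \<theta> Y \<omega>] sq_gap_nonneg[of \<theta> X Y \<omega>] by auto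
  have Zint: "integrable M (total_loss m \<theta> Z)"
    by (rule Bochner_Integration.integrable_bound[OF avg]) (use bnd in auto)
  show "Z \<in> feasible m \<theta>" using Zcl Zint by (simp add: feasible_def)
  have "integrable M (\<lambda>\<omega>. total_loss m \<theta> X \<omega> + total_loss m \<theta> Y \<omega>)" using int by simp
  then show gint: "integrable M (sq_gap \<theta> X Y)"
    by (rule Bochner_Integration.integrable_bound) (use bnd in auto)
  have "(\<integral>\<omega>. total_loss m \<theta> Z \<omega> + sq_gap \<theta> X Y \<omega> / 2 \<partial>M) \<le> (\<integral>\<omega>. (total_loss m \<theta> X \<omega> + total_loss m \<theta> Y \<omega>) / 2 \<partial>M)"
    by (intro integral_mono avg le) (use Zint gint in simp)
  then show "risk m \<theta> Z + (\<integral>\<omega>. sq_gap \<theta> X Y \<omega> \<partial>M) / 2 \<le> (risk m \<theta> X + risk m \<theta> Y) / 2"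
    using Zint gint int by (simp add: risk_def)
qed

text \<open>A limit value \<open>+\<infinity>\<close> on a set \<open>S\<close> in some coordinate is excluded by absence of arbitrage: the
  truncations at 1 of \<open>X k / m\<close> converge, first in \<open>k\<close> and then in \<open>m\<close>, to the indicator of \<open>S\<close>.\<close>

lemma claims_limit_of_exp:
  assumes \<theta>: "\<theta> \<in> L0 M" and X: "\<And>k. X k \<in> claims"
    and conv: "\<And>i. AE \<omega> in M. convergent (\<lambda>k. exp (- (X k \<omega> $ i - \<theta> \<omega> $ i) / 2))"
  shows "\<exists>X'\<in>claims. AE \<omega> in M. (\<lambda>k. X k \<omega>) \<longlonglongrightarrow> X' \<omega>"
proof -
  note [measurable] = \<theta> claims_measurable[OF X]
  define L where "L i \<omega> = lim (\<lambda>k. exp (- (X k \<omega> $ i - \<theta> \<omega> $ i) / 2))" for i \<omega>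
  have [measurable]: "L i \<in> borel_measurable M" for i
    unfolding L_def by (rule borel_measurable_lim_metric) measurable
  have L: "AE \<omega> in M. \<forall>i. (\<lambda>k. exp (- (X k \<omega> $ i - \<theta> \<omega> $ i) / 2)) \<longlonglongrightarrow> L i \<omega>"
  proof -
    have "AE \<omega> in M. \<forall>i\<in>UNIV. convergent (\<lambda>k. exp (- (X k \<omega> $ i - \<theta> \<omega> $ i) / 2))"
      using conv by (intro AE_finite_allI) auto
    then show ?thesis by eventually_elim (auto simp: L_def convergent_LIMSEQ_iff)
  qed
  \<comment> \<open>Where \<open>L i \<omega> = 0\<close> the value of \<open>ln\<close> is
    meaningless and harmless: \<open>V\<close> and \<open>I\<close> treat that case separately, and
    it turns out to be null.\<close>
  define x where "x i \<omega> = \<theta> \<omega> $ i - 2 * ln (L i \<omega>)" for i \<omega>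
  have [measurable]: "x i \<in> borel_measurable M" for i unfolding x_def by measurable
  have L0: "0 \<le> L i \<omega>" if "(\<lambda>k. exp (- (X k \<omega> $ i - \<theta> \<omega> $ i) / 2)) \<longlonglongrightarrow> L i \<omega>" for i \<omega>
    by (rule LIMSEQ_le_const[OF that]) auto
  have fin: "(\<lambda>k. X k \<omega> $ i) \<longlonglongrightarrow> x i \<omega>"
    if lim: "(\<lambda>k. exp (- (X k \<omega> $ i - \<theta> \<omega> $ i) / 2)) \<longlonglongrightarrow> L i \<omega>" and "L i \<omega> \<noteq> 0" for i \<omega>
  proof -
    have "L i \<omega> > 0" using L0[OF lim] that(2) by simp
    have "(\<lambda>k. \<theta> \<omega> $ i - 2 * ln (exp (- (X k \<omega> $ i - \<theta> \<omega> $ i) / 2))) \<longlonglongrightarrow> x i \<omega>"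
      unfolding x_def by (intro tendsto_intros lim that(2))
    then show ?thesis by (simp add: field_simps)
  qed
  have inf: "filterlim (\<lambda>k. X k \<omega> $ i) at_top sequentially"
    if lim: "(\<lambda>k. exp (- (X k \<omega> $ i - \<theta> \<omega> $ i) / 2)) \<longlonglongrightarrow> L i \<omega>" and L0: "L i \<omega> = 0" for i \<omega>
    unfolding filterlim_at_top
  proof
    fix c
    have "\<forall>\<^sub>F k in sequentially. exp (- (X k \<omega> $ i - \<theta> \<omega> $ i) / 2) < exp (- (c - \<theta> \<omega> $ i) / 2)"
      using lim L0 by (intro order_tendstoD(2)) auto
    then show "\<forall>\<^sub>F k in sequentially. c \<le> X k \<omega> $ i" by eventually_elim simp
  qed
  define V where "V m \<omega> = (\<chi> i. if L i \<omega> = 0 then 1 else min ((1 / real (Suc m)) * x i \<omega>) 1)" for m \<omega>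
  have V: "V m \<in> claims" for m
  proof (rule claims_closed)
    have "(\<lambda>\<omega>. \<chi> i. min (((1 / real (Suc m)) *\<^sub>R X k \<omega>) $ i) 1) \<in> claims" for k
      by (intro claims_truncate claims_scaleR X) simp
    then show "(\<lambda>\<omega>. \<chi> i. min ((1 / real (Suc m)) * X k \<omega> $ i) 1) \<in> claims" for k by simp
    show "AE \<omega> in M. (\<lambda>k. \<chi> i. min ((1 / real (Suc m)) * X k \<omega> $ i) 1) \<longlonglongrightarrow> V m \<omega>" using L
    proof eventually_elim
      case (elim \<omega>)
      show ?case
      proof (rule vec_tendstoI)
        fix i
        show "(\<lambda>k. (\<chi> i. min ((1 / real (Suc m)) * X k \<omega> $ i) 1) $ i) \<longlonglongrightarrow> V m \<omega> $ i"
        proof (cases "L i \<omega> = 0")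
          case False
          have "(\<lambda>k. min ((1 / real (Suc m)) * X k \<omega> $ i) 1) \<longlonglongrightarrow> min ((1 / real (Suc m)) * x i \<omega>) 1"
            by (intro tendsto_intros fin False spec[OF elim])
          then show ?thesis using False by (simp add: V_def)
        next
          case True
          have "\<forall>\<^sub>F k in sequentially. real (Suc m) \<le> X k \<omega> $ i"
            using inf[OF spec[OF elim] True] unfolding filterlim_at_top by blast
          then have "\<forall>\<^sub>F k in sequentially. min ((1 / real (Suc m)) * X k \<omega> $ i) 1 = 1"
            by eventually_elim (simp add: min_def field_simps)
          then show ?thesis using True by (simp add: V_def tendsto_eventually)
        qed
      qed
    qed
    show "V m \<in> L0 M" unfolding V_def by measurable
  qed
  define I where "I \<omega> = (\<chi> i. if L i \<omega> = 0 then 1 else (0::real))" for \<omega>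
  have "I \<in> claims"
  proof (rule claims_closed[OF V])
    show "AE \<omega> in M. (\<lambda>m. V m \<omega>) \<longlonglongrightarrow> I \<omega>"
    proof (intro AE_I2 vec_tendstoI)
      fix \<omega> i
      have "(\<lambda>m. min (x i \<omega> / real (Suc m)) 1) \<longlonglongrightarrow> min 0 1"
        by (intro tendsto_min LIMSEQ_Suc[OF lim_const_over_n] tendsto_const)
      then show "(\<lambda>m. V m \<omega> $ i) \<longlonglongrightarrow> I \<omega> $ i" by (simp add: V_def I_def)
    qed
    show "I \<in> L0 M" unfolding I_def by measurable
  qed
  then have "AE \<omega> in M. I \<omega> = 0"
    by (rule arbitrage_free) (simp add: I_def less_eq_vec_def)
  then have Lne: "AE \<omega> in M. \<forall>i. L i \<omega> \<noteq> 0"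
    by eventually_elim (auto simp: I_def vec_eq_iff split: if_splits)
  have lim: "AE \<omega> in M. (\<lambda>k. X k \<omega>) \<longlonglongrightarrow> (\<chi> i. x i \<omega>)" using L Lne
  proof eventually_elim
    case (elim \<omega>)
    show ?case by (rule vec_tendstoI) (use fin elim in simp)
  qed
  have "(\<lambda>\<omega>. \<chi> i. x i \<omega>) \<in> claims"
    by (rule claims_closed[OF X lim]) measurable
  with lim show ?thesis by (intro bexI[of _ "\<lambda>\<omega>. \<chi> i. x i \<omega>"])
qed

lemma claims_limit_of_small_gaps:
  assumes \<theta>: "\<theta> \<in> L0 M" and X: "\<And>k. X k \<in> claims"
    and int: "\<And>k. integrable M (sq_gap \<theta> (X k) (X (Suc k)))"
    and le: "\<And>k. (\<integral>\<omega>. sq_gap \<theta> (X k) (X (Suc k)) \<omega> \<partial>M) \<le> C * (1 / 4) ^ k"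
  shows "\<exists>X'\<in>claims. AE \<omega> in M. (\<lambda>k. X k \<omega>) \<longlonglongrightarrow> X' \<omega>"
proof (rule claims_limit_of_exp[OF \<theta> X])
  fix i
  note [measurable] = \<theta> claims_measurable[OF X]
  define f where "f k \<omega> = exp (- (X k \<omega> $ i - \<theta> \<omega> $ i) / 2)" for k \<omega>
  have [measurable]: "f k \<in> borel_measurable M" for k unfolding f_def by measurable
  have sq: "(f (Suc k) \<omega> - f k \<omega>)\<^sup>2 \<le> sq_gap \<theta> (X k) (X (Suc k)) \<omega>" for k \<omega>
  proof -
    have "(f k \<omega> - f (Suc k) \<omega>)\<^sup>2 \<le> sq_gap \<theta> (X k) (X (Suc k)) \<omega>"
      unfolding sq_gap_def f_def by (rule member_le_sum) auto
    then show ?thesis by (simp add: power2_commute)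
  qed
  have i: "integrable M (\<lambda>\<omega>. (f (Suc k) \<omega> - f k \<omega>)\<^sup>2)" for k
    by (rule Bochner_Integration.integrable_bound[OF int[of k]]) (use sq sq_gap_nonneg in auto)
  have "AE \<omega> in M. convergent (\<lambda>k. f k \<omega>)"
  proof (rule AE_convergent_if_L2_increments_summable[where f = f, OF prob_space_axioms _ i])
    show "(\<integral>\<omega>. (f (Suc k) \<omega> - f k \<omega>)\<^sup>2 \<partial>M) \<le> C * (1 / 4) ^ k" for k
      using order_trans[OF integral_mono[OF i int sq] le] .
  qed simp
  then show "AE \<omega> in M. convergent (\<lambda>k. exp (- (X k \<omega> $ i - \<theta> \<omega> $ i) / 2))" by (simp add: f_def)
qed

lemma risk_minimizer_exists:
  assumes \<theta>: "\<theta> \<in> claims" and m: "0 \<le> m"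
  shows "\<exists>X\<in>feasible m \<theta>. \<forall>Y\<in>feasible m \<theta>. risk m \<theta> X \<le> risk m \<theta> Y"
proof -
  have [measurable]: "\<theta> \<in> L0 M" by (rule claims_measurable[OF \<theta>])
  have \<theta>f: "\<theta> \<in> feasible m \<theta>" using \<theta> by (simp add: feasible_def total_loss_def[abs_def])
  define j where "j = Inf (risk m \<theta> ` feasible m \<theta>)"
  have bdd: "bdd_below (risk m \<theta> ` feasible m \<theta>)" by (rule bdd_belowI[of _ 0]) (use risk_nonneg[OF m] in auto)
  have j: "j \<le> risk m \<theta> Y" if "Y \<in> feasible m \<theta>" for Y
    unfolding j_def by (rule cInf_lower[OF _ bdd]) (use that in auto)
  have "\<exists>X. X \<in> feasible m \<theta> \<and> risk m \<theta> X < j + (1 / 4) ^ k" for k :: nat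
  proof -
    have "Inf (risk m \<theta> ` feasible m \<theta>) < j + (1 / 4) ^ k" by (simp add: j_def)
    from cInf_lessD[OF _ this] show ?thesis using \<theta>f by auto
  qed
  then obtain X where X: "\<And>k. X k \<in> feasible m \<theta>" "\<And>k::nat. risk m \<theta> (X k) < j + (1 / 4) ^ k" by metis
  have cl: "X k \<in> claims" for k using X(1)[of k] by (simp add: feasible_def)
  note mid = risk_midpoint[OF claims_measurable[OF \<theta>] m X(1) X(1)]
  have "(\<integral>\<omega>. sq_gap \<theta> (X k) (X (Suc k)) \<omega> \<partial>M) \<le> 2 * (1 / 4) ^ k" for k
  proof -
    \<comment> \<open>\<open>r\<close> is the risk of the midpoint, at least the infimum
      \<open>j\<close>; both ends exceed \<open>j\<close> by less than \<open>p\<close>.\<close>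
    have arith: "e \<le> 2 * p" if "r + e / 2 \<le> (a + b) / 2" "j \<le> r" "a < j + p" "b < j + q" "q \<le> p"
      for e r a b p q :: real
    proof -
      have "e \<le> (a + b) - 2 * r" using that(1) by (simp add: field_simps)
      then show ?thesis using that(2-5) by linarith
    qed
    show ?thesis by (rule arith[OF mid(3) j[OF mid(1)] X(2) X(2)]) simp
  qed
  from claims_limit_of_small_gaps[OF claims_measurable[OF \<theta>] cl mid(2) this]
  obtain X' where X': "X' \<in> claims" and lim: "AE \<omega> in M. (\<lambda>k. X k \<omega>) \<longlonglongrightarrow> X' \<omega>" by blast
  note [measurable] = claims_measurable[OF X']
  have liml: "AE \<omega> in M. (\<lambda>k. total_loss m \<theta> (X k) \<omega>) \<longlonglongrightarrow> total_loss m \<theta> X' \<omega>" using lim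
    by eventually_elim (unfold total_loss_def, intro tendsto_sum isCont_tendsto_compose[OF isCont_loss] tendsto_intros)
  have "(\<lambda>k. j + (1 / 4) ^ k) \<longlonglongrightarrow> j + 0" by (intro tendsto_intros LIMSEQ_power_zero) simp
  then have jl: "(\<lambda>k. j + (1 / 4) ^ k) \<longlonglongrightarrow> j" by simp
  have i: "integrable M (total_loss m \<theta> (X k))" for k using X(1)[of k] by (simp add: feasible_def)
  \<comment> \<open>No dominating function is at hand; for a minimizer the inequality from Fatou
    suffices.\<close>
  note fatou = integral_le_of_AE_limit[OF i total_loss_nonneg[OF m] _ total_loss_nonneg[OF m] liml _ jl]
  have "integrable M (total_loss m \<theta> X')"
    by (rule fatou(1)) (use X(2) in \<open>auto simp: risk_def less_imp_le\<close>)
  moreover have "risk m \<theta> X' \<le> j" unfolding risk_def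
    by (rule fatou(2)) (use X(2) in \<open>auto simp: risk_def less_imp_le\<close>)
  ultimately show ?thesis using X' j by (intro bexI[of _ X']) (auto simp: feasible_def intro: order_trans)
qed

end


section \<open>Convergence and first-order conditions\<close>

text \<open>The rate is the one that \<open>claims_limit_of_small_gaps\<close> asks for.\<close>

lemma fast_subsequence:
  fixes j :: "nat \<Rightarrow> real"
  assumes "convergent j"
  shows "\<exists>r. strict_mono r \<and> (\<forall>k. \<bar>j (r (Suc k)) - j (r k)\<bar> \<le> (1 / 4) ^ k)"
proof -
  have "\<exists>N. \<forall>p\<ge>N. \<forall>q\<ge>N. \<bar>j p - j q\<bar> < (1 / 4) ^ k" for k :: nat
    using CauchyD[OF convergent_Cauchy[OF assms], of "(1 / 4) ^ k"] by simp
  then obtain N where N: "\<And>k p q. N k \<le> p \<Longrightarrow> N k \<le> q \<Longrightarrow> \<bar>j p - j q\<bar> < (1 / 4) ^ k" by metis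
  have "\<exists>r. \<forall>k. N k \<le> r k \<and> r k < r (Suc k)"
  proof (rule dependent_nat_choice)
    show "\<exists>x. N 0 \<le> x" by blast
    show "\<exists>y. N (Suc k) \<le> y \<and> x < y" for x k
      by (rule exI[of _ "max (N (Suc k)) (Suc x)"]) simp
  qed
  then obtain r where r: "\<And>k. N k \<le> r k" "\<And>k. r k < r (Suc k)" by blast
  have "\<bar>j (r (Suc k)) - j (r k)\<bar> \<le> (1 / 4) ^ k" for k
    using N[of k "r (Suc k)" "r k"] r(1)[of k] r(2)[of k] by simp
  then show ?thesis using r(2) by (auto simp: strict_mono_Suc_iff)
qed

lemma integrable_vec_lambda:
  fixes f :: "'d::finite \<Rightarrow> 'b \<Rightarrow> real"
  assumes "\<And>i. integrable N (f i)" shows "integrable N (\<lambda>\<omega>. \<chi> i. f i \<omega>)"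
proof -
  have "(\<lambda>\<omega>. \<chi> i. f i \<omega>) = (\<lambda>\<omega>. \<Sum>i\<in>UNIV. f i \<omega> *\<^sub>R axis i 1)"
    by (auto simp: vec_eq_iff axis_def if_distrib cong: if_cong)
  then show ?thesis using assms by simp
qed

lemma integrable_bounded_inner:
  fixes h Z :: "'b \<Rightarrow> 'e::euclidean_space"
  assumes [measurable]: "h \<in> borel_measurable N" and h: "\<And>x. norm (h x) \<le> B" and Z: "integrable N Z"
  shows "integrable N (\<lambda>x. h x \<bullet> Z x)"
proof (rule Bochner_Integration.integrable_bound)
  show "integrable N (\<lambda>x. B * norm (Z x))" using Z by simp
  have [measurable]: "Z \<in> borel_measurable N" using Z by simp
  show "(\<lambda>x. h x \<bullet> Z x) \<in> borel_measurable N" by measurable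
  show "AE x in N. norm (h x \<bullet> Z x) \<le> norm (B * norm (Z x))"
  proof (intro AE_I2)
    fix x
    have "0 \<le> B" using order_trans[OF norm_ge_zero h] .
    then show "norm (h x \<bullet> Z x) \<le> norm (B * norm (Z x))"
      using order_trans[OF Cauchy_Schwarz_ineq2[of "h x" "Z x"] mult_right_mono[OF h[of x]]] by simp
  qed
qed

context market
begin

definition minimizer :: "real \<Rightarrow> ('a \<Rightarrow> real^'d) \<Rightarrow> ('a \<Rightarrow> real^'d) \<Rightarrow> bool" where
  "minimizer m \<theta> X \<longleftrightarrow> X \<in> feasible m \<theta> \<and> (\<forall>Y\<in>feasible m \<theta>. risk m \<theta> X \<le> risk m \<theta> Y)"

lemma feasible_antimono:
  assumes \<theta>: "\<theta> \<in> L0 M" and m: "0 \<le> m" "m \<le> m'" and X: "X \<in> feasible m' \<theta>"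
  shows "X \<in> feasible m \<theta>" "risk m \<theta> X \<le> risk m' \<theta> X"
proof -
  have cl: "X \<in> claims" and int: "integrable M (total_loss m' \<theta> X)" using X by (auto simp: feasible_def)
  note [measurable] = \<theta> claims_measurable[OF cl]
  have le: "total_loss m \<theta> X \<omega> \<le> total_loss m' \<theta> X \<omega>" for \<omega>
    unfolding total_loss_def by (intro sum_mono loss_mono m)
  have i: "integrable M (total_loss m \<theta> X)"
    by (rule Bochner_Integration.integrable_bound[OF int]) (use le total_loss_nonneg m in \<open>auto intro!: AE_I2 simp: abs_of_nonneg\<close>)
  then show "X \<in> feasible m \<theta>" using cl by (simp add: feasible_def)
  show "risk m \<theta> X \<le> risk m' \<theta> X" unfolding risk_def by (rule integral_mono[OF i int le])
qed

text \<open>The minimal risks increase with the penalty \<open>m\<close> and are bounded, and the midpoint inequality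
  turns the convergence of the minimal risks into convergence of the minimizers.\<close>

lemma minimizers_converge:
  assumes max: "maximal M claims \<theta>"
  shows "\<exists>X. (\<forall>k::nat. \<exists>m\<ge>0. minimizer m \<theta> (X k)) \<and> (AE \<omega> in M. (\<lambda>k. X k \<omega>) \<longlonglongrightarrow> \<theta> \<omega>)"
proof -
  have \<theta>: "\<theta> \<in> claims" using max by (simp add: maximal_def)
  have \<theta>m[measurable]: "\<theta> \<in> L0 M" by (rule claims_measurable[OF \<theta>])
  have "\<exists>X. minimizer (real m) \<theta> X" for m :: nat
    using risk_minimizer_exists[OF \<theta>, of "real m"] by (auto simp: minimizer_def)
  then obtain Y where Y: "\<And>m::nat. minimizer (real m) \<theta> (Y m)" by metis
  have Yf: "Y m \<in> feasible (real m) \<theta>" for m using Y[of m] by (simp add: minimizer_def)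
  have Ymin: "risk (real m) \<theta> (Y m) \<le> risk (real m) \<theta> X" if "X \<in> feasible (real m) \<theta>" for m X
    using Y[of m] that by (simp add: minimizer_def)
  have Ycl: "Y m \<in> claims" for m using Yf[of m] by (simp add: feasible_def)
  define j where "j m = risk (real m) \<theta> (Y m)" for m
  have gap: "integrable M (sq_gap \<theta> (Y p) (Y q))" "(\<integral>\<omega>. sq_gap \<theta> (Y p) (Y q) \<omega> \<partial>M) \<le> j q - j p"
    if "p \<le> q" for p q
  proof -
    \<comment> \<open>Compared at the smaller penalty \<open>p\<close>, the claim \<open>Y q\<close>
      has risk at most \<open>j q\<close>, while the midpoint of \<open>Y p\<close> and
      \<open>Y q\<close> has risk at least \<open>j p\<close>.\<close>
    have q: "Y q \<in> feasible (real p) \<theta>" "risk (real p) \<theta> (Y q) \<le> j q"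
      using feasible_antimono[OF \<theta>m _ _ Yf[of q], of "real p"] that by (auto simp: j_def)
    note mid = risk_midpoint[OF \<theta>m _ Yf[of p] q(1)]
    show "integrable M (sq_gap \<theta> (Y p) (Y q))" by (rule mid(2)) simp
    have arith: "e \<le> b' - a" if "z + e / 2 \<le> (a + b) / 2" "a \<le> z" "b \<le> b'" for e z a b b' :: real
      using that by (simp add: field_simps)
    show "(\<integral>\<omega>. sq_gap \<theta> (Y p) (Y q) \<omega> \<partial>M) \<le> j q - j p"
      unfolding j_def[of p] by (rule arith[OF mid(3) Ymin[OF mid(1)] q(2)]) simp_all
  qed
  have "incseq j" unfolding incseq_def
  proof (intro allI impI)
    fix p q :: nat assume "p \<le> q"
    have "0 \<le> (\<integral>\<omega>. sq_gap \<theta> (Y p) (Y q) \<omega> \<partial>M)"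
      by (intro Bochner_Integration.integral_nonneg sq_gap_nonneg)
    from order_trans[OF this gap(2)[OF \<open>p \<le> q\<close>]] show "j p \<le> j q" by simp
  qed
  \<comment> \<open>The claim \<open>\<theta>\<close> itself competes at every penalty, with loss 1
    in each coordinate.\<close>
  moreover have jd: "j m \<le> real CARD('d)" for m
  proof -
    have tl: "total_loss (real m) \<theta> \<theta> = (\<lambda>\<omega>. real CARD('d))" by (simp add: total_loss_def[abs_def] loss_def)
    then have "\<theta> \<in> feasible (real m) \<theta>" using \<theta> by (simp add: feasible_def)
    from Ymin[OF this] show ?thesis by (simp add: j_def risk_def tl prob_space)
  qed
  ultimately have "convergent j"
    by (meson convergentI incseq_convergent)
  then obtain r where r: "strict_mono r" "\<And>k. \<bar>j (r (Suc k)) - j (r k)\<bar> \<le> (1 / 4) ^ k"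
    using fast_subsequence by blast
  have rle: "r k \<le> r (Suc k)" for k using r(1) by (simp add: strict_mono_Suc_iff less_imp_le)
  have gapr: "(\<integral>\<omega>. sq_gap \<theta> (Y (r k)) (Y (r (Suc k))) \<omega> \<partial>M) \<le> 1 * (1 / 4) ^ k" for k
    using gap(2)[OF rle[of k]] r(2)[of k] by linarith
  obtain W where W: "W \<in> claims" and lim: "AE \<omega> in M. (\<lambda>k. Y (r k) \<omega>) \<longlonglongrightarrow> W \<omega>"
    using claims_limit_of_small_gaps[of \<theta> "\<lambda>k. Y (r k)" 1, OF \<theta>m Ycl gap(1)[OF rle] gapr] by blast
  note [measurable] = claims_measurable[OF W] claims_measurable[OF Ycl]
  define neg where "neg X \<omega> = (\<Sum>i\<in>UNIV. (max 0 (- (X \<omega> $ i - \<theta> \<omega> $ i)))\<^sup>2)" for X :: "'a \<Rightarrow> real^'d" and \<omega>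
  have neg_m: "neg X \<in> borel_measurable M" if [measurable]: "X \<in> L0 M" for X unfolding neg_def by measurable
  have neg0: "0 \<le> neg X \<omega>" for X \<omega> by (simp add: neg_def sum_nonneg)
  have negle: "real m * neg X \<omega> \<le> total_loss (real m) \<theta> X \<omega>" for m X \<omega>
    unfolding neg_def total_loss_def sum_distrib_left loss_def by (intro sum_mono) simp
  \<comment> \<open>The shift gives \<open>s k \<ge> Suc k\<close>, so the penalty is positive even
    at \<open>k = 0\<close>.\<close>
  define s where "s k = r (Suc k)" for k
  have s: "Suc k \<le> s k" for k using seq_suble[OF r(1)] by (simp add: s_def)
  have tli: "integrable M (total_loss (real m) \<theta> (Y m))" for m using Yf[of m] by (simp add: feasible_def)
  have negi: "integrable M (neg (Y (s k)))" for k
  proof (rule Bochner_Integration.integrable_bound[OF tli[of "s k"]])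
    show "AE \<omega> in M. norm (neg (Y (s k)) \<omega>) \<le> norm (total_loss (real (s k)) \<theta> (Y (s k)) \<omega>)"
    proof (intro AE_I2)
      fix \<omega>
      have "neg (Y (s k)) \<omega> \<le> real (s k) * neg (Y (s k)) \<omega>"
        using mult_right_mono[of 1 "real (s k)" "neg (Y (s k)) \<omega>"] s[of k] neg0 by simp
      with negle[of "s k" "Y (s k)" \<omega>] neg0[of "Y (s k)" \<omega>]
      show "norm (neg (Y (s k)) \<omega>) \<le> norm (total_loss (real (s k)) \<theta> (Y (s k)) \<omega>)" by simp
    qed
  qed (simp add: neg_m claims_measurable[OF Ycl])
  \<comment> \<open>The risks stay below \<open>real CARD('d)\<close> although squared shortfall is
    charged at rate \<open>s k\<close>; hence the expected squared shortfall tends to zero.\<close>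
  have negint: "(\<integral>\<omega>. neg (Y (s k)) \<omega> \<partial>M) \<le> real CARD('d) / real (Suc k)" for k
  proof -
    have "real (Suc k) * (\<integral>\<omega>. neg (Y (s k)) \<omega> \<partial>M) \<le> real (s k) * (\<integral>\<omega>. neg (Y (s k)) \<omega> \<partial>M)"
      using s[of k] by (intro mult_right_mono Bochner_Integration.integral_nonneg neg0) linarith
    also have "\<dots> = (\<integral>\<omega>. real (s k) * neg (Y (s k)) \<omega> \<partial>M)" by simp
    also have "\<dots> \<le> j (s k)" unfolding j_def risk_def
      by (intro integral_mono tli negle integrable_mult_right negi)
    also have "\<dots> \<le> real CARD('d)" by (rule jd)
    finally show ?thesis by (simp add: field_simps)
  qed
  have lims: "AE \<omega> in M. (\<lambda>k. Y (s k) \<omega>) \<longlonglongrightarrow> W \<omega>"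
    using lim unfolding s_def by eventually_elim (rule LIMSEQ_Suc)
  have limneg: "AE \<omega> in M. (\<lambda>k. neg (Y (s k)) \<omega>) \<longlonglongrightarrow> neg W \<omega>" using lims
    unfolding neg_def by eventually_elim (intro tendsto_intros)
  note fatou = integral_le_of_AE_limit[OF negi neg0 neg_m[OF claims_measurable[OF W]] neg0 limneg negint
      LIMSEQ_Suc[OF lim_const_over_n]]
  have "(\<integral>\<omega>. neg W \<omega> \<partial>M) = 0"
    using fatou(2) Bochner_Integration.integral_nonneg[of M "neg W"] neg0 by (simp add: order_antisym)
  then have "AE \<omega> in M. neg W \<omega> = 0"
    using integral_nonneg_eq_0_iff_AE[OF fatou(1)] neg0 by simp
  then have "AE \<omega> in M. \<theta> \<omega> \<le> W \<omega>"
  proof eventually_elim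
    case (elim \<omega>)
    then have "\<forall>i. (max 0 (- (W \<omega> $ i - \<theta> \<omega> $ i)))\<^sup>2 = 0"
      unfolding neg_def by (subst (asm) sum_nonneg_eq_0_iff) auto
    then have "max 0 (- (W \<omega> $ i - \<theta> \<omega> $ i)) = 0" for i by simp
    then have "- (W \<omega> $ i - \<theta> \<omega> $ i) \<le> 0" for i by (metis max.cobounded2)
    then show ?case by (simp add: less_eq_vec_def)
  qed
  with max W have "AE \<omega> in M. W \<omega> = \<theta> \<omega>" unfolding maximal_def by blast
  with lim have "AE \<omega> in M. (\<lambda>k. Y (r k) \<omega>) \<longlonglongrightarrow> \<theta> \<omega>" by eventually_elim simp
  moreover have "\<exists>m\<ge>0. minimizer m \<theta> (Y (r k))" for k using Y[of "r k"] by (intro exI[of _ "real (r k)"]) simp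
  ultimately show ?thesis by (intro exI[of _ "\<lambda>k. Y (r k)"]) simp
qed

section \<open>First-order conditions and supporting price processes\<close>

text \<open>Minus the gradient of the total loss with respect to the claim.\<close>

definition marginal_loss :: "real \<Rightarrow> ('a \<Rightarrow> real^'d) \<Rightarrow> ('a \<Rightarrow> real^'d) \<Rightarrow> 'a \<Rightarrow> real^'d" where
  "marginal_loss m \<theta> X \<omega> =
     (\<chi> i. exp (- (X \<omega> $ i - \<theta> \<omega> $ i)) + 2 * m * max 0 (- (X \<omega> $ i - \<theta> \<omega> $ i)))"

lemma marginal_loss_integrable:
  assumes \<theta>: "\<theta> \<in> L0 M" and m: "0 \<le> m" and X: "X \<in> feasible m \<theta>"
  shows "integrable M (marginal_loss m \<theta> X)"
  unfolding marginal_loss_def[abs_def]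
proof (rule integrable_vec_lambda)
  fix i
  have cl: "X \<in> claims" and int: "integrable M (total_loss m \<theta> X)" using X by (auto simp: feasible_def)
  note [measurable] = \<theta> claims_measurable[OF cl]
  show "integrable M (\<lambda>\<omega>. exp (- (X \<omega> $ i - \<theta> \<omega> $ i)) + 2 * m * max 0 (- (X \<omega> $ i - \<theta> \<omega> $ i)))"
  proof (rule Bochner_Integration.integrable_bound)
    show "integrable M (\<lambda>\<omega>. (1 + 2 * m) * total_loss m \<theta> X \<omega>)" using int by simp
    show "AE \<omega> in M. norm (exp (- (X \<omega> $ i - \<theta> \<omega> $ i)) + 2 * m * max 0 (- (X \<omega> $ i - \<theta> \<omega> $ i)))
      \<le> norm ((1 + 2 * m) * total_loss m \<theta> X \<omega>)"
    proof (intro AE_I2)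
      fix \<omega>
      define x where "x = X \<omega> $ i - \<theta> \<omega> $ i"
      \<comment> \<open>The linear slope of the penalty is absorbed by the exponential, so
        feasibility alone makes the marginal loss integrable.\<close>
      have "max 0 (- x) \<le> exp (- x)" using exp_ge_add_one_self[of "- x"] by (simp add: max_def)
      then have "exp (- x) + 2 * m * max 0 (- x) \<le> exp (- x) + 2 * m * exp (- x)"
        using m by (intro add_left_mono mult_left_mono) auto
      also have "\<dots> = (1 + 2 * m) * exp (- x)" by (simp add: algebra_simps)
      also have "\<dots> \<le> (1 + 2 * m) * loss m x" using m by (intro mult_left_mono) (auto simp: loss_def)
      also have "\<dots> \<le> (1 + 2 * m) * total_loss m \<theta> X \<omega>"
        unfolding total_loss_def x_def using m
        by (intro mult_left_mono member_le_sum loss_nonneg) auto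
      finally show "norm (exp (- (X \<omega> $ i - \<theta> \<omega> $ i)) + 2 * m * max 0 (- (X \<omega> $ i - \<theta> \<omega> $ i)))
        \<le> norm ((1 + 2 * m) * total_loss m \<theta> X \<omega>)"
        using m total_loss_nonneg[OF m, of \<theta> X \<omega>] by (simp add: x_def)
    qed
  qed measurable
qed

text \<open>A step of length \<open>s\<close> along \<open>v\<close> lowers the risk by at least
  \<open>s * I - s\<^sup>2 * C\<close>. Minimality therefore forces \<open>I \<le> s * C\<close> for
  all small positive \<open>s\<close>.\<close>

lemma minimizer_first_order:
  assumes \<theta>: "\<theta> \<in> L0 M" and m: "0 \<le> m" and X: "minimizer m \<theta> X"
    and v: "v \<in> L0 M" and vB: "\<And>\<omega>. norm (v \<omega>) \<le> B"
    and dir: "\<And>s. 0 < s \<Longrightarrow> s \<le> 1 \<Longrightarrow> (\<lambda>\<omega>. X \<omega> + s *\<^sub>R v \<omega>) \<in> claims"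
  shows "(\<integral>\<omega>. v \<omega> \<bullet> marginal_loss m \<theta> X \<omega> \<partial>M) \<le> 0"
proof -
  have Xf: "X \<in> feasible m \<theta>" and Xmin: "\<And>Y. Y \<in> feasible m \<theta> \<Longrightarrow> risk m \<theta> X \<le> risk m \<theta> Y"
    using X by (auto simp: minimizer_def)
  have cl: "X \<in> claims" and int: "integrable M (total_loss m \<theta> X)" using Xf by (auto simp: feasible_def)
  note [measurable] = \<theta> claims_measurable[OF cl] v
  \<comment> \<open>With \<open>b \<ge> 1\<close> the single condition \<open>s \<le> 1 / b\<close>
    gives both \<open>s \<le> 1\<close>, for admissibility of the direction, and coordinates of
    \<open>s *\<^sub>R v \<omega>\<close> of size at most 1, for the second-order bound.\<close>
  define b where "b = max 1 B"
  have b: "1 \<le> b" "norm (v \<omega>) \<le> b" for \<omega> using vB[of \<omega>] by (auto simp: b_def)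
  let ?Z = "marginal_loss m \<theta> X"
  define I where "I = (\<integral>\<omega>. v \<omega> \<bullet> ?Z \<omega> \<partial>M)"
  define C where "C = b\<^sup>2 * (risk m \<theta> X + real CARD('d) * m)"
  have vZ: "integrable M (\<lambda>\<omega>. v \<omega> \<bullet> ?Z \<omega>)"
    by (rule integrable_bounded_inner[OF v vB marginal_loss_integrable[OF \<theta> m Xf]])
  have IsC: "I \<le> s * C" if s: "0 < s" "s \<le> 1 / b" for s
  proof -
    have s1: "s \<le> 1" using s(2) b(1) by (simp add: order_trans)
    define Y where "Y \<omega> = X \<omega> + s *\<^sub>R v \<omega>" for \<omega>
    have Ycl: "Y \<in> claims" unfolding Y_def using dir s s1 by simp
    note [measurable] = claims_measurable[OF Ycl]
    define R where "R \<omega> = total_loss m \<theta> X \<omega> - s * (v \<omega> \<bullet> ?Z \<omega>) + s\<^sup>2 * (b\<^sup>2 * (total_loss m \<theta> X \<omega> + real CARD('d) * m))" for \<omega>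
    have le: "total_loss m \<theta> Y \<omega> \<le> R \<omega>" for \<omega>
    proof -
      have "loss m (Y \<omega> $ i - \<theta> \<omega> $ i) \<le> loss m (X \<omega> $ i - \<theta> \<omega> $ i) - s * (v \<omega> $ i * ?Z \<omega> $ i)
          + s\<^sup>2 * (b\<^sup>2 * (loss m (X \<omega> $ i - \<theta> \<omega> $ i) + m))" for i
      proof -
        define x where "x = X \<omega> $ i - \<theta> \<omega> $ i"
        have vi: "\<bar>v \<omega> $ i\<bar> \<le> b" using order_trans[OF component_le_norm_cart b(2)] .
        have "\<bar>s * v \<omega> $ i\<bar> \<le> (1 / b) * b" unfolding abs_mult using s vi b(1) by (intro mult_mono) auto
        then have sv: "\<bar>s * v \<omega> $ i\<bar> \<le> 1" using b(1) by simp
        have "loss m (x + s * v \<omega> $ i) \<le> loss m x - (exp (- x) + 2 * m * max 0 (- x)) * (s * v \<omega> $ i) + (s * v \<omega> $ i)\<^sup>2 * (exp (- x) + m)"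
          by (rule loss_shift_le[OF m sv])
        also have "(s * v \<omega> $ i)\<^sup>2 * (exp (- x) + m) \<le> (s * b)\<^sup>2 * (loss m x + m)"
        proof (rule mult_mono)
          show "(s * v \<omega> $ i)\<^sup>2 \<le> (s * b)\<^sup>2"
            using mult_left_mono[OF vi, of s] s by (intro power2_le_iff_abs_le[THEN iffD2]) (auto simp: abs_mult)
        qed (use m in \<open>auto simp: loss_def\<close>)
        finally show ?thesis
          by (simp add: x_def Y_def marginal_loss_def algebra_simps power_mult_distrib)
      qed
      then have "total_loss m \<theta> Y \<omega> \<le> (\<Sum>i\<in>UNIV. loss m (X \<omega> $ i - \<theta> \<omega> $ i) - s * (v \<omega> $ i * ?Z \<omega> $ i)
          + s\<^sup>2 * (b\<^sup>2 * (loss m (X \<omega> $ i - \<theta> \<omega> $ i) + m)))"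
        unfolding total_loss_def by (intro sum_mono)
      also have "\<dots> = R \<omega>"
        unfolding R_def total_loss_def inner_vec_def
        by (simp add: sum.distrib sum_subtractf sum_distrib_left[symmetric])
      finally show ?thesis .
    qed
    have Rint: "integrable M R" unfolding R_def using int vZ by simp
    have Yint: "integrable M (total_loss m \<theta> Y)"
    proof (rule Bochner_Integration.integrable_bound[OF Rint])
      show "AE \<omega> in M. norm (total_loss m \<theta> Y \<omega>) \<le> norm (R \<omega>)"
      proof (intro AE_I2)
        fix \<omega> show "norm (total_loss m \<theta> Y \<omega>) \<le> norm (R \<omega>)"
          using le[of \<omega>] total_loss_nonneg[OF m, of \<theta> Y \<omega>] by simp
      qed
    qed simp
    have "risk m \<theta> X \<le> risk m \<theta> Y" using Ycl Yint by (intro Xmin) (simp add: feasible_def)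
    also have "\<dots> \<le> (\<integral>\<omega>. R \<omega> \<partial>M)" unfolding risk_def by (rule integral_mono[OF Yint Rint le])
    also have "\<dots> = risk m \<theta> X - s * I + s\<^sup>2 * C"
      unfolding R_def using int vZ by (simp add: risk_def I_def C_def prob_space)
    finally have "s * I \<le> s * (s * C)" by (simp add: power2_eq_square)
    then show ?thesis using s(1) by (simp add: mult_le_cancel_left_pos)
  qed
  have "I \<le> 0"
  proof (rule LIMSEQ_le_const)
    show "(\<lambda>k. (C / b) / real (Suc k)) \<longlonglongrightarrow> 0" by (rule LIMSEQ_Suc[OF lim_const_over_n])
    have "I \<le> (C / b) / real (Suc k)" for k
    proof -
      have "b * 1 \<le> b * real (Suc k)" using b(1) by (intro mult_left_mono) auto
      then have "1 / (b * real (Suc k)) \<le> 1 / b" using b(1) by (intro divide_left_mono) auto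
      from IsC[OF _ this] show ?thesis using b(1) by (simp add: mult.commute)
    qed
    then show "\<exists>N. \<forall>k\<ge>N. I \<le> (C / b) / real (Suc k)" by blast
  qed
  then show ?thesis by (simp add: I_def)
qed

definition conditional_vec :: "('a \<Rightarrow> real^'d) \<Rightarrow> nat \<Rightarrow> 'a \<Rightarrow> real^'d" where
  "conditional_vec Z t \<omega> = (\<chi> i. real_cond_exp M (F t) (\<lambda>\<omega>. Z \<omega> $ i) \<omega>)"

lemma integrable_vec_nth:
  fixes Z :: "'a \<Rightarrow> real^'d"
  assumes "integrable M Z" shows "integrable M (\<lambda>\<omega>. Z \<omega> $ i)"
  using integrable_inner_left[of "axis i 1" M Z] assms by (simp add: inner_axis)

lemma sigma_finite_subalgebra_F: "t \<le> T \<Longrightarrow> sigma_finite_subalgebra M (F t)"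
  by (intro finite_measure_subalgebra_is_sigma_finite finite_measure_subalgebra.intro
      finite_measure_axioms finite_measure_subalgebra_axioms.intro filtration_subalgebra)

lemma conditional_vec_measurable: "conditional_vec Z t \<in> borel_measurable (F t)"
  unfolding conditional_vec_def[abs_def] by measurable

lemma conditional_vec_integrable:
  assumes t: "t \<le> T" and Z: "integrable M Z" shows "integrable M (conditional_vec Z t)"
proof -
  interpret sigma_finite_subalgebra M "F t" by (rule sigma_finite_subalgebra_F[OF t])
  show ?thesis unfolding conditional_vec_def[abs_def]
    by (intro integrable_vec_lambda real_cond_exp_int(1) integrable_vec_nth Z)
qed

lemma conditional_vec_inner:
  assumes t: "t \<le> T" and Z: "integrable M Z" and h: "h \<in> borel_measurable (F t)" "\<And>\<omega>. norm (h \<omega>) \<le> B"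
  shows "(\<integral>\<omega>. h \<omega> \<bullet> conditional_vec Z t \<omega> \<partial>M) = (\<integral>\<omega>. h \<omega> \<bullet> Z \<omega> \<partial>M)"
proof -
  interpret sigma_finite_subalgebra M "F t" by (rule sigma_finite_subalgebra_F[OF t])
  have hM: "h \<in> borel_measurable M" by (rule measurable_from_subalg[OF filtration_subalgebra[OF t] h(1)])
  note [measurable] = h(1) hM
  have B0: "0 \<le> B" using order_trans[OF norm_ge_zero h(2)] .
  have int: "integrable M (\<lambda>\<omega>. h \<omega> $ i * Z \<omega> $ i)" for i
  proof (rule Bochner_Integration.integrable_bound)
    show "integrable M (\<lambda>\<omega>. B * Z \<omega> $ i)" using integrable_vec_nth[OF Z] by simp
    have [measurable]: "Z \<in> borel_measurable M" using Z by simp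
    show "(\<lambda>\<omega>. h \<omega> $ i * Z \<omega> $ i) \<in> borel_measurable M" by measurable
    show "AE \<omega> in M. norm (h \<omega> $ i * Z \<omega> $ i) \<le> norm (B * Z \<omega> $ i)"
    proof (intro AE_I2)
      fix \<omega>
      have "\<bar>h \<omega> $ i\<bar> \<le> B" by (rule order_trans[OF component_le_norm_cart h(2)])
      then show "norm (h \<omega> $ i * Z \<omega> $ i) \<le> norm (B * Z \<omega> $ i)"
        using B0 by (auto simp: abs_mult intro!: mult_right_mono)
    qed
  qed
  have hi: "(\<lambda>\<omega>. h \<omega> $ i) \<in> borel_measurable (F t)" for i by measurable
  have Zi: "(\<lambda>\<omega>. Z \<omega> $ i) \<in> borel_measurable M" for i using integrable_vec_nth[OF Z] by simp
  note ce = real_cond_exp_intg[OF int hi Zi]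
  show ?thesis unfolding inner_vec_def conditional_vec_def
    by (simp add: Bochner_Integration.integral_sum ce int)
qed

text \<open>The data witnessing that the closure of \<open>[\<A>, X]\<close> is arbitrage-free: a consistent price
  process \<open>Z\<close> which vanishes on the trades \<open>\<alpha> t i * \<gamma> t i\<close> financing \<open>X\<close>.\<close>

definition supporting_prices ::
    "('a \<Rightarrow> real^'d) \<Rightarrow> (nat \<Rightarrow> 'a \<Rightarrow> real^'d) \<Rightarrow> (nat \<Rightarrow> nat \<Rightarrow> 'a \<Rightarrow> real) \<Rightarrow> bool" where
  "supporting_prices X Z \<alpha> \<longleftrightarrow>
     (\<forall>t\<le>T. Z t \<in> borel_measurable (F t) \<and> integrable M (Z t)) \<and>
     (\<forall>t<T. \<forall>h\<in>borel_measurable (F t). (\<forall>\<omega>. norm (h \<omega>) \<le> 1) \<longrightarrow>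
        (\<integral>\<omega>. h \<omega> \<bullet> (Z (Suc t) \<omega> - Z t \<omega>) \<partial>M) = 0) \<and>
     (AE \<omega> in M. \<forall>i. 0 < Z T \<omega> $ i) \<and>
     (\<forall>t\<le>T. \<forall>i\<in>{1..n t}. \<alpha> t i \<in> nonneg_measurable (F t) \<and>
        (AE \<omega> in M. Z t \<omega> \<bullet> \<gamma> t i \<omega> \<le> 0 \<and> \<alpha> t i \<omega> * (Z t \<omega> \<bullet> \<gamma> t i \<omega>) = 0)) \<and>
     (AE \<omega> in M. X \<omega> = (\<Sum>t\<le>T. \<Sum>i=1..n t. \<alpha> t i \<omega> *\<^sub>R \<gamma> t i \<omega>))"

text \<open>The first-order condition makes the integral nonpositive while the integrand is
  nonnegative. It is applied to directions supported on the event where a desired inequality fails,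
  which shows that event to be null.\<close>

lemma minimizer_direction_null:
  assumes \<theta>: "\<theta> \<in> L0 M" and m: "0 \<le> m" and X: "minimizer m \<theta> X" and t: "t \<le> T"
    and v: "v \<in> borel_measurable (F t)" and vB: "\<And>\<omega>. norm (v \<omega>) \<le> B"
    and dir: "\<And>s. 0 < s \<Longrightarrow> s \<le> 1 \<Longrightarrow> (\<lambda>\<omega>. X \<omega> + s *\<^sub>R v \<omega>) \<in> claims"
    and nonneg: "\<And>\<omega>. 0 \<le> v \<omega> \<bullet> conditional_vec (marginal_loss m \<theta> X) t \<omega>"
  shows "AE \<omega> in M. v \<omega> \<bullet> conditional_vec (marginal_loss m \<theta> X) t \<omega> = 0"
proof -
  have Xf: "X \<in> feasible m \<theta>" using X by (simp add: minimizer_def)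
  note Z = marginal_loss_integrable[OF \<theta> m Xf]
  have vM: "v \<in> borel_measurable M" by (rule measurable_from_subalg[OF filtration_subalgebra[OF t] v])
  have "(\<integral>\<omega>. v \<omega> \<bullet> conditional_vec (marginal_loss m \<theta> X) t \<omega> \<partial>M) \<le> 0"
    unfolding conditional_vec_inner[OF t Z v vB] by (rule minimizer_first_order[OF \<theta> m X vM vB dir])
  then have "(\<integral>\<omega>. v \<omega> \<bullet> conditional_vec (marginal_loss m \<theta> X) t \<omega> \<partial>M) = 0"
    using nonneg by (intro order_antisym Bochner_Integration.integral_nonneg) auto
  moreover have "integrable M (\<lambda>\<omega>. v \<omega> \<bullet> conditional_vec (marginal_loss m \<theta> X) t \<omega>)"
    by (rule integrable_bounded_inner[OF vM vB conditional_vec_integrable[OF t Z]])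
  ultimately show ?thesis
    using integral_nonneg_eq_0_iff_AE[of M "\<lambda>\<omega>. v \<omega> \<bullet> conditional_vec (marginal_loss m \<theta> X) t \<omega>"] nonneg by simp
qed

text \<open>Complementary slackness: any generator may be added to the trades financing
  \<open>X\<close>, which gives the sign of \<open>Z t \<bullet> \<gamma> t i\<close>; a generator
  in use may also be reduced, which gives equality there.\<close>

lemma minimizer_supporting_prices:
  assumes \<theta>: "\<theta> \<in> L0 M" and m: "0 \<le> m" and X: "minimizer m \<theta> X"
  shows "\<exists>Z \<alpha>. supporting_prices X Z \<alpha>"
proof -
  have Xf: "X \<in> feasible m \<theta>" using X by (simp add: minimizer_def)
  then have Xcl: "X \<in> claims" by (simp add: feasible_def)
  then obtain y where y: "y \<in> exact_claims F n \<gamma> {..T}" and Xy: "AE \<omega> in M. X \<omega> = y \<omega>"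
    unfolding claims_iff by blast
  from y obtain \<alpha> where y_eq: "y = (\<lambda>\<omega>. \<Sum>t\<in>{..T}. \<Sum>i=1..n t. \<alpha> t i \<omega> *\<^sub>R \<gamma> t i \<omega>)"
    and \<alpha>: "\<And>t i. t \<in> {..T} \<Longrightarrow> i \<in> {1..n t} \<Longrightarrow> \<alpha> t i \<in> nonneg_measurable (F t)"
    by (rule exact_claimsE) blast
  define Z0 where "Z0 = marginal_loss m \<theta> X"
  define Z where "Z = conditional_vec Z0"
  have Z0: "integrable M Z0" unfolding Z0_def by (rule marginal_loss_integrable[OF \<theta> m Xf])
  have Zm: "Z t \<in> borel_measurable (F t)" for t unfolding Z_def by (rule conditional_vec_measurable)
  have Zi: "integrable M (Z t)" if "t \<le> T" for t unfolding Z_def by (rule conditional_vec_integrable[OF that Z0])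
  note null = minimizer_direction_null[OF \<theta> m X, folded Z0_def, folded Z_def]
  have mart: "(\<integral>\<omega>. h \<omega> \<bullet> (Z (Suc t) \<omega> - Z t \<omega>) \<partial>M) = 0"
    if t: "t < T" and h: "h \<in> borel_measurable (F t)" "\<And>\<omega>. norm (h \<omega>) \<le> 1" for t h
  proof -
    have hS: "h \<in> borel_measurable (F (Suc t))"
      by (rule measurable_from_subalg[OF filtration_subalgebra_mono h(1)]) (use t in auto)
    have hM: "h \<in> borel_measurable M"
      by (rule measurable_from_subalg[OF filtration_subalgebra h(1)]) (use t in auto)
    have "(\<integral>\<omega>. h \<omega> \<bullet> (Z (Suc t) \<omega> - Z t \<omega>) \<partial>M) = (\<integral>\<omega>. h \<omega> \<bullet> Z (Suc t) \<omega> \<partial>M) - (\<integral>\<omega>. h \<omega> \<bullet> Z t \<omega> \<partial>M)"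
      unfolding inner_diff_right using t
      by (intro Bochner_Integration.integral_diff integrable_bounded_inner[OF hM h(2)] Zi) auto
    also have "\<dots> = 0"
      using conditional_vec_inner[OF _ Z0 hS h(2)] conditional_vec_inner[OF _ Z0 h] t by (simp add: Z_def)
    finally show ?thesis .
  qed
  have pos: "AE \<omega> in M. \<forall>i. 0 < Z T \<omega> $ i"
  proof -
    interpret sigma_finite_subalgebra M "F T" by (rule sigma_finite_subalgebra_F) simp
    have "AE \<omega> in M. 0 < real_cond_exp M (F T) (\<lambda>\<omega>. Z0 \<omega> $ i) \<omega>" for i
    proof (rule real_cond_exp_gr_c[OF integrable_vec_nth[OF Z0]], rule AE_I2)
      show "0 < Z0 \<omega> $ i" for \<omega> using m by (auto simp: Z0_def marginal_loss_def intro!: add_pos_nonneg)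
    qed
    then have "AE \<omega> in M. \<forall>i\<in>UNIV. 0 < real_cond_exp M (F T) (\<lambda>\<omega>. Z0 \<omega> $ i) \<omega>"
      by (intro AE_finite_allI) auto
    then show ?thesis by (simp add: Z_def conditional_vec_def)
  qed
  have gen: "AE \<omega> in M. Z t \<omega> \<bullet> \<gamma> t i \<omega> \<le> 0 \<and> \<alpha> t i \<omega> * (Z t \<omega> \<bullet> \<gamma> t i \<omega>) = 0"
    if t: "t \<le> T" and i: "i \<in> {1..n t}" for t i
  proof -
    note [measurable] = Zm[of t] generators[OF t i]
    have a: "\<alpha> t i \<in> nonneg_measurable (F t)" using \<alpha> t i by simp
    then have [measurable]: "\<alpha> t i \<in> borel_measurable (F t)" and a0: "\<And>\<omega>. \<omega> \<in> space M \<Longrightarrow> 0 \<le> \<alpha> t i \<omega>"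
      by (auto simp: nonneg_measurable_def space_F[OF t])
    have single: "(\<lambda>\<omega>. c \<omega> *\<^sub>R \<gamma> t i \<omega>) \<in> claims" if "c \<in> nonneg_measurable (F t)" for c
    proof -
      have "(\<lambda>\<omega>. \<Sum>r\<in>{t}. \<Sum>k=1..n r. (if k = i then c \<omega> else 0) *\<^sub>R \<gamma> r k \<omega>) \<in> exact_claims F n \<gamma> {t}"
        using that by (intro exact_claimsI[where \<alpha> = "\<lambda>_ k \<omega>. if k = i then c \<omega> else 0"]) (auto simp: nonneg_measurable_def)
      moreover have "(\<Sum>r\<in>{t}. \<Sum>k=1..n r. (if k = i then c \<omega> else 0) *\<^sub>R \<gamma> r k \<omega>) = c \<omega> *\<^sub>R \<gamma> t i \<omega>" for \<omega>
        using i by (simp add: if_distrib[of "\<lambda>c. c *\<^sub>R _"] cong: if_cong)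
      ultimately show ?thesis using exact_claims_imp_claims[OF exact_claims_mono[OF _ t]] by simp
    qed
    \<comment> \<open>Adding \<open>\<gamma> t i\<close> is always admissible; localizing to norms
      below \<open>N\<close> makes the direction bounded.\<close>
    have 1: "AE \<omega> in M. \<not> (norm (\<gamma> t i \<omega>) \<le> real N \<and> 0 < Z t \<omega> \<bullet> \<gamma> t i \<omega>)" for N :: nat
    proof -
      define Q where "Q \<omega> \<longleftrightarrow> norm (\<gamma> t i \<omega>) \<le> real N \<and> 0 < Z t \<omega> \<bullet> \<gamma> t i \<omega>" for \<omega>
      have [measurable]: "Measurable.pred (F t) Q" unfolding Q_def by measurable
      define v where "v \<omega> = (if Q \<omega> then \<gamma> t i \<omega> else 0)" for \<omega>
      have "AE \<omega> in M. v \<omega> \<bullet> Z t \<omega> = 0"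
      proof (rule null[OF t])
        show "v \<in> borel_measurable (F t)" unfolding v_def by measurable
        show "norm (v \<omega>) \<le> real N" for \<omega> by (simp add: v_def Q_def)
        show "0 \<le> v \<omega> \<bullet> Z t \<omega>" for \<omega> by (simp add: v_def Q_def inner_commute)
        show "(\<lambda>\<omega>. X \<omega> + s *\<^sub>R v \<omega>) \<in> claims" if s: "0 < s" "s \<le> 1" for s
        proof -
          have "(\<lambda>\<omega>. (if Q \<omega> then s else 0) *\<^sub>R \<gamma> t i \<omega>) \<in> claims"
            by (rule single) (use s in \<open>auto simp: nonneg_measurable_def\<close>)
          from claims_add[OF Xcl this] show ?thesis
            by (simp add: v_def if_distrib[of "\<lambda>c. c *\<^sub>R _"] if_distrib[of "\<lambda>c. _ *\<^sub>R c"] cong: if_cong)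
        qed
      qed
      then show ?thesis
        by eventually_elim (auto simp: v_def Q_def inner_commute split: if_splits)
    qed
    \<comment> \<open>The direction now undoes a trade that is actually made, so its coefficient has
      to be bounded as well.\<close>
    have 2: "AE \<omega> in M. \<not> (norm (\<gamma> t i \<omega>) \<le> real N \<and> \<alpha> t i \<omega> \<le> real N \<and> 0 < \<alpha> t i \<omega> \<and> Z t \<omega> \<bullet> \<gamma> t i \<omega> < 0)" for N :: nat
    proof -
      define Q where "Q \<omega> \<longleftrightarrow> norm (\<gamma> t i \<omega>) \<le> real N \<and> \<alpha> t i \<omega> \<le> real N \<and> 0 < \<alpha> t i \<omega> \<and> Z t \<omega> \<bullet> \<gamma> t i \<omega> < 0" for \<omega>
      have [measurable]: "Measurable.pred (F t) Q" unfolding Q_def by measurable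
      define v where "v \<omega> = (if Q \<omega> then - \<alpha> t i \<omega> *\<^sub>R \<gamma> t i \<omega> else 0)" for \<omega>
      have "AE \<omega> in M. v \<omega> \<bullet> Z t \<omega> = 0"
      proof (rule null[OF t])
        show "v \<in> borel_measurable (F t)" unfolding v_def by measurable
        show "norm (v \<omega>) \<le> real N * real N" for \<omega>
          by (auto simp: v_def Q_def intro!: mult_mono)
        show "0 \<le> v \<omega> \<bullet> Z t \<omega>" for \<omega>
          by (auto simp: v_def Q_def inner_commute mult_le_0_iff)
        show "(\<lambda>\<omega>. X \<omega> + s *\<^sub>R v \<omega>) \<in> claims" if s: "0 < s" "s \<le> 1" for s
        proof -
          \<comment> \<open>On \<open>Q\<close> the fraction \<open>s\<close> of one trade is
            withdrawn; the coefficient stays nonnegative because \<open>s \<le> 1\<close>.\<close>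
          define \<beta> where "\<beta> r k \<omega> = (if r = t \<and> k = i \<and> Q \<omega> then (1 - s) * \<alpha> r k \<omega> else \<alpha> r k \<omega>)" for r k \<omega>
          have \<beta>: "\<beta> r k \<in> nonneg_measurable (F r)" if "r \<in> {..T}" "k \<in> {1..n r}" for r k
          proof (cases "r = t \<and> k = i")
            case True
            then show ?thesis using a s unfolding \<beta>_def by (auto simp: nonneg_measurable_def)
          next
            case False
            then have "\<beta> r k = \<alpha> r k" by (auto simp: \<beta>_def)
            then show ?thesis using \<alpha>[OF that] by simp
          qed
          have "(\<lambda>\<omega>. \<Sum>r\<in>{..T}. \<Sum>k=1..n r. \<beta> r k \<omega> *\<^sub>R \<gamma> r k \<omega>) \<in> claims"
            by (intro exact_claims_imp_claims exact_claimsI \<beta>)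
          moreover have "(\<Sum>r\<in>{..T}. \<Sum>k=1..n r. \<beta> r k \<omega> *\<^sub>R \<gamma> r k \<omega>) = y \<omega> + s *\<^sub>R v \<omega>" for \<omega>
          proof -
            have inner: "(\<Sum>k=1..n r. if r = t then if k = i then s *\<^sub>R v \<omega> else 0 else 0) = (if r = t then s *\<^sub>R v \<omega> else 0)" for r
              by (cases "r = t") (use i in auto)
            have "(\<Sum>r\<in>{..T}. \<Sum>k=1..n r. \<beta> r k \<omega> *\<^sub>R \<gamma> r k \<omega>) =
              (\<Sum>r\<in>{..T}. \<Sum>k=1..n r. \<alpha> r k \<omega> *\<^sub>R \<gamma> r k \<omega> + (if r = t then if k = i then s *\<^sub>R v \<omega> else 0 else 0))"
              by (intro sum.cong refl) (auto simp: \<beta>_def v_def algebra_simps)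
            also have "\<dots> = y \<omega> + s *\<^sub>R v \<omega>" unfolding sum.distrib inner y_eq using t by simp
            finally show ?thesis .
          qed
          ultimately have cl: "(\<lambda>\<omega>. y \<omega> + s *\<^sub>R v \<omega>) \<in> claims" by simp
          have vm: "v \<in> L0 M"
            by (rule measurable_from_subalg[OF filtration_subalgebra[OF t]]) (unfold v_def, measurable)
          show ?thesis
          proof (rule claims_cong_AE[OF cl])
            show "AE \<omega> in M. y \<omega> + s *\<^sub>R v \<omega> = X \<omega> + s *\<^sub>R v \<omega>" using Xy by eventually_elim simp
            show "(\<lambda>\<omega>. X \<omega> + s *\<^sub>R v \<omega>) \<in> L0 M" using claims_measurable[OF Xcl] vm by simp
          qed
        qed
      qed
      then show ?thesis
        by eventually_elim (auto simp: v_def Q_def inner_commute split: if_splits)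
    qed
    have "AE \<omega> in M. \<forall>N::nat. \<not> (norm (\<gamma> t i \<omega>) \<le> real N \<and> 0 < Z t \<omega> \<bullet> \<gamma> t i \<omega>)"
      "AE \<omega> in M. \<forall>N::nat. \<not> (norm (\<gamma> t i \<omega>) \<le> real N \<and> \<alpha> t i \<omega> \<le> real N \<and> 0 < \<alpha> t i \<omega> \<and> Z t \<omega> \<bullet> \<gamma> t i \<omega> < 0)"
      using 1 2 by (simp_all only: AE_all_countable) auto
    then show ?thesis using AE_space
    proof eventually_elim
      case (elim \<omega>)
      obtain N :: nat where N: "max (norm (\<gamma> t i \<omega>)) (\<alpha> t i \<omega>) \<le> real N" using real_arch_simple by blast
      have le: "Z t \<omega> \<bullet> \<gamma> t i \<omega> \<le> 0" using spec[OF elim(1), of N] N by auto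
      have "\<not> (0 < \<alpha> t i \<omega> \<and> Z t \<omega> \<bullet> \<gamma> t i \<omega> < 0)" using spec[OF elim(2), of N] N by auto
      then show ?case using le a0[OF elim(3)] by auto
    qed
  qed
  have "AE \<omega> in M. X \<omega> = (\<Sum>t\<le>T. \<Sum>i=1..n t. \<alpha> t i \<omega> *\<^sub>R \<gamma> t i \<omega>)" using Xy unfolding y_eq .
  then have "supporting_prices X Z \<alpha>"
    unfolding supporting_prices_def using Zm Zi mart pos gen \<alpha> by simp
  then show ?thesis by blast
qed

end


section \<open>The randomized market\<close>

lemma subalgebra_pair:
  assumes "subalgebra M F" "subalgebra R H" shows "subalgebra (M \<Otimes>\<^sub>M R) (F \<Otimes>\<^sub>M H)"
  unfolding subalgebra_def
proof
  show "space (F \<Otimes>\<^sub>M H) = space (M \<Otimes>\<^sub>M R)" using assms by (simp add: subalgebra_def space_pair_measure)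
  have "{a \<times> b | a b. a \<in> sets F \<and> b \<in> sets H} \<subseteq> sets (M \<Otimes>\<^sub>M R)"
    using assms by (auto simp: subalgebra_def)
  then show "sets (F \<Otimes>\<^sub>M H) \<subseteq> sets (M \<Otimes>\<^sub>M R)"
    using assms unfolding sets_pair_measure[of F H]
    by (intro sets.sigma_sets_subset') (auto simp: subalgebra_def space_pair_measure[symmetric])
qed

text \<open>Truncating the distance at 1 turns convergence in probability into convergence in mean,
  to which \<open>null_in_prob_L1\<close> applies.\<close>

lemma AE_subseq_of_L0_convergent:
  fixes f :: "nat \<Rightarrow> 'b \<Rightarrow> real^'d"
  assumes "prob_space N" and [measurable]: "\<And>k. f k \<in> L0 N" "W \<in> L0 N"
    and lim: "\<And>e. 0 < e \<Longrightarrow> (\<lambda>k. measure N {\<omega> \<in> space N. norm (f k \<omega> - W \<omega>) > e}) \<longlonglongrightarrow> 0"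
  obtains r :: "nat \<Rightarrow> nat" where "strict_mono r" "AE \<omega> in N. (\<lambda>k. f (r k) \<omega>) \<longlonglongrightarrow> W \<omega>"
proof -
  interpret prob_space N by fact
  define g where "g k \<omega> = min 1 (norm (f k \<omega> - W \<omega>))" for k \<omega>
  have [measurable]: "g k \<in> borel_measurable N" for k unfolding g_def by measurable
  have g: "0 \<le> g k \<omega>" "g k \<omega> \<le> 1" for k \<omega> by (auto simp: g_def)
  have gi: "integrable N (g k)" for k
    by (rule integrable_const_bound[of _ 1]) (use g in auto)
  define A where "A e k = {\<omega> \<in> space N. norm (f k \<omega> - W \<omega>) > e}" for e k
  have [measurable]: "A e k \<in> sets N" for e k unfolding A_def by measurable
  have le: "(\<integral>\<omega>. \<bar>g k \<omega>\<bar> \<partial>N) \<le> e + measure N (A e k)" if e: "0 < e" for e k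
  proof -
    have "(\<integral>\<omega>. \<bar>g k \<omega>\<bar> \<partial>N) \<le> (\<integral>\<omega>. e + indicator (A e k) \<omega> \<partial>N)"
    proof (rule integral_mono)
      show "\<bar>g k \<omega>\<bar> \<le> e + indicator (A e k) \<omega>" if "\<omega> \<in> space N" for \<omega>
        using that e g[of k \<omega>] by (auto simp: A_def g_def indicator_def)
    qed (use gi in \<open>auto simp: emeasure_eq_measure\<close>)
    also have "\<dots> = e + measure N (A e k)" by (simp add: prob_space emeasure_eq_measure)
    finally show ?thesis .
  qed
  have "(\<lambda>k. \<integral>\<omega>. \<bar>g k \<omega>\<bar> \<partial>N) \<longlonglongrightarrow> 0"
  proof (rule LIMSEQ_I)
    fix e :: real assume e: "0 < e"
    have "\<forall>\<^sub>F k in sequentially. measure N (A (e / 2) k) < e / 2"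
      unfolding A_def by (rule order_tendstoD(2)[OF lim]) (use e in auto)
    then obtain K where K: "\<And>k. k \<ge> K \<Longrightarrow> measure N (A (e / 2) k) < e / 2"
      by (auto simp: eventually_sequentially)
    have "norm ((\<integral>\<omega>. \<bar>g k \<omega>\<bar> \<partial>N) - 0) < e" if "k \<ge> K" for k
    proof -
      have "0 \<le> (\<integral>\<omega>. \<bar>g k \<omega>\<bar> \<partial>N)" by simp
      then show ?thesis using le[of "e / 2" k] e K[OF that] by simp
    qed
    then show "\<exists>K. \<forall>k\<ge>K. norm ((\<integral>\<omega>. \<bar>g k \<omega>\<bar> \<partial>N) - 0) < e" by blast
  qed
  from null_in_probE[OF null_in_prob_L1[OF gi this], of id]
  obtain r :: "nat \<Rightarrow> nat" where r: "strict_mono r" "AE \<omega> in N. (\<lambda>k. g (r k) \<omega>) \<longlonglongrightarrow> 0"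
    by (auto simp: strict_mono_def)
  from r(2) have "AE \<omega> in N. (\<lambda>k. f (r k) \<omega>) \<longlonglongrightarrow> W \<omega>"
  proof eventually_elim
    case (elim \<omega>)
    have "\<forall>\<^sub>F k in sequentially. g (r k) \<omega> < 1" by (rule order_tendstoD(2)[OF elim]) simp
    then have "\<forall>\<^sub>F k in sequentially. g (r k) \<omega> = norm (f (r k) \<omega> - W \<omega>)"
      by eventually_elim (auto simp: g_def)
    then have "(\<lambda>k. norm (f (r k) \<omega> - W \<omega>)) \<longlonglongrightarrow> 0" using elim by (rule Lim_transform_eventually[rotated])
    then show ?case by (simp add: tendsto_norm_zero_iff LIM_zero_iff)
  qed
  with r(1) show ?thesis by (rule that)
qed

context market
begin

section \<open>Transfer to the product space and proper maximality\<close>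

abbreviation "tilde \<equiv> tilde_M M T"
abbreviation "tilde_claims \<equiv> tilde_A M F T n \<gamma>"

lemma prob_space_tilde: "prob_space tilde"
  by (rule prob_space_tilde_M) (rule prob_space_axioms)

lemma fst_measurable_tilde: "fst \<in> tilde \<rightarrow>\<^sub>M M"
  unfolding tilde_M_def by (rule measurable_fst)

lemma fst_measurable_tilde_F: "fst \<in> tilde_F F T t \<rightarrow>\<^sub>M F t"
  unfolding tilde_F_def by (rule measurable_fst)

lemma distr_tilde_fst: "distr tilde M fst = M"
proof -
  interpret R: prob_space "rand_space T" by (rule prob_space_rand_space)
  show ?thesis unfolding tilde_M_def by (rule R.distr_pair_fst)
qed

lemma AE_tilde_fst:
  assumes "AE \<omega> in M. P \<omega>" shows "AE x in tilde. P (fst x)"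
  by (rule AE_distrD[OF fst_measurable_tilde]) (unfold distr_tilde_fst, rule assms)

lemma AE_tilde_fst_iff:
  assumes "{\<omega> \<in> space M. P \<omega>} \<in> sets M"
  shows "(AE x in tilde. P (fst x)) \<longleftrightarrow> (AE \<omega> in M. P \<omega>)"
  using AE_distr_iff[OF fst_measurable_tilde assms] unfolding distr_tilde_fst by simp

lemma integrable_tilde_fst:
  fixes f :: "'a \<Rightarrow> 'c::{banach, second_countable_topology}"
  assumes "integrable M f" shows "integrable tilde (\<lambda>x. f (fst x))"
  by (rule integrable_distr[OF fst_measurable_tilde]) (unfold distr_tilde_fst, rule assms)

lemma subalgebra_tilde:
  assumes t: "t \<le> T" shows "subalgebra tilde (tilde_F F T t)"
  unfolding tilde_M_def tilde_F_def
  by (intro subalgebra_pair filtration_subalgebra subalgebra_rand_filtration t)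

lemma subalgebra_rand_mono:
  assumes "s \<le> t" shows "subalgebra (rand_filtration T t) (rand_filtration T s)"
proof -
  let ?A = "\<lambda>t. {{w \<in> space (rand_space T). w s \<in> B} | s B. s \<in> {1..t} \<and> B \<subseteq> {1..}}"
  have "?A s \<subseteq> ?A t" using assms by fastforce
  moreover have "?A u \<subseteq> Pow (space (rand_space T))" for u by auto
  ultimately show ?thesis
    unfolding subalgebra_def rand_filtration_def
    by (auto simp: space_measure_of_conv sets_measure_of_conv dest: sigma_sets_mono')
qed

lemma subalgebra_tilde_mono:
  assumes "s \<le> t" "t \<le> T" shows "subalgebra (tilde_F F T t) (tilde_F F T s)"
  unfolding tilde_F_def by (intro subalgebra_pair filtration_subalgebra_mono subalgebra_rand_mono assms)

lemma tilde_claims_iff: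
  "X \<in> tilde_claims \<longleftrightarrow> X \<in> L0 tilde \<and>
     (\<exists>y\<in>exact_claims (tilde_F F T) n (\<lambda>t i x. \<gamma> t i (fst x)) {..T}. AE x in tilde. X x = y x)"
  unfolding tilde_A_def
proof (rule market_claims_iff)
  show "(\<lambda>x. \<gamma> t i (fst x)) \<in> borel_measurable (tilde_F F T t)" if "t \<le> T" "i \<in> {1..n t}" for t i
    by (rule measurable_compose[OF fst_measurable_tilde_F generators[OF that]])
qed (rule subalgebra_tilde)

lemma claims_imp_tilde_claims:
  assumes "X \<in> claims" shows "(\<lambda>x. X (fst x)) \<in> tilde_claims"
proof -
  obtain y where X: "X \<in> L0 M" and y: "y \<in> exact_claims F n \<gamma> {..T}" and Xy: "AE \<omega> in M. X \<omega> = y \<omega>"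
    using assms unfolding claims_iff by blast
  from y obtain \<alpha> where y_eq: "y = (\<lambda>\<omega>. \<Sum>t\<in>{..T}. \<Sum>i=1..n t. \<alpha> t i \<omega> *\<^sub>R \<gamma> t i \<omega>)"
    and \<alpha>: "\<And>t i. t \<in> {..T} \<Longrightarrow> i \<in> {1..n t} \<Longrightarrow> \<alpha> t i \<in> nonneg_measurable (F t)"
    by (rule exact_claimsE) blast
  have \<alpha>': "(\<lambda>x. \<alpha> t i (fst x)) \<in> nonneg_measurable (tilde_F F T t)" if "t \<in> {..T}" "i \<in> {1..n t}" for t i
    using \<alpha>[OF that] measurable_compose[OF fst_measurable_tilde_F, of "\<alpha> t i" t]
      measurable_space[OF fst_measurable_tilde_F, of _ t]
    by (auto simp: nonneg_measurable_def)
  have "(\<lambda>x. y (fst x)) \<in> exact_claims (tilde_F F T) n (\<lambda>t i x. \<gamma> t i (fst x)) {..T}"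
    unfolding y_eq by (rule exact_claimsI[where \<alpha> = "\<lambda>t i x. \<alpha> t i (fst x)"]) (rule \<alpha>')
  then show ?thesis unfolding tilde_claims_iff
    using AE_tilde_fst[OF Xy] measurable_compose[OF fst_measurable_tilde X] by (intro conjI bexI) auto
qed

text \<open>By Fubini: for a fixed outcome \<open>w\<close> of the randomization the section of
  \<open>h\<close> is an admissible test vector of the original market, so the inner integral is
  already zero.\<close>

lemma tilde_martingale:
  assumes t: "t \<le> T" and D: "integrable M D"
    and mart: "\<And>h. h \<in> borel_measurable (F t) \<Longrightarrow> (\<And>\<omega>. norm (h \<omega>) \<le> 1) \<Longrightarrow> (\<integral>\<omega>. h \<omega> \<bullet> D \<omega> \<partial>M) = 0"
    and h: "h \<in> borel_measurable (tilde_F F T t)" "\<And>x. norm (h x) \<le> 1"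
  shows "(\<integral>x. h x \<bullet> (D (fst x) :: real^'d) \<partial>tilde) = 0"
proof -
  interpret R: prob_space "rand_space T" by (rule prob_space_rand_space)
  interpret pair_sigma_finite M "rand_space T" ..
  have hm: "h \<in> borel_measurable tilde" by (rule measurable_from_subalg[OF subalgebra_tilde[OF t] h(1)])
  have "integrable tilde (\<lambda>x. h x \<bullet> D (fst x))"
    by (rule integrable_bounded_inner[OF hm h(2) integrable_tilde_fst[OF D]])
  moreover have "(\<lambda>(\<omega>, w). h (\<omega>, w) \<bullet> D \<omega>) = (\<lambda>x. h x \<bullet> D (fst x))" by auto
  ultimately have "(\<integral>x. h x \<bullet> D (fst x) \<partial>tilde) = (\<integral>w. (\<integral>\<omega>. h (\<omega>, w) \<bullet> D \<omega> \<partial>M) \<partial>rand_space T)"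
    unfolding tilde_M_def using integral_snd[of "\<lambda>\<omega> w. h (\<omega>, w) \<bullet> D \<omega>"] by simp
  also have "\<dots> = (\<integral>w. 0 \<partial>rand_space T)"
  proof (rule Bochner_Integration.integral_cong[OF refl])
    fix w assume "w \<in> space (rand_space T)"
    then have w: "w \<in> space (rand_filtration T t)"
      using subalgebra_rand_filtration[OF t] by (simp add: subalgebra_def)
    show "(\<integral>\<omega>. h (\<omega>, w) \<bullet> D \<omega> \<partial>M) = 0"
      using measurable_compose[OF measurable_Pair2'[OF w] h(1)[unfolded tilde_F_def]] h(2) by (intro mart) auto
  qed
  finally show ?thesis by simp
qed

text \<open>An approximating sequence in the cone is written as net trades at each date. Their
  values under \<open>Z\<close> are nonpositive, uniformly over the multiples of \<open>X\<close>
  subtracted, so the sequence meets the hypotheses of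
  \<open>no_asymptotic_arbitrage\<close>.\<close>

lemma supporting_prices_imp_properly_maximal:
  assumes X: "X \<in> claims" and supp: "supporting_prices X Z \<alpha>"
  shows "properly_maximal tilde tilde_claims (\<lambda>x. X (fst x))"
  unfolding properly_maximal_def
proof (intro conjI ballI impI)
  show "(\<lambda>x. X (fst x)) \<in> tilde_claims" by (rule claims_imp_tilde_claims[OF X])
  have Zm: "\<And>t. t \<le> T \<Longrightarrow> Z t \<in> borel_measurable (F t)" and Zi: "\<And>t. t \<le> T \<Longrightarrow> integrable M (Z t)"
    and mart: "\<And>t h. t < T \<Longrightarrow> h \<in> borel_measurable (F t) \<Longrightarrow> (\<And>\<omega>. norm (h \<omega>) \<le> 1) \<Longrightarrow>
        (\<integral>\<omega>. h \<omega> \<bullet> (Z (Suc t) \<omega> - Z t \<omega>) \<partial>M) = 0"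
    and pos: "AE \<omega> in M. \<forall>i. 0 < Z T \<omega> $ i"
    and \<alpha>: "\<And>t i. t \<le> T \<Longrightarrow> i \<in> {1..n t} \<Longrightarrow> \<alpha> t i \<in> nonneg_measurable (F t)"
    and gen: "\<And>t i. t \<le> T \<Longrightarrow> i \<in> {1..n t} \<Longrightarrow>
        AE \<omega> in M. Z t \<omega> \<bullet> \<gamma> t i \<omega> \<le> 0 \<and> \<alpha> t i \<omega> * (Z t \<omega> \<bullet> \<gamma> t i \<omega>) = 0"
    and Xeq: "AE \<omega> in M. X \<omega> = (\<Sum>t\<le>T. \<Sum>i=1..n t. \<alpha> t i \<omega> *\<^sub>R \<gamma> t i \<omega>)"
    using supp unfolding supporting_prices_def by blast+
  fix W assume W: "W \<in> L0_topology tilde closure_of cone_minus tilde_claims (\<lambda>x. X (fst x))"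
    and W0: "AE x in tilde. 0 \<le> W x"
  then obtain f where Wm: "W \<in> L0 tilde"
    and f: "\<And>k. f k \<in> cone_minus tilde_claims (\<lambda>x. X (fst x)) \<inter> L0 tilde"
    and lim: "\<And>e. 0 < e \<Longrightarrow> (\<lambda>k::nat. measure tilde {x \<in> space tilde. norm (f k x - W x) > e}) \<longlonglongrightarrow> 0"
    unfolding L0_closure_sequential[OF prob_space_tilde] by blast
  have fm: "f k \<in> L0 tilde" for k using f by simp
  obtain r :: "nat \<Rightarrow> nat" where r: "strict_mono r" "AE x in tilde. (\<lambda>k. f (r k) x) \<longlonglongrightarrow> W x"
    by (rule AE_subseq_of_L0_convergent[OF prob_space_tilde fm Wm lim]) blast+
  have ex: "\<exists>\<beta> c. 0 \<le> c \<and> (\<forall>t\<le>T. \<forall>i\<in>{1..n t}. \<beta> t i \<in> nonneg_measurable (tilde_F F T t)) \<and>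
      (AE x in tilde. f k x = (\<Sum>t\<le>T. \<Sum>i=1..n t. (\<beta> t i x - c * \<alpha> t i (fst x)) *\<^sub>R \<gamma> t i (fst x)))" for k
  proof -
    obtain a c where fk: "f k = (\<lambda>x. a x - c *\<^sub>R X (fst x))" and a: "a \<in> tilde_claims" and c: "0 \<le> c"
      using f[of k] unfolding cone_minus_def by blast
    obtain y where y: "y \<in> exact_claims (tilde_F F T) n (\<lambda>t i x. \<gamma> t i (fst x)) {..T}"
      and ay: "AE x in tilde. a x = y x" using a unfolding tilde_claims_iff by blast
    from y obtain \<beta> where y_eq: "y = (\<lambda>x. \<Sum>t\<in>{..T}. \<Sum>i=1..n t. \<beta> t i x *\<^sub>R \<gamma> t i (fst x))"
      and \<beta>: "\<And>t i. t \<in> {..T} \<Longrightarrow> i \<in> {1..n t} \<Longrightarrow> \<beta> t i \<in> nonneg_measurable (tilde_F F T t)"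
      by (rule exact_claimsE) blast
    have "AE x in tilde. f k x = (\<Sum>t\<le>T. \<Sum>i=1..n t. (\<beta> t i x - c * \<alpha> t i (fst x)) *\<^sub>R \<gamma> t i (fst x))"
      using ay AE_tilde_fst[OF Xeq] unfolding fk y_eq
      by eventually_elim (simp add: scaleR_diff_left sum_subtractf scaleR_sum_right)
    then show ?thesis using \<beta> c by (intro exI[of _ \<beta>] exI[of _ c]) auto
  qed
  have "\<forall>k. \<exists>p. 0 \<le> snd p \<and> (\<forall>t\<le>T. \<forall>i\<in>{1..n t}. fst p t i \<in> nonneg_measurable (tilde_F F T t)) \<and>
      (AE x in tilde. f k x = (\<Sum>t\<le>T. \<Sum>i=1..n t. (fst p t i x - snd p * \<alpha> t i (fst x)) *\<^sub>R \<gamma> t i (fst x)))"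
    using ex by simp
  from choice[OF this] obtain p where p: "\<And>k. 0 \<le> snd (p k)"
    "\<And>k t i. t \<le> T \<Longrightarrow> i \<in> {1..n t} \<Longrightarrow> fst (p k) t i \<in> nonneg_measurable (tilde_F F T t)"
    "\<And>k. AE x in tilde. f k x = (\<Sum>t\<le>T. \<Sum>i=1..n t. (fst (p k) t i x - snd (p k) * \<alpha> t i (fst x)) *\<^sub>R \<gamma> t i (fst x))"
    by blast
  \<comment> \<open>Net coefficients may be negative, so \<open>\<zeta> k t\<close> need not lie in
    the trading cone; only its value is controlled.\<close>
  define \<zeta> where "\<zeta> k t x = (\<Sum>i=1..n t. (fst (p k) t i x - snd (p k) * \<alpha> t i (fst x)) *\<^sub>R \<gamma> t i (fst x))" for k t x
  have \<zeta>m: "\<zeta> k t \<in> borel_measurable (tilde_F F T t)" if t: "t \<le> T" for k t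
    unfolding \<zeta>_def
  proof (intro borel_measurable_sum borel_measurable_scaleR borel_measurable_diff borel_measurable_times borel_measurable_const)
    fix i assume i: "i \<in> {1..n t}"
    show "fst (p k) t i \<in> borel_measurable (tilde_F F T t)" using p(2)[OF t i] by (simp add: nonneg_measurable_def)
    show "(\<lambda>x. \<alpha> t i (fst x)) \<in> borel_measurable (tilde_F F T t)"
      by (rule measurable_compose[OF fst_measurable_tilde_F]) (use \<alpha>[OF t i] in \<open>simp add: nonneg_measurable_def\<close>)
    show "(\<lambda>x. \<gamma> t i (fst x)) \<in> borel_measurable (tilde_F F T t)"
      by (rule measurable_compose[OF fst_measurable_tilde_F generators[OF t i]])
  qed
  have \<zeta>le: "AE x in tilde. Z t (fst x) \<bullet> \<zeta> k t x \<le> 0" if t: "t \<le> T" for k t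
  proof -
    have sp: "space (tilde_F F T t) = space tilde" using subalgebra_tilde[OF t] by (simp add: subalgebra_def)
    have "AE x in tilde. \<forall>i\<in>{1..n t}. Z t (fst x) \<bullet> \<gamma> t i (fst x) \<le> 0 \<and> \<alpha> t i (fst x) * (Z t (fst x) \<bullet> \<gamma> t i (fst x)) = 0"
      by (intro AE_finite_allI AE_tilde_fst gen t) auto
    then show ?thesis using AE_space
    proof eventually_elim
      case (elim x)
      \<comment> \<open>Since \<open>\<alpha> t i\<close> times the price of
        \<open>\<gamma> t i\<close> is zero, the part with factor \<open>snd (p k)\<close> drops
        out, whatever its size.\<close>
      have "Z t (fst x) \<bullet> \<zeta> k t x = (\<Sum>i=1..n t. fst (p k) t i x * (Z t (fst x) \<bullet> \<gamma> t i (fst x)))"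
        unfolding \<zeta>_def inner_sum_right using elim(1)
        by (intro sum.cong refl) (auto simp: left_diff_distrib)
      also have "\<dots> \<le> 0"
        using elim p(2)[OF t] sp by (intro sum_nonpos mult_nonneg_nonpos) (auto simp: nonneg_measurable_def)
      finally show ?case .
    qed
  qed
  define S where "S k t x = (\<Sum>s\<le>t. \<zeta> k s x)" for k t x
  have Sf: "AE x in tilde. \<forall>k. f k x = S k T x"
    unfolding AE_all_countable S_def \<zeta>_def using p(3) by blast
  show "AE x in tilde. W x = 0"
  proof (rule no_asymptotic_arbitrage[of tilde T "tilde_F F T" "\<lambda>t x. Z t (fst x)" "\<lambda>k. S (r k)", OF prob_space_tilde subalgebra_tilde])
    show "(\<lambda>x. Z t (fst x)) \<in> borel_measurable (tilde_F F T t)" if "t \<le> T" for t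
      by (rule measurable_compose[OF fst_measurable_tilde_F Zm[OF that]])
    show "integrable tilde (\<lambda>x. Z t (fst x))" if "t \<le> T" for t by (rule integrable_tilde_fst[OF Zi[OF that]])
    show "(\<integral>x. h x \<bullet> (Z (Suc t) (fst x) - Z t (fst x)) \<partial>tilde) = 0"
      if "t < T" "h \<in> borel_measurable (tilde_F F T t)" "\<And>x. norm (h x) \<le> 1" for t h
    proof (rule tilde_martingale[where t = t and D = "\<lambda>\<omega>. Z (Suc t) \<omega> - Z t \<omega>"])
      show "integrable M (\<lambda>\<omega>. Z (Suc t) \<omega> - Z t \<omega>)"
        using that(1) by (intro Bochner_Integration.integrable_diff Zi) auto
      show "(\<integral>\<omega>. g \<omega> \<bullet> (Z (Suc t) \<omega> - Z t \<omega>) \<partial>M) = 0"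
        if "g \<in> borel_measurable (F t)" "\<And>\<omega>. norm (g \<omega>) \<le> 1" for g
        by (rule mart[OF \<open>t < T\<close> that])
    qed (use that in auto)
    show "S (r k) t \<in> borel_measurable (tilde_F F T t)" if "t \<le> T" for k t
      unfolding S_def
    proof (rule borel_measurable_sum)
      fix s assume "s \<in> {..t}"
      then have st: "s \<le> t" by simp
      show "\<zeta> (r k) s \<in> borel_measurable (tilde_F F T t)"
        by (rule measurable_from_subalg[OF subalgebra_tilde_mono[OF st that] \<zeta>m[OF order_trans[OF st that]]])
    qed
    show "AE x in tilde. Z 0 (fst x) \<bullet> S (r k) 0 x \<le> 0" for k using \<zeta>le[of 0] by (simp add: S_def)
    show "AE x in tilde. Z (Suc t) (fst x) \<bullet> S (r k) (Suc t) x \<le> Z (Suc t) (fst x) \<bullet> S (r k) t x" if "t < T" for k t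
      using \<zeta>le[of "Suc t" "r k"] that by (auto simp: S_def inner_add_right)
    show "AE x in tilde. (\<lambda>k. S (r k) T x) \<longlonglongrightarrow> W x" using r(2) Sf by eventually_elim simp
    show "AE x in tilde. \<forall>i. 0 < Z T (fst x) $ i" by (rule AE_tilde_fst[OF pos])
  qed (use W0 in simp_all)
qed

text \<open>A claim of the original market is a competitor in the randomized one, and almost sure
  relations between functions of the first coordinate mean the same in both.\<close>

lemma maximal_of_tilde_maximal:
  assumes \<theta>: "\<theta> \<in> claims" and max: "maximal tilde tilde_claims (\<lambda>x. \<theta> (fst x))"
  shows "maximal M claims \<theta>"
  unfolding maximal_def
proof (intro conjI ballI impI \<theta>)
  fix W assume W: "W \<in> claims" and le: "AE \<omega> in M. \<theta> \<omega> \<le> W \<omega>"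
  note [measurable] = claims_measurable[OF W] claims_measurable[OF \<theta>]
  have "AE x in tilde. W (fst x) = \<theta> (fst x)"
    using bspec[OF conjunct2[OF max[unfolded maximal_def]] claims_imp_tilde_claims[OF W]] AE_tilde_fst[OF le]
    by simp
  then show "AE \<omega> in M. W \<omega> = \<theta> \<omega>"
    by (subst (asm) AE_tilde_fst_iff) auto
qed

theorem properly_maximal_approximation:
  assumes \<theta>: "\<theta> \<in> claims" and max: "maximal M claims \<theta> \<or> maximal tilde tilde_claims (\<lambda>x. \<theta> (fst x))"
  shows "\<exists>X. (\<forall>k::nat. properly_maximal tilde tilde_claims (\<lambda>x. X k (fst x))) \<and>
    (AE \<omega> in M. (\<lambda>k. X k \<omega>) \<longlonglongrightarrow> \<theta> \<omega>)"
proof -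
  have "maximal M claims \<theta>" using max maximal_of_tilde_maximal[OF \<theta>] by blast
  from minimizers_converge[OF this] obtain X where X: "\<And>k::nat. \<exists>m\<ge>0. minimizer m \<theta> (X k)"
    and lim: "AE \<omega> in M. (\<lambda>k. X k \<omega>) \<longlonglongrightarrow> \<theta> \<omega>" by blast
  have "properly_maximal tilde tilde_claims (\<lambda>x. X k (fst x))" for k
  proof -
    obtain m where m: "0 \<le> m" "minimizer m \<theta> (X k)" using X by blast
    have "X k \<in> claims" using m(2) by (simp add: minimizer_def feasible_def)
    then show ?thesis
      using minimizer_supporting_prices[OF claims_measurable[OF \<theta>] m] supporting_prices_imp_properly_maximal by blast
  qed
  with lim show ?thesis by blast
qed

end

theorem theorem4p11:
  fixes M :: "'a measure" and F :: "nat \<Rightarrow> 'a measure" and T :: nat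
    and n :: "nat \<Rightarrow> nat" and \<gamma> :: "nat \<Rightarrow> nat \<Rightarrow> 'a \<Rightarrow> real^'d"
    and \<theta> :: "'a \<Rightarrow> real^'d"
  assumes "market M F T n \<gamma>"
    and "\<theta> \<in> market_claims M F T n \<gamma>"
    and "maximal M (market_claims M F T n \<gamma>) \<theta> \<or>
         maximal (tilde_M M T) (tilde_A M F T n \<gamma>) (\<lambda>x. \<theta> (fst x))"
  shows "\<exists>\<theta>s :: nat \<Rightarrow> 'a \<times> (nat \<Rightarrow> nat) \<Rightarrow> real^'d.
           (\<forall>k\<ge>1. properly_maximal (tilde_M M T) (tilde_A M F T n \<gamma>) (\<theta>s k)) \<and>
           (AE x in tilde_M M T. (\<lambda>k. \<theta>s k x) \<longlonglongrightarrow> \<theta> (fst x))"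
proof -
  interpret market M F T n \<gamma> by fact
  obtain X where "\<And>k::nat. properly_maximal tilde tilde_claims (\<lambda>x. X k (fst x))"
    "AE \<omega> in M. (\<lambda>k. X k \<omega>) \<longlonglongrightarrow> \<theta> \<omega>"
    using properly_maximal_approximation[OF assms(2,3)] by blast
  then show ?thesis using AE_tilde_fst by (intro exI[of _ "\<lambda>k x. X k (fst x)"]) auto
qed

end
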